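(* Let $n\ge2$ be an integer, let $K$ be the Markov transition kernel of Kac's random walk on $SO(n)$, and let $D$ be the Riemannian distance on $SO(n)$ induced by the Hilbert–Schmidt inner product. Then for all Borel probability measures $\mu,\nu$ on $SO(n)$, $$W_{D,2}(\mu K,\nu K)\le\sqrt{1-\frac{1}{\binom{n}{2}}}\;W_{D,2}(\mu,\nu).$$
   Context: $M(n,\mathbb{R})$ is the space of real $n\times n$ matrices with the Hilbert–Schmidt inner product $\langle a,b\rangle_{\mathrm{hs}}=\mathrm{Tr}(a^\dagger b)$, where $a^\dagger$ is the transpose. $SO(n)=\{a\in M(n,\mathbb{R}): aa^\dagger=\mathrm{id},\ \det a=1\}$, and $D$ is the Riemannian distance on the submanifold $SO(n)$ for the Riemannian structure obtained by restricting $\langle\cdot,\cdot\rangle_{\mathrm{hs}}$ to its tangent spaces (so $D(a,b)$ is the infimum of the Hilbert–Schmidt lengths of piecewise smooth curves in $SO(n)$ from $a$ to $b$). For $1\le i<j\le n$ and $\theta\in[0,2\pi]$, $R(i,j,\theta)\in SO(n)$ is the linear map with $R(i,j,\theta)e_i=\cos\theta\, e_i+\sin\theta\, e_j$, $R(i,j,\theta)e_j=\cos\theta\, e_j-\sin\theta\, e_i$, and $R(i,j,\theta)e_k=e_k$ for $k\notin\{i,j\}$, where $e_1,\dots,e_n$ is the canonical basis of $\mathbb{R}^n$. The kernel of Kac's random walk is $$K_x(S)=\frac{1}{2\pi\binom{n}{2}}\sum_{1\le i<j\le n}\int_0^{2\pi}\delta_{R(i,j,\theta)x}(S)\,d\theta,\qquad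 x\in SO(n),\ S\subset SO(n)\text{ Borel},$$ and $\mu K(S)=\int K_x(S)\,d\mu(x)$. For a metric space $(M,d)$ and Borel probability measures $\mu,\nu$ on $M$ with finite second moments, $W_{d,2}(\mu,\nu)=\inf\left(\int d(x,y)^2\,d\eta(x,y)\right)^{1/2}$, the infimum being over all couplings $\eta$ of $\mu$ and $\nu$ (probability measures on $M\times M$ with marginals $\mu,\nu$). *)

theory Defs
  imports "HOL-Analysis.Analysis" "HOL-Probability.Probability"
begin

type_synonym 'n sqmat = "real^'n^'n"

definition hs_inner :: "'n::finite sqmat \<Rightarrow> 'n sqmat \<Rightarrow> real" where
  "hs_inner a b = trace (transpose a ** b)"

definition hs_norm :: "'n::finite sqmat \<Rightarrow> real" where
  "hs_norm a = sqrt (hs_inner a a)"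

lemma hs_inner_eq_inner: "hs_inner a b = a \<bullet> b"
  unfolding hs_inner_def trace_def matrix_matrix_mult_def transpose_def inner_vec_def
  by (simp, subst sum.swap) simp

lemma hs_norm_eq_norm: "hs_norm a = norm a"
  by (simp add: hs_norm_def hs_inner_eq_inner norm_eq_sqrt_inner)

definition SO :: "'n::finite sqmat set" where
  "SO = {a. a ** transpose a = mat 1 \<and> det a = 1}"

lemma SO_eq_rotation_matrix: "SO = {a. rotation_matrix a}"
  by (auto simp: SO_def rotation_matrix_def orthogonal_matrix matrix_left_right_inverse)

abbreviation SO_borel :: "'n::finite sqmat measure" where
  "SO_borel \<equiv> restrict_space borel SO"

(* C-infinity on the closed interval {s..t}, one-sided at the end points:
   g k is the k-th derivative of \<gamma> there. *)
definition smooth_on_interval :: "(real \<Rightarrow> 'a::real_normed_vector) \<Rightarrow> real \<Rightarrow> real \<Rightarrow> bool" where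
  "smooth_on_interval \<gamma> s t \<longleftrightarrow>
     (\<exists>g :: nat \<Rightarrow> real \<Rightarrow> 'a.
        (\<forall>x\<in>{s..t}. g 0 x = \<gamma> x) \<and>
        (\<forall>k. \<forall>x\<in>{s..t}. (g k has_vector_derivative g (Suc k) x) (at x within {s..t})))"

(* Smoothness is required up to the break points. This excludes the curves with unbounded
   derivative that piecewise_C1_differentiable_on admits, for which the integral in hs_length
   could be the default value 0. *)
definition piecewise_smooth_path :: "(real \<Rightarrow> 'a::real_normed_vector) \<Rightarrow> bool" where
  "piecewise_smooth_path \<gamma> \<longleftrightarrow> path \<gamma> \<and>
     (\<exists>(m::nat) (\<tau> :: nat \<Rightarrow> real). \<tau> 0 = 0 \<and> \<tau> m = 1 \<and>
        (\<forall>k<m. \<tau> k < \<tau> (Suc k) \<and> smooth_on_interval \<gamma> (\<tau> k) (\<tau> (Suc k))))"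

definition hs_length :: "(real \<Rightarrow> 'n::finite sqmat) \<Rightarrow> real" where
  "hs_length \<gamma> = integral {0..1} (\<lambda>t. hs_norm (vector_derivative \<gamma> (at t within {0..1})))"

definition SO_dist :: "'n::finite sqmat \<Rightarrow> 'n sqmat \<Rightarrow> real" where
  "SO_dist a b = Inf {hs_length \<gamma> | \<gamma>. piecewise_smooth_path \<gamma> \<and> path_image \<gamma> \<subseteq> SO \<and>
                                      pathstart \<gamma> = a \<and> pathfinish \<gamma> = b}"

(* The matrix whose c-th column is the image of the c-th basis vector. *)
definition kac_rotation :: "'n::finite \<Rightarrow> 'n \<Rightarrow> real \<Rightarrow> 'n sqmat" where
  "kac_rotation i j \<theta> = (\<chi> r c.
     (if c = i then cos \<theta> *\<^sub>R axis i 1 + sin \<theta> *\<^sub>R axis j 1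
      else if c = j then cos \<theta> *\<^sub>R axis j 1 - sin \<theta> *\<^sub>R axis i 1
      else axis c 1) $ r)"

lemma kac_rotation_axis:
  "kac_rotation i j \<theta> *v axis c 1 =
     (if c = i then cos \<theta> *\<^sub>R axis i 1 + sin \<theta> *\<^sub>R axis j 1
      else if c = j then cos \<theta> *\<^sub>R axis j 1 - sin \<theta> *\<^sub>R axis i 1
      else axis c 1)"
  unfolding matrix_vector_mult_basis by (simp add: column_def kac_rotation_def vec_eq_iff)

(* The order on the index type only serves to enumerate the pairs i < j. *)
definition kac_kernel_fun :: "'n::{finite,linorder} sqmat \<Rightarrow> 'n sqmat set \<Rightarrow> ennreal" where
  "kac_kernel_fun x S =
     ennreal (1 / (2 * pi * real (CARD('n) choose 2))) *
     (\<Sum>(i, j) \<in> {(i, j). i < j}.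
        \<integral>\<^sup>+\<theta>\<in>{0..2*pi}. emeasure (return SO_borel (kac_rotation i j \<theta> ** x)) S \<partial>lborel)"

definition kac_kernel :: "'n::{finite,linorder} sqmat \<Rightarrow> 'n sqmat measure" where
  "kac_kernel x = measure_of SO (sets SO_borel) (kac_kernel_fun x)"

definition kac_step :: "'n::{finite,linorder} sqmat measure \<Rightarrow> 'n sqmat measure" where
  "kac_step \<mu> = \<mu> \<bind> kac_kernel"

definition couplings :: "'a measure \<Rightarrow> 'b measure \<Rightarrow> ('a \<times> 'b) measure set" where
  "couplings \<mu> \<nu> = {\<eta>. prob_space \<eta> \<and> sets \<eta> = sets (\<mu> \<Otimes>\<^sub>M \<nu>) \<and>
                        distr \<eta> \<mu> fst = \<mu> \<and> distr \<eta> \<nu> snd = \<nu>}"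

(* For measures with finite second moments every coupling has integrable cost; the integrability
   clause keeps the default value 0 of the Bochner integral out of the infimum. *)
definition wasserstein2 :: "('a \<Rightarrow> 'a \<Rightarrow> real) \<Rightarrow> 'a measure \<Rightarrow> 'a measure \<Rightarrow> real" where
  "wasserstein2 d \<mu> \<nu> =
     Inf {sqrt (\<integral>z. (d (fst z) (snd z))\<^sup>2 \<partial>\<eta>) | \<eta>.
            \<eta> \<in> couplings \<mu> \<nu> \<and> integrable \<eta> (\<lambda>z. (d (fst z) (snd z))\<^sup>2)}"


lemma space_SO_borel [simp]: "space SO_borel = SO"
  by (simp add: space_restrict_space)

lemma SO_in_sets [simp]: "SO \<in> sets SO_borel"
  using sets.top[of "SO_borel :: 'n::finite sqmat measure"] by simp

lemma kac_rotation_add: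
  assumes "i \<noteq> j"
  shows "kac_rotation i j \<alpha> ** kac_rotation i j \<beta> = kac_rotation i j (\<alpha> + \<beta>)"
proof -
  have "(kac_rotation i j \<alpha> ** kac_rotation i j \<beta>) *v axis c 1
      = kac_rotation i j (\<alpha> + \<beta>) *v axis c 1" for c
    using assms
    by (simp add: matrix_vector_mul_assoc[symmetric] kac_rotation_axis matrix_vector_right_distrib
        matrix_vector_mult_diff_distrib matrix_vector_mult_scaleR cos_add sin_add algebra_simps)
  then show ?thesis
    by (simp add: matrix_vector_mult_basis column_def vec_eq_iff)
qed

lemma transpose_kac_rotation:
  "i \<noteq> j \<Longrightarrow> transpose (kac_rotation i j \<theta>) = kac_rotation i j (- \<theta>)"
  by (auto simp: transpose_def kac_rotation_def vec_eq_iff axis_def)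

lemma kac_rotation_0: "kac_rotation i j 0 = mat 1"
  by (auto simp: kac_rotation_def vec_eq_iff axis_def mat_def)

lemma kac_rotation_in_SO:
  assumes "i \<noteq> j"
  shows "kac_rotation i j \<theta> \<in> SO"
proof -
  let ?R = "kac_rotation i j :: real \<Rightarrow> _"
  have orth: "?R t ** transpose (?R t) = mat 1" for t
    using assms by (simp add: transpose_kac_rotation kac_rotation_add kac_rotation_0)
  have "det (?R (\<theta>/2)) * det (?R (\<theta>/2)) = det (?R \<theta>)"
    using kac_rotation_add[OF assms, of "\<theta>/2" "\<theta>/2"] by (metis det_mul field_sum_of_halves)
  moreover have "det (?R (\<theta>/2)) * det (?R (\<theta>/2)) = 1"
    using orth[of "\<theta>/2"] by (metis det_mul det_transpose det_I)
  ultimately show ?thesis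
    using orth by (simp add: SO_def)
qed

lemma SO_mult: "a \<in> SO \<Longrightarrow> b \<in> SO \<Longrightarrow> a ** b \<in> SO"
  by (auto simp: SO_eq_rotation_matrix rotation_matrix_def orthogonal_matrix_mul det_mul)

lemma continuous_kac_rotation_mult:
  fixes i j :: "'a::finite"
  shows "continuous_on UNIV (\<lambda>p::real \<times> 'a sqmat. kac_rotation i j (fst p) ** snd p)"
proof -
  have 1: "continuous_on UNIV (\<lambda>p::real \<times> 'a sqmat. kac_rotation i j (fst p) $ r $ c)" for r c
    by (cases "c = i"; cases "c = j")
       (auto simp: kac_rotation_def axis_def intro!: continuous_intros)
  have 2: "continuous_on UNIV (\<lambda>p::real \<times> 'a sqmat. snd p $ r $ c)" for r c
    by (intro continuous_intros)
  show ?thesis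
    unfolding matrix_matrix_mult_def
    by (intro continuous_on_vec_lambda continuous_on_sum continuous_on_mult 1 2)
qed

lemma measurable_kac_rotation_mult:
  fixes i j :: "'a::finite"
  assumes "i \<noteq> j"
  shows "(\<lambda>(\<theta>, x). kac_rotation i j \<theta> ** x) \<in> lborel \<Otimes>\<^sub>M SO_borel \<rightarrow>\<^sub>M SO_borel"
proof (rule measurable_restrict_space2)
  show "(\<lambda>(\<theta>, x). kac_rotation i j \<theta> ** x) \<in> space (lborel \<Otimes>\<^sub>M SO_borel) \<rightarrow> SO"
    using assms by (auto simp: space_pair_measure intro: SO_mult kac_rotation_in_SO)
  have "(\<lambda>p::real \<times> 'a sqmat. kac_rotation i j (fst p) ** snd p) \<in> borel_measurable (borel \<Otimes>\<^sub>M borel)"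
    unfolding borel_prod
    by (intro borel_measurable_continuous_onI continuous_kac_rotation_mult)
  moreover have "(\<lambda>p. (fst p, snd p)) \<in> lborel \<Otimes>\<^sub>M SO_borel \<rightarrow>\<^sub>M borel \<Otimes>\<^sub>M borel"
    by (intro measurable_Pair measurable_compose[OF measurable_snd] measurable_compose[OF measurable_fst])
       (auto intro: measurable_restrict_space1)
  ultimately show "(\<lambda>(\<theta>, x). kac_rotation i j \<theta> ** x) \<in> borel_measurable (lborel \<Otimes>\<^sub>M SO_borel)"
    unfolding split_beta by (auto dest: measurable_compose)
qed

lemma measurable_kac_return:
  assumes "i \<noteq> j" "S \<in> sets SO_borel"
  shows "(\<lambda>(x, \<theta>). emeasure (return SO_borel (kac_rotation i j \<theta> ** x)) S)
           \<in> borel_measurable (SO_borel \<Otimes>\<^sub>M lborel)"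
proof -
  have "(\<lambda>p. indicator S (case p of (x, \<theta>) \<Rightarrow> kac_rotation i j \<theta> ** x) :: ennreal)
          \<in> borel_measurable (SO_borel \<Otimes>\<^sub>M lborel)"
    using measurable_pair_swap[OF measurable_kac_rotation_mult[OF assms(1)]] assms(2)
    by (intro measurable_compose[OF _ borel_measurable_indicator[OF assms(2)]])
       (simp add: split_beta)
  then show ?thesis
    using assms(2) by (simp add: split_beta)
qed

lemma measurable_kac_return':
  assumes "i \<noteq> j" "x \<in> SO" "S \<in> sets SO_borel"
  shows "(\<lambda>\<theta>. emeasure (return SO_borel (kac_rotation i j \<theta> ** x)) S) \<in> borel_measurable lborel"
  using measurable_compose[OF measurable_Pair1' measurable_kac_return[OF assms(1,3)], of x] assms(2)
  by simp

lemma sets_kac_kernel [simp]: "sets (kac_kernel x) = sets SO_borel"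
  unfolding kac_kernel_def
  using sets.sets_measure_of_eq[of SO_borel] by simp

lemma space_kac_kernel [simp]: "space (kac_kernel x) = SO"
  using sets_eq_imp_space_eq[OF sets_kac_kernel] by simp

lemma emeasure_kac_kernel:
  assumes x: "x \<in> SO" and S: "S \<in> sets SO_borel"
  shows "emeasure (kac_kernel x) S = kac_kernel_fun x S"
proof (rule emeasure_measure_of[OF kac_kernel_def])
  show "sets SO_borel \<subseteq> Pow SO"
    using sets.space_closed[of SO_borel] by simp
  show "positive (sets (kac_kernel x)) (kac_kernel_fun x)"
    by (simp add: positive_def kac_kernel_fun_def)
  show "countably_additive (sets (kac_kernel x)) (kac_kernel_fun x)"
  proof (rule countably_additiveI)
    fix A :: "nat \<Rightarrow> 'a sqmat set"
    assume A: "range A \<subseteq> sets (kac_kernel x)" "disjoint_family A"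
    have A': "A k \<in> sets SO_borel" for k
      using A(1) by auto
    let ?f = "\<lambda>p \<theta> S. emeasure (return SO_borel (kac_rotation (fst p) (snd p) \<theta> ** x)) S"
    have "(\<Sum>k. \<integral>\<^sup>+\<theta>\<in>{0..2*pi}. ?f p \<theta> (A k) \<partial>lborel)
        = (\<integral>\<^sup>+\<theta>\<in>{0..2*pi}. ?f p \<theta> (\<Union>k. A k) \<partial>lborel)" if "fst p < snd p" for p
    proof -
      have ne: "fst p \<noteq> snd p" using that by simp
      have "(\<Sum>k. \<integral>\<^sup>+\<theta>\<in>{0..2*pi}. ?f p \<theta> (A k) \<partial>lborel)
          = (\<integral>\<^sup>+\<theta>. (\<Sum>k. ?f p \<theta> (A k) * indicator {0..2*pi} \<theta>) \<partial>lborel)"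
        by (rule nn_integral_suminf[symmetric], rule borel_measurable_times_ennreal,
            rule measurable_kac_return'[OF ne x A']) auto
      also have "\<dots> = (\<integral>\<^sup>+\<theta>\<in>{0..2*pi}. ?f p \<theta> (\<Union>k. A k) \<partial>lborel)"
      proof (intro nn_integral_cong)
        fix \<theta>
        have "(\<Sum>k. ?f p \<theta> (A k)) = ?f p \<theta> (\<Union>k. A k)"
          by (rule suminf_emeasure) (use A in auto)
        then show "(\<Sum>k. ?f p \<theta> (A k) * indicator {0..2*pi} \<theta>)
            = ?f p \<theta> (\<Union>k. A k) * indicator {0..2*pi} \<theta>"
          by (simp only: ennreal_suminf_multc)
      qed
      finally show ?thesis .
    qed
    then have "(\<Sum>p\<in>{(i, j). i < j}. \<Sum>k. \<integral>\<^sup>+\<theta>\<in>{0..2*pi}. ?f p \<theta> (A k) \<partial>lborel)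
        = (\<Sum>p\<in>{(i, j). i < j}. \<integral>\<^sup>+\<theta>\<in>{0..2*pi}. ?f p \<theta> (\<Union>k. A k) \<partial>lborel)"
      by (intro sum.cong) auto
    then show "(\<Sum>k. kac_kernel_fun x (A k)) = kac_kernel_fun x (\<Union>k. A k)"
      unfolding kac_kernel_fun_def split_beta
      by (subst ennreal_suminf_cmult, subst suminf_sum) auto
  qed
  show "S \<in> sets (kac_kernel x)" using S by simp
qed

lemma card_less_pairs: "card {(i, j). i < (j :: 'n::{finite,linorder})} = CARD('n) choose 2"
proof -
  have "bij_betw (\<lambda>(i, j). {i, j}) {(i, j). i < (j :: 'n)} {A. A \<subseteq> UNIV \<and> card A = 2}"
  proof (rule bij_betwI')
    fix A :: "'n set" assume "A \<in> {A. A \<subseteq> UNIV \<and> card A = 2}"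
    then obtain i j where "A = {i, j}" "i \<noteq> j" by (auto simp: card_2_iff)
    then show "\<exists>p\<in>{(i, j). i < j}. A = (case p of (i, j) \<Rightarrow> {i, j})"
      by (cases "i < j")
         (auto intro: bexI[of _ "(i, j)"] bexI[of _ "(j, i)"] simp: insert_commute not_less_iff_gr_or_eq)
  qed (auto simp: doubleton_eq_iff)
  then show ?thesis
    using n_subsets[of "UNIV :: 'n set" 2] by (simp add: bij_betw_same_card)
qed

lemma prob_space_kac_kernel:
  fixes x :: "'n::{finite,linorder} sqmat"
  assumes n: "2 \<le> CARD('n)" and x: "x \<in> SO"
  shows "prob_space (kac_kernel x)"
proof
  let ?C = "real (CARD('n) choose 2)"
  have C: "?C > 0"
    using n by (simp add: zero_less_binomial)
  have "(\<integral>\<^sup>+\<theta>\<in>{0..2*pi}. emeasure (return SO_borel (kac_rotation i j \<theta> ** x)) SO \<partial>lborel)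
        = ennreal (2 * pi)" if "i < j" for i j :: 'n
  proof -
    have "kac_rotation i j \<theta> ** x \<in> SO" for \<theta>
      using that x by (intro SO_mult kac_rotation_in_SO) auto
    then have "(\<integral>\<^sup>+\<theta>\<in>{0..2*pi}. emeasure (return SO_borel (kac_rotation i j \<theta> ** x)) SO \<partial>lborel)
        = (\<integral>\<^sup>+\<theta>. indicator {0..2*pi} \<theta> \<partial>lborel)"
      by (intro nn_integral_cong) simp
    also have "\<dots> = ennreal (2 * pi)" by simp
    finally show ?thesis .
  qed
  then have "(\<Sum>(i, j)\<in>{(i, j). i < (j::'n)}. \<integral>\<^sup>+\<theta>\<in>{0..2*pi}.
                emeasure (return SO_borel (kac_rotation i j \<theta> ** x)) SO \<partial>lborel)
      = (\<Sum>p\<in>{(i, j). i < (j::'n)}. ennreal (2 * pi))"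
    by (intro sum.cong) auto
  also have "\<dots> = ennreal (?C * (2 * pi))"
    by (simp add: card_less_pairs ennreal_mult' ennreal_of_nat_eq_real_of_nat)
  finally have "kac_kernel_fun x SO = ennreal (1 / (2 * pi * ?C)) * ennreal (?C * (2 * pi))"
    by (simp add: kac_kernel_fun_def)
  also have "\<dots> = 1"
    using C by (simp add: ennreal_mult'[symmetric])
  finally show "emeasure (kac_kernel x) (space (kac_kernel x)) = 1"
    using emeasure_kac_kernel[OF x SO_in_sets] by simp
qed

lemma measurable_kac_kernel:
  assumes "2 \<le> CARD('n)"
  shows "kac_kernel \<in> SO_borel \<rightarrow>\<^sub>M subprob_algebra (SO_borel :: 'n::{finite,linorder} sqmat measure)"
proof (rule measurable_subprob_algebra)
  fix S :: "'n sqmat set" assume S: "S \<in> sets SO_borel"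
  have "kac_kernel_fun x S = ennreal (1 / (2 * pi * real (CARD('n) choose 2))) *
      (\<Sum>p \<in> {(i, j). i < j}.
        \<integral>\<^sup>+\<theta>. emeasure (return SO_borel (kac_rotation (fst p) (snd p) \<theta> ** x)) S
            * indicator {0..2*pi} \<theta> \<partial>lborel)" for x
    by (simp add: kac_kernel_fun_def split_beta)
  moreover have "(\<lambda>x. \<integral>\<^sup>+\<theta>. emeasure (return SO_borel (kac_rotation i j \<theta> ** x)) S
            * indicator {0..2*pi} \<theta> \<partial>lborel) \<in> borel_measurable SO_borel" if "i < j" for i j :: 'n
  proof (rule sigma_finite_measure.borel_measurable_nn_integral[OF sigma_finite_lborel])
    have "(\<lambda>p. (case p of (x, \<theta>) \<Rightarrow> emeasure (return SO_borel (kac_rotation i j \<theta> ** x)) S)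
              * indicator {0..2*pi} (snd p)) \<in> borel_measurable (SO_borel \<Otimes>\<^sub>M lborel)"
      using that S by (intro borel_measurable_times_ennreal measurable_kac_return) auto
    then show "(\<lambda>(x, \<theta>). emeasure (return SO_borel (kac_rotation i j \<theta> ** x)) S
              * indicator {0..2*pi} \<theta>) \<in> borel_measurable (SO_borel \<Otimes>\<^sub>M lborel)"
      by (simp add: split_beta)
  qed
  ultimately have "(\<lambda>x. kac_kernel_fun x S) \<in> borel_measurable SO_borel"
    by (auto intro!: borel_measurable_times_ennreal borel_measurable_sum)
  then show "(\<lambda>x. emeasure (kac_kernel x) S) \<in> borel_measurable SO_borel"
    by (subst measurable_cong[where g = "\<lambda>x. kac_kernel_fun x S"]) (use S in \<open>auto simp: emeasure_kac_kernel\<close>)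
qed (use assms prob_space_kac_kernel prob_space_imp_subprob_space in auto)

lemma emeasure_kac_step:
  fixes \<mu> :: "'n::{finite,linorder} sqmat measure"
  assumes "2 \<le> CARD('n)" "prob_space \<mu>" "sets \<mu> = sets SO_borel" "S \<in> sets SO_borel"
  shows "emeasure (kac_step \<mu>) S = (\<integral>\<^sup>+x. kac_kernel_fun x S \<partial>\<mu>)"
proof -
  have sp: "space \<mu> = SO" using sets_eq_imp_space_eq[OF assms(3)] by simp
  have "kac_kernel \<in> \<mu> \<rightarrow>\<^sub>M subprob_algebra SO_borel"
    using measurable_kac_kernel[OF assms(1)] measurable_cong_sets[OF assms(3) refl] by blast
  then have "emeasure (kac_step \<mu>) S = (\<integral>\<^sup>+x. emeasure (kac_kernel x) S \<partial>\<mu>)"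
    unfolding kac_step_def using assms(2,4) prob_space.not_empty
    by (intro emeasure_bind) auto
  also have "\<dots> = (\<integral>\<^sup>+x. kac_kernel_fun x S \<partial>\<mu>)"
    using sp assms(4) by (intro nn_integral_cong) (simp add: emeasure_kac_kernel)
  finally show ?thesis .
qed

end

theory Submission
  imports Defs
begin

text \<open>
  Along a curve \<open>\<gamma>\<close> from \<open>x\<close> to \<open>y\<close> write \<open>\<gamma>' = H \<gamma>\<close> with \<open>H\<close> antisymmetric. For a plane \<open>(i, j)\<close> with generator
  \<open>J\<close>, the rotated curve \<open>R(i, j, \<phi>) \<gamma>\<close> has speed \<open>|\<phi>' J + H|\<close>, and the choice \<open>\<phi>' = - \<langle>H, J\<rangle> / 2\<close> makes its
  square equal to \<open>|H|\<^sup>2 - 2 H\<^sub>i\<^sub>j\<^sup>2\<close>. Since \<open>|H|\<^sup>2\<close> is the sum of \<open>2 H\<^sub>i\<^sub>j\<^sup>2\<close> over \<open>i < j\<close>, the vector of these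
  speeds has norm \<open>sqrt (C - 1) |H|\<close> with \<open>C = n choose 2\<close>, and the norm of an integral is at most the
  integral of the norm. So the angles \<open>\<phi> i j\<close> reached at the end of a nearly shortest curve satisfy
  \<open>\<Sum> D(x, R(i, j, \<phi> i j) y)\<^sup>2 \<le> (C - 1) (D(x, y) + \<epsilon>)\<^sup>2\<close>. As \<open>D\<close> is left invariant and a uniform angle is
  invariant under shifts, moving \<open>x\<close> by \<open>R(i, j, \<theta>)\<close> and \<open>y\<close> by \<open>R(i, j, \<theta> + \<phi> i j)\<close> is a coupling of the two
  kernels that contracts the mean squared distance by \<open>1 - 1 / C\<close>, globally and without passing from
  local to global contraction.
\<close>

text \<open>The angular speed in a plane is one free scalar, and the chosen one removes from H its
  orthogonal projection on J. So each plane cancels its own coordinate of H, and on average one C-th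
  of the squared speed is lost. Bounding the norm of the integrated vector of speeds, instead of
  each squared length by itself, works for every parametrisation of the curve. Two obstacles shape
  the rest. \<open>SO_dist\<close> is known only as an infimum over curves, so its finiteness,
  continuity and boundedness are derived without geodesics or charts. All three come from writing
  every rotation as a product of Givens rotations in one fixed list of planes, with angles in a
  compact interval: such products are joined to the identity by arcs of explicit length, and
  sequences of them have subsequences that converge in norm and in distance. The other obstacle is
  that the angles \<phi> i j merely exist for each pair of points, whereas a coupling needs them to
  be measurable; they are therefore picked for centres of small cells, at the price of an error that
  vanishes with the cell size.\<close>

section \<open>Smooth functions on an interval\<close>

text \<open>The \<open>n\<close>-th derivative need not be continuous; smoothness is the conjunction over all \<open>n\<close>, which
  makes closure under products and rotations a plain induction on \<open>n\<close>.\<close>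
primrec Ck :: "nat \<Rightarrow> real set \<Rightarrow> (real \<Rightarrow> 'a::real_normed_vector) \<Rightarrow> bool" where
  "Ck 0 S f \<longleftrightarrow> True"
| "Ck (Suc n) S f \<longleftrightarrow>
     (\<exists>f'. (\<forall>x\<in>S. (f has_vector_derivative f' x) (at x within S)) \<and> Ck n S f')"

lemma Ck_SucI:
  "(\<And>x. x \<in> S \<Longrightarrow> (f has_vector_derivative f' x) (at x within S)) \<Longrightarrow> Ck n S f' \<Longrightarrow> Ck (Suc n) S f"
  by auto

lemma Ck_cong: "Ck n S f \<Longrightarrow> (\<And>x. x \<in> S \<Longrightarrow> f x = g x) \<Longrightarrow> Ck n S g"
proof (cases n)
  case (Suc m)
  assume eq: "\<And>x. x \<in> S \<Longrightarrow> f x = g x" and "Ck n S f"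
  then obtain f' where f': "\<And>x. x \<in> S \<Longrightarrow> (f has_vector_derivative f' x) (at x within S)"
    and n: "Ck m S f'" by (auto simp: Suc)
  have "(g has_vector_derivative f' x) (at x within S)" if "x \<in> S" for x
    by (rule has_vector_derivative_transform[OF that _ f'[OF that]]) (simp add: eq)
  with n show ?thesis unfolding Suc by (intro Ck_SucI)
qed simp

lemma Ck_mono: "Ck (Suc n) S f \<Longrightarrow> Ck n S f"
proof (induction n arbitrary: f)
  case (Suc n)
  from Suc.prems obtain f' where "\<forall>x\<in>S. (f has_vector_derivative f' x) (at x within S)"
    and "Ck (Suc n) S f'" by auto
  then show ?case using Suc.IH[of f'] by (intro Ck_SucI) auto
qed simp

lemma Ck_const: "Ck n S (\<lambda>x. c)"
proof (induction n arbitrary: c)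
  case (Suc n)
  show ?case by (rule Ck_SucI[OF _ Suc]) (rule has_vector_derivative_const)
qed simp

lemma Ck_affine: "Ck n S (\<lambda>x. c + x *\<^sub>R d)"
proof (cases n)
  case (Suc m)
  have "((\<lambda>x. c + x *\<^sub>R d) has_vector_derivative d) (at x within S)" for x
    by (auto intro!: derivative_eq_intros)
  then show ?thesis unfolding Suc by (rule Ck_SucI[OF _ Ck_const])
qed simp

lemma Ck_add: "Ck n S f \<Longrightarrow> Ck n S g \<Longrightarrow> Ck n S (\<lambda>x. f x + g x)"
proof (induction n arbitrary: f g)
  case (Suc n)
  from Suc.prems obtain f' g' where
    "\<forall>x\<in>S. (f has_vector_derivative f' x) (at x within S)" "Ck n S f'"
    "\<forall>x\<in>S. (g has_vector_derivative g' x) (at x within S)" "Ck n S g'" by auto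
  then show ?case
    by (intro Ck_SucI[of _ _ "\<lambda>x. f' x + g' x"] has_vector_derivative_add Suc.IH) auto
qed simp

text \<open>The product rule leaves one factor undifferentiated in each summand;
  \<open>Ck_mono\<close> lowers its order so that the induction hypothesis covers both
  summands.\<close>

lemma Ck_bilinear:
  assumes "bounded_bilinear h"
  shows "Ck n S f \<Longrightarrow> Ck n S g \<Longrightarrow> Ck n S (\<lambda>x. h (f x) (g x))"
proof (induction n arbitrary: f g)
  case (Suc n)
  from Suc.prems obtain f' g' where d:
    "\<forall>x\<in>S. (f has_vector_derivative f' x) (at x within S)" "Ck n S f'"
    "\<forall>x\<in>S. (g has_vector_derivative g' x) (at x within S)" "Ck n S g'" by auto
  have "Ck n S (\<lambda>x. h (f x) (g' x) + h (f' x) (g x))"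
    by (intro Ck_add Suc.IH d Ck_mono[OF Suc.prems(1)] Ck_mono[OF Suc.prems(2)])
  then show ?case
    using d by (intro Ck_SucI[OF bounded_bilinear.has_vector_derivative[OF assms]]) auto
qed simp

lemma Ck_linear: "bounded_linear h \<Longrightarrow> Ck n S f \<Longrightarrow> Ck n S (\<lambda>x. h (f x))"
proof (induction n arbitrary: f)
  case (Suc n)
  from Suc.prems obtain f' where
    "\<forall>x\<in>S. (f has_vector_derivative f' x) (at x within S)" "Ck n S f'" by auto
  then show ?case
    using bounded_linear.has_vector_derivative[OF Suc.prems(1)] Suc.IH[OF Suc.prems(1), of f']
    by (intro Ck_SucI[of _ _ "\<lambda>x. h (f' x)"]) auto
qed simp

lemma smooth_imp_Ck: "smooth_on_interval f a b \<Longrightarrow> Ck n {a..b} f"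
proof -
  assume "smooth_on_interval f a b"
  then obtain g where g: "\<forall>x\<in>{a..b}. g 0 x = f x"
    "\<And>k. \<forall>x\<in>{a..b}. (g k has_vector_derivative g (Suc k) x) (at x within {a..b})"
    unfolding smooth_on_interval_def by auto
  have "Ck n {a..b} (g k)" for k
  proof (induction n arbitrary: k)
    case (Suc n)
    then show ?case using g(2)[of k] by (intro Ck_SucI[of _ _ "g (Suc k)"]) auto
  qed simp
  then show ?thesis using g(1) by (auto intro: Ck_cong)
qed

text \<open>\<open>Ck n\<close> may supply unrelated derivatives for different n. On a nondegenerate
  interval the derivative is unique, so iterating \<open>vector_derivative\<close> produces one
  sequence that serves for all orders.\<close>

lemma Ck_imp_smooth:
  assumes "a < b" "\<And>n. Ck n {a..b} f"
  shows "smooth_on_interval f a b"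
proof -
  let ?S = "{a..b}"
  let ?D = "\<lambda>h x. vector_derivative h (at x within ?S)"
  have D: "(\<forall>x\<in>?S. (h has_vector_derivative ?D h x) (at x within ?S)) \<and> Ck n ?S (?D h)"
    if "Ck (Suc n) ?S h" for h :: "real \<Rightarrow> 'a" and n
  proof -
    from that obtain h' where h': "\<forall>x\<in>?S. (h has_vector_derivative h' x) (at x within ?S)" "Ck n ?S h'"
      by auto
    then have eq: "?D h x = h' x" if "x \<in> ?S" for x
      using vector_derivative_within_cbox[of a b x h "h' x"] assms(1) that by simp
    have "Ck n ?S (?D h)"
      by (rule Ck_cong[OF h'(2)]) (simp add: eq)
    then show ?thesis using h'(1) eq by simp
  qed
  define g where "g k = (?D ^^ k) f" for k
  have "Ck n ?S (g k)" for n k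
  proof (induction k arbitrary: n)
    case 0
    then show ?case using assms(2) by (simp add: g_def)
  next
    case (Suc k)
    have "g (Suc k) = ?D (g k)" by (simp add: g_def)
    then show ?case using D[OF Suc] by simp
  qed
  then have "\<forall>x\<in>?S. (g k has_vector_derivative g (Suc k) x) (at x within ?S)" for k
    using D[of 0 "g k"] by (simp add: g_def)
  moreover have "g 0 = f" by (simp add: g_def)
  ultimately show ?thesis unfolding smooth_on_interval_def by (intro exI[of _ g]) auto
qed

lemma smooth_on_interval_iff_Ck: "a < b \<Longrightarrow> smooth_on_interval f a b \<longleftrightarrow> (\<forall>n. Ck n {a..b} f)"
  by (auto intro: smooth_imp_Ck Ck_imp_smooth)

text \<open>Each differentiation contributes a factor c, so the k-th derivative carries
  \<open>c ^ k\<close>. Used to move a segment to the unit interval (c = b - a) and to run two paths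
  in half the time (c = 2).\<close>

lemma smooth_on_interval_affine:
  assumes "smooth_on_interval f (c * a + d) (c * b + d)" "0 < c"
  shows "smooth_on_interval (\<lambda>x. f (c * x + d)) a b"
proof -
  from assms(1) obtain g where g: "\<forall>x\<in>{c * a + d..c * b + d}. g 0 x = f x"
    "\<And>k. \<forall>x\<in>{c * a + d..c * b + d}.
        (g k has_vector_derivative g (Suc k) x) (at x within {c * a + d..c * b + d})"
    unfolding smooth_on_interval_def by auto
  have in_range: "c * x + d \<in> {c * a + d..c * b + d}" if "x \<in> {a..b}" for x
    using that assms(2) by auto
  have "((\<lambda>x. c ^ k *\<^sub>R g k (c * x + d)) has_vector_derivative
          c ^ Suc k *\<^sub>R g (Suc k) (c * x + d)) (at x within {a..b})"
    if x: "x \<in> {a..b}" for k x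
  proof -
    have "((\<lambda>x. c * x + d) has_vector_derivative c) (at x within {a..b})"
      by (auto intro!: derivative_eq_intros)
    moreover have "(g k has_vector_derivative g (Suc k) (c * x + d))
        (at (c * x + d) within (\<lambda>x. c * x + d) ` {a..b})"
      by (rule has_vector_derivative_within_subset[OF g(2)[rule_format, OF in_range[OF x]]])
         (use in_range in blast)
    ultimately have "(g k \<circ> (\<lambda>x. c * x + d) has_vector_derivative c *\<^sub>R g (Suc k) (c * x + d))
        (at x within {a..b})"
      by (rule vector_diff_chain_within)
    from bounded_linear.has_vector_derivative[OF bounded_linear_scaleR_right this, of "c ^ k"]
    show ?thesis by (simp add: o_def mult.commute)
  qed
  then show ?thesis
    unfolding smooth_on_interval_def
    using g(1) in_range by (intro exI[of _ "\<lambda>k x. c ^ k *\<^sub>R g k (c * x + d)"]) auto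
qed

lemma smooth_on_interval_cong:
  "smooth_on_interval f a b \<Longrightarrow> (\<And>x. x \<in> {a..b} \<Longrightarrow> f x = g x) \<Longrightarrow> smooth_on_interval g a b"
  unfolding smooth_on_interval_def by force

section \<open>Matrices and rotations\<close>

lemma bounded_bilinear_matrix_mult: "bounded_bilinear ((**) :: 'n::finite sqmat \<Rightarrow> 'n sqmat \<Rightarrow> 'n sqmat)"
proof -
  have "bilinear ((**) :: 'n sqmat \<Rightarrow> 'n sqmat \<Rightarrow> 'n sqmat)"
    unfolding bilinear_def
    by (auto intro!: linearI simp: vec_eq_iff matrix_matrix_mult_def sum.distrib algebra_simps
        sum_distrib_left)
  then show ?thesis by (simp add: bilinear_conv_bounded_bilinear)
qed

text \<open>The generator J of the overview: for i \<noteq> j, the derivative at angle 0 of the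
  rotation that turns the i-th axis towards the j-th. It is skew-symmetric with norm sqrt 2.\<close>

definition kac_gen :: "'n::finite \<Rightarrow> 'n \<Rightarrow> 'n sqmat" where
  "kac_gen i j = (\<chi> r c. if r = j \<and> c = i then 1 else if r = i \<and> c = j then -1 else 0)"

text \<open>The generator stands to the right of the rotation R. If \<gamma>' = H \<gamma>, the
  velocity of R \<gamma> is then R (\<phi>' J + H) \<gamma>, and orthogonal invariance of the norm
  strips both outer factors.\<close>

lemma kac_rotation_deriv:
  assumes "i \<noteq> j"
  shows "(kac_rotation i j has_vector_derivative kac_rotation i j \<theta> ** kac_gen i j) (at \<theta> within S)"
proof -
  have m: "(kac_rotation i j \<theta> ** kac_gen i j) $ r $ c =
     (if c = i then - sin \<theta> *\<^sub>R axis i 1 + cos \<theta> *\<^sub>R axis j 1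
      else if c = j then - sin \<theta> *\<^sub>R axis j 1 - cos \<theta> *\<^sub>R axis i 1
      else 0) $ r" for r c
  proof -
    have "(kac_rotation i j \<theta> ** kac_gen i j) $ r $ c = 
       kac_rotation i j \<theta> $ r $ j * kac_gen i j $ j $ c + kac_rotation i j \<theta> $ r $ i * kac_gen i j $ i $ c"
    proof -
      have "(\<Sum>k\<in>UNIV. kac_rotation i j \<theta> $ r $ k * kac_gen i j $ k $ c)
        = (\<Sum>k\<in>{i,j}. kac_rotation i j \<theta> $ r $ k * kac_gen i j $ k $ c)"
        by (rule sum.mono_neutral_right) (auto simp: kac_gen_def)
      then show ?thesis using assms by (simp add: matrix_matrix_mult_def)
    qed
    then show ?thesis using assms by (auto simp: kac_rotation_def kac_gen_def axis_def)
  qed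
  have "((\<lambda>\<theta>. kac_rotation i j \<theta> $ r $ c) has_vector_derivative (kac_rotation i j \<theta> ** kac_gen i j) $ r $ c) (at \<theta> within S)" for r c
    unfolding m by (cases "c = i"; cases "c = j"; use assms in \<open>auto simp: kac_rotation_def axis_def has_real_derivative_iff_has_vector_derivative[symmetric] intro!: derivative_eq_intros\<close>)
  then show ?thesis
    unfolding has_vector_derivative_def has_derivative_componentwise_within[of "kac_rotation i j"]
    by (auto simp: Basis_vec_def inner_axis has_vector_derivative_def scaleR_vec_def)
qed

lemma Ck_rotation:
  assumes "i \<noteq> j"
  shows "Ck n S \<phi> \<Longrightarrow> Ck n S (\<lambda>t. kac_rotation i j (\<phi> t))"
proof (induction n arbitrary: \<phi>)
  case (Suc n)
  from Suc.prems obtain \<phi>' where d: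
    "\<forall>x\<in>S. (\<phi> has_vector_derivative \<phi>' x) (at x within S)" "Ck n S \<phi>'" by auto
  have "((\<lambda>t. kac_rotation i j (\<phi> t)) has_vector_derivative
      \<phi>' x *\<^sub>R (kac_rotation i j (\<phi> x) ** kac_gen i j)) (at x within S)" if "x \<in> S" for x
    using vector_diff_chain_within[OF d(1)[rule_format, OF that] kac_rotation_deriv[OF assms]]
    by (simp add: o_def)
  then show ?case
  proof (rule Ck_SucI)
    show "Ck n S (\<lambda>x. \<phi>' x *\<^sub>R (kac_rotation i j (\<phi> x) ** kac_gen i j))"
    by (intro Ck_bilinear[OF bounded_bilinear_scaleR] Ck_bilinear[OF bounded_bilinear_matrix_mult]
        Ck_const d(2) Suc.IH Ck_mono[OF Suc.prems])
  qed
qed simp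

lemma SO_transpose_mult: "u \<in> SO \<Longrightarrow> transpose u ** u = mat 1"
  by (simp add: SO_def matrix_left_right_inverse)

lemma SO_mult_transpose: "u \<in> SO \<Longrightarrow> u ** transpose u = mat 1"
  by (simp add: SO_def)

lemma SO_transpose: "u \<in> SO \<Longrightarrow> transpose u \<in> SO"
  using SO_transpose_mult[of u] by (simp add: SO_def)

lemma norm_transpose: "norm (transpose m) = norm (m :: 'n::finite sqmat)"
  unfolding norm_eq_sqrt_inner inner_vec_def
  by (simp add: transpose_def) (rule sum.swap)

lemma norm_SO_mult_left:
  fixes u m :: "'n::finite sqmat"
  assumes "u \<in> SO" shows "norm (u ** m) = norm m"
proof -
  have "transpose (u ** m) ** (u ** m) = transpose m ** (transpose u ** u) ** m"
    by (simp only: matrix_transpose_mul matrix_mul_assoc)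
  then have "hs_norm (u ** m) = hs_norm m"
    by (simp add: hs_norm_def hs_inner_def SO_transpose_mult[OF assms])
  then show ?thesis by (simp add: hs_norm_eq_norm)
qed

lemma norm_SO_mult_right: "u \<in> SO \<Longrightarrow> norm (m ** u) = norm (m :: 'n::finite sqmat)"
  using norm_SO_mult_left[OF SO_transpose, of u "transpose m"]
  unfolding matrix_transpose_mul[symmetric] norm_transpose .

lemma bounded_linear_matrix_mult_left: "bounded_linear (\<lambda>m. (u :: 'n::finite sqmat) ** (m :: 'n sqmat))"
  by (rule bounded_bilinear.bounded_linear_right[OF bounded_bilinear_matrix_mult])

lemma bounded_linear_transpose: "bounded_linear (transpose :: 'n::finite sqmat \<Rightarrow> 'n sqmat)"
  by (simp add: linear_conv_bounded_linear[symmetric])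
     (auto intro!: linearI simp: transpose_def vec_eq_iff)

section \<open>Curves in the rotation group and the distance\<close>

text \<open>Speaks of lengths attained by some curve, because curves can be joined and translated
  while an infimum cannot; the passage to the infimum is left to \<epsilon>-arguments.\<close>

definition SO_curve :: "'n::finite sqmat \<Rightarrow> 'n sqmat \<Rightarrow> real \<Rightarrow> bool" where
  "SO_curve x y l \<longleftrightarrow> (\<exists>\<gamma>. piecewise_smooth_path \<gamma> \<and> path_image \<gamma> \<subseteq> SO \<and>
     pathstart \<gamma> = x \<and> pathfinish \<gamma> = y \<and> hs_length \<gamma> = l)"

lemma SO_dist_eq_Inf: "SO_dist x y = Inf {l. SO_curve x y l}"
  unfolding SO_dist_def SO_curve_def by (rule arg_cong[of _ _ Inf]) auto

text \<open>A nonintegrable speed has integral 0 by convention, so both cases give a nonnegative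
  value. This bounds the set of lengths below, as \<open>Inf\<close> on the reals requires.\<close>

lemma hs_length_nonneg: "0 \<le> hs_length \<gamma>"
  unfolding hs_length_def hs_norm_eq_norm
  by (cases "(\<lambda>t. norm (vector_derivative \<gamma> (at t within {0..1}))) integrable_on {0..1}")
     (auto intro: integral_nonneg simp: not_integrable_integral)

lemma SO_curve_nonneg: "SO_curve x y l \<Longrightarrow> 0 \<le> l"
  by (auto simp: SO_curve_def hs_length_nonneg)

lemma SO_dist_le: "SO_curve x y l \<Longrightarrow> SO_dist x y \<le> l"
  unfolding SO_dist_eq_Inf by (rule cInf_lower) (auto intro!: bdd_belowI[of _ 0] SO_curve_nonneg)

section \<open>Lengths of piecewise smooth curves\<close>

lemma breakpoints_mono:
  fixes \<tau> :: "nat \<Rightarrow> real"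
  assumes "\<And>k. k < m \<Longrightarrow> \<tau> k < \<tau> (Suc k)" and "k \<le> l" "l \<le> m"
  shows "\<tau> k \<le> \<tau> l"
  using assms(2,3)
proof (induction rule: dec_induct)
  case (step n)
  then show ?case using assms(1)[of n] by simp
qed simp

lemma between_breakpoints:
  fixes \<tau> :: "nat \<Rightarrow> real"
  assumes "\<tau> 0 \<le> t" "t \<le> \<tau> m" "t \<notin> \<tau> ` {..m}"
  obtains k where "k < m" "\<tau> k < t" "t < \<tau> (Suc k)"
proof -
  have "\<exists>k<m. \<tau> k < t \<and> t < \<tau> (Suc k)"
    using assms
  proof (induction m)
    case 0
    then show ?case by auto
  next
    case (Suc m)
    show ?case
    proof (cases "t \<le> \<tau> m")
      case True
      then have "\<exists>k<m. \<tau> k < t \<and> t < \<tau> (Suc k)" using Suc by (auto simp: atMost_Suc)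
      then show ?thesis by (auto intro: less_SucI)
    next
      case False
      moreover have "t \<noteq> \<tau> (Suc m)" using Suc by auto
      ultimately show ?thesis using Suc.prems by (intro exI[of _ m]) auto
    qed
  qed
  then show ?thesis using that by blast
qed

lemma vector_derivative_inner:
  fixes f :: "real \<Rightarrow> 'a::euclidean_space"
  assumes "(f has_vector_derivative f') (at t within {a..b})" "a < t" "t < b"
  shows "(f has_vector_derivative f') (at t)"
  using assms at_within_Icc_at by metis

definition speed :: "(real \<Rightarrow> 'n::finite sqmat) \<Rightarrow> real \<Rightarrow> real" where
  "speed \<gamma> t = norm (vector_derivative \<gamma> (at t within {0..1}))"

lemma hs_length_eq: "hs_length \<gamma> = integral {0..1} (speed \<gamma>)"
  by (simp add: hs_length_def speed_def hs_norm_eq_norm cong: integral_cong)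

lemma speed_eq:
  assumes "(\<gamma> has_vector_derivative v) (at t)" "0 < t" "t < 1"
  shows "speed \<gamma> t = norm v"
proof -
  have "at t within {0..1} = at t" using assms(2,3) by (simp add: at_within_Icc_at)
  then show ?thesis using assms(1) by (simp add: speed_def vector_derivative_at)
qed

lemma smooth_obtain_derivative:
  assumes "smooth_on_interval \<gamma> s t" "s < t"
  obtains \<gamma>' where "\<And>u. u \<in> {s..t} \<Longrightarrow> (\<gamma> has_vector_derivative \<gamma>' u) (at u within {s..t})"
    and "\<And>n. Ck n {s..t} \<gamma>'"
proof -
  from assms(1) obtain g where g: "\<forall>x\<in>{s..t}. g 0 x = \<gamma> x"
    "\<And>k. \<forall>x\<in>{s..t}. (g k has_vector_derivative g (Suc k) x) (at x within {s..t})"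
    unfolding smooth_on_interval_def by auto
  show thesis
  proof
    fix u assume u: "u \<in> {s..t}"
    show "(\<gamma> has_vector_derivative g (Suc 0) u) (at u within {s..t})"
      by (rule has_vector_derivative_transform[OF u _ g(2)[of 0, rule_format, OF u]]) (use g(1) in simp)
  next
    have "smooth_on_interval (g (Suc 0)) s t"
      unfolding smooth_on_interval_def by (rule exI[of _ "\<lambda>k. g (Suc k)"]) (use g(2) in auto)
    then show "Ck n {s..t} (g (Suc 0))" for n by (rule smooth_imp_Ck)
  qed
qed

lemma continuous_on_vector_derivative':
  "(\<And>x. x \<in> S \<Longrightarrow> (f has_vector_derivative f' x) (at x within S)) \<Longrightarrow> continuous_on S f"
  unfolding continuous_on_eq_continuous_within
  using has_vector_derivative_continuous by blast

lemma Ck_continuous_on: "Ck 1 S f \<Longrightarrow> continuous_on S f"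
  unfolding One_nat_def Ck.simps using continuous_on_vector_derivative' by blast

lemma kac_gen_eq: "i \<noteq> j \<Longrightarrow> kac_gen i j = axis j (axis i 1) - axis i (axis j 1)"
  by (auto simp: kac_gen_def vec_eq_iff axis_def)

lemma inner_kac_gen: "i \<noteq> j \<Longrightarrow> h \<bullet> kac_gen i j = h $ j $ i - h $ i $ j"
  by (simp add: kac_gen_eq inner_diff_right inner_axis)

lemma norm_kac_gen: "i \<noteq> j \<Longrightarrow> norm (kac_gen i j) = sqrt 2"
  unfolding norm_eq_sqrt_inner by (simp add: inner_kac_gen) (simp add: kac_gen_def)

text \<open>At a break point the one-sided velocities of adjacent pieces may differ, and
  \<open>speed\<close> takes no controlled value there; both ends are dropped as a finite
  exceptional set.\<close>

lemma speed_has_integral_piece: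
  assumes d: "\<And>u. u \<in> {s..t} \<Longrightarrow> (\<gamma> has_vector_derivative \<gamma>' u) (at u within {s..t})"
    and c: "continuous_on {s..t} \<gamma>'" and st: "0 \<le> s" "s < t" "t \<le> 1"
  shows "(speed \<gamma> has_integral (integral {s..t} (\<lambda>u. norm (\<gamma>' u)))) {s..t}"
proof -
  have "((\<lambda>u. norm (\<gamma>' u)) has_integral (integral {s..t} (\<lambda>u. norm (\<gamma>' u)))) {s..t}"
    using c by (intro integrable_integral integrable_continuous_interval continuous_intros)
  moreover have "speed \<gamma> u = norm (\<gamma>' u)" if "u \<in> {s..t} - {s, t}" for u
    using that st by (intro speed_eq vector_derivative_inner[OF d]) auto
  ultimately show ?thesis
    by (intro has_integral_spike_finite[of "{s, t}" _ "speed \<gamma>" "\<lambda>u. norm (\<gamma>' u)"]) auto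
qed

lemma speed_integrable_breakpoints:
  assumes "\<tau> 0 = 0" "\<tau> m = 1"
    and "\<And>k. k < m \<Longrightarrow> \<tau> k < \<tau> (Suc k)" "\<And>k. k < m \<Longrightarrow> smooth_on_interval \<gamma> (\<tau> k) (\<tau> (Suc k))"
  shows "speed \<gamma> integrable_on {0..1}"
proof -
  have "k \<le> m \<Longrightarrow> speed \<gamma> integrable_on {0..\<tau> k}" for k
  proof (induction k)
    case (Suc k)
    then have k: "k < m" by simp
    obtain \<gamma>' where g: "\<And>u. u \<in> {\<tau> k..\<tau> (Suc k)} \<Longrightarrow> (\<gamma> has_vector_derivative \<gamma>' u) (at u within {\<tau> k..\<tau> (Suc k)})"
      "\<And>n. Ck n {\<tau> k..\<tau> (Suc k)} \<gamma>'"
      using smooth_obtain_derivative[OF assms(4,3)[OF k]] by blast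
    have t: "0 \<le> \<tau> k" "\<tau> (Suc k) \<le> 1"
      using breakpoints_mono[of m \<tau> 0 k] breakpoints_mono[of m \<tau> "Suc k" m] assms k by auto
    have "(speed \<gamma> has_integral integral {\<tau> k..\<tau> (Suc k)} (\<lambda>u. norm (\<gamma>' u))) {\<tau> k..\<tau> (Suc k)}"
    proof (rule speed_has_integral_piece)
      show "continuous_on {\<tau> k..\<tau> (Suc k)} \<gamma>'" by (rule Ck_continuous_on[OF g(2)])
    qed (fact g(1) t assms(3)[OF k])+
    then have "speed \<gamma> integrable_on {\<tau> k..\<tau> (Suc k)}"
      by (rule has_integral_integrable)
    then show ?case
      using Suc t assms(3)[OF k] 
      by (auto intro: Henstock_Kurzweil_Integration.integrable_combine[of 0 "\<tau> k" "\<tau> (Suc k)"])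
  qed (auto simp: assms(1) integrable_on_def intro: has_integral_refl)
  from this[of m] show ?thesis by (simp add: assms(2))
qed

text \<open>F holds all break points, 0 and 1 included, so that outside F the two-sided derivative
  exists and the unrestricted chain rule applies.\<close>

lemma piecewise_smooth_derivative:
  fixes \<gamma> :: "real \<Rightarrow> 'n::finite sqmat"
  assumes "piecewise_smooth_path \<gamma>"
  obtains F \<gamma>' where "finite F" "\<And>t. t \<in> {0..1} - F \<Longrightarrow> (\<gamma> has_vector_derivative \<gamma>' t) (at t)"
    "((\<lambda>t. norm (\<gamma>' t)) has_integral hs_length \<gamma>) {0..1}" "0 \<in> F" "1 \<in> F"
proof -
  from assms obtain m \<tau> where \<tau>: "\<tau> 0 = 0" "\<tau> m = 1"
    "\<And>k. k < m \<Longrightarrow> \<tau> k < \<tau> (Suc k)" "\<And>k. k < m \<Longrightarrow> smooth_on_interval \<gamma> (\<tau> k) (\<tau> (Suc k))"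
    unfolding piecewise_smooth_path_def by blast
  show thesis
  proof
    let ?D = "\<lambda>t. vector_derivative \<gamma> (at t)"
    show d: "(\<gamma> has_vector_derivative ?D t) (at t)" if "t \<in> {0..1} - \<tau> ` {..m}" for t
    proof -
      have "\<tau> 0 \<le> t" "t \<le> \<tau> m" "t \<notin> \<tau> ` {..m}" using that \<tau>(1,2) by auto
      then obtain k where k: "k < m" "\<tau> k < t" "t < \<tau> (Suc k)"
        by (rule between_breakpoints)
      obtain \<gamma>' where "\<And>u. u \<in> {\<tau> k..\<tau> (Suc k)} \<Longrightarrow> (\<gamma> has_vector_derivative \<gamma>' u) (at u within {\<tau> k..\<tau> (Suc k)})"
        and "\<And>n. Ck n {\<tau> k..\<tau> (Suc k)} \<gamma>'"
        using smooth_obtain_derivative[OF \<tau>(4,3)[OF k(1)]] by blast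
      then have "(\<gamma> has_vector_derivative \<gamma>' t) (at t)"
        using k by (intro vector_derivative_inner[of _ _ _ "\<tau> k" "\<tau> (Suc k)"]) auto
      then show ?thesis by (simp add: vector_derivative_at)
    qed
    have F: "0 \<in> \<tau> ` {..m}" "1 \<in> \<tau> ` {..m}" using \<tau>(1,2) by force+
    have "(speed \<gamma> has_integral hs_length \<gamma>) {0..1}"
      unfolding hs_length_eq using speed_integrable_breakpoints[OF \<tau>] by (simp add: integrable_integral)
    moreover have "norm (?D t) = speed \<gamma> t" if "t \<in> {0..1} - \<tau> ` {..m}" for t
    proof -
      have "t \<noteq> 0" "t \<noteq> 1" using that F by auto
      then show ?thesis using that by (intro speed_eq[OF d, symmetric]) auto
    qed
    ultimately show "((\<lambda>t. norm (?D t)) has_integral hs_length \<gamma>) {0..1}"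
      by (intro has_integral_spike_finite[of "\<tau> ` {..m}" _ "\<lambda>t. norm (?D t)" "speed \<gamma>"]) auto
    show "0 \<in> \<tau> ` {..m}" "1 \<in> \<tau> ` {..m}" by (fact F)+
  qed auto
qed

lemma hs_length_eqI:
  fixes \<gamma> :: "real \<Rightarrow> 'n::finite sqmat"
  assumes "finite F" "\<And>t. t \<in> {0<..<1} - F \<Longrightarrow> (\<gamma> has_vector_derivative \<gamma>' t) (at t)"
    "((\<lambda>t. norm (\<gamma>' t)) has_integral l) {0..1}"
  shows "hs_length \<gamma> = l"
proof -
  have "speed \<gamma> t = norm (\<gamma>' t)" if "t \<in> {0..1} - (F \<union> {0, 1})" for t
    using that assms(2)[of t] by (intro speed_eq) auto
  then have "(speed \<gamma> has_integral l) {0..1}"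
    using assms(1) by (intro has_integral_spike_finite[OF _ _ assms(3), of "F \<union> {0, 1}"]) auto
  then show ?thesis unfolding hs_length_eq by (rule integral_unique)
qed

text \<open>Reparametrising \<open>{a..b}\<close> affinely over the unit interval multiplies the
  speed by b - a, and this factor cancels the Jacobian of the substitution.\<close>

lemma SO_curve_segment:
  assumes "a < b" and sm: "smooth_on_interval \<gamma> a b"
    and d: "\<And>t. t \<in> {a..b} \<Longrightarrow> (\<gamma> has_vector_derivative \<gamma>' t) (at t within {a..b})"
    and c: "continuous_on {a..b} \<gamma>'" and SO: "\<gamma> ` {a..b} \<subseteq> SO"
  shows "SO_curve (\<gamma> a) (\<gamma> b) (integral {a..b} (\<lambda>t. norm (\<gamma>' t)))"
proof -
  let ?h = "\<lambda>t. (b - a) * t + a"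
  let ?\<beta> = "\<lambda>t. \<gamma> (?h t)"
  have sm': "smooth_on_interval ?\<beta> 0 1"
    using assms(1) sm by (intro smooth_on_interval_affine) auto
  obtain \<beta>' where \<beta>': "\<And>u. u \<in> {0..1} \<Longrightarrow> (?\<beta> has_vector_derivative \<beta>' u) (at u within {0..1})"
    and "\<And>n. Ck n {0..1} \<beta>'"
    using smooth_obtain_derivative[OF sm' zero_less_one] by blast
  from \<beta>' have "continuous_on {0..1} ?\<beta>"
    by (rule continuous_on_vector_derivative')
  \<comment> \<open>A single piece: with \<open>real\<close> as the sequence of break points and m =
    1 they are 0 and 1.\<close>
  then have pw: "piecewise_smooth_path ?\<beta>"
    unfolding piecewise_smooth_path_def path_def using sm'
    by (intro conjI exI[of _ 1] exI[of _ real]) auto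
  have h: "?h t \<in> {a..b}" if "t \<in> {0..1}" for t
  proof -
    have "0 \<le> (b - a) * t" "(b - a) * t \<le> b - a"
      using that assms(1) mult_left_le[of t "b - a"] by auto
    then show ?thesis by simp
  qed
  have "hs_length ?\<beta> = integral {a..b} (\<lambda>t. norm (\<gamma>' t))"
  proof (rule hs_length_eqI[of "{}"])
    fix t :: real assume "t \<in> {0<..<1} - {}"
    then have t: "0 < t" "t < 1" by auto
    have "0 < (b - a) * t" "(b - a) * t < b - a"
      using assms(1) t mult_strict_left_mono[of t 1 "b - a"] by auto
    then have "a < ?h t" "?h t < b" by auto
    then have 1: "(\<gamma> has_vector_derivative \<gamma>' (?h t)) (at (?h t))"
      using vector_derivative_inner[OF d] by auto
    have 2: "(?h has_vector_derivative (b - a)) (at t)"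
      by (auto intro!: derivative_eq_intros)
    show "(?\<beta> has_vector_derivative (b - a) *\<^sub>R \<gamma>' (?h t)) (at t)"
      using vector_diff_chain_at[OF 2 1] by (simp add: o_def)
  next
    let ?I = "integral {a..b} (\<lambda>t. norm (\<gamma>' t))"
    have "((\<lambda>t. norm (\<gamma>' t)) has_integral ?I) (cbox a b)"
      using c unfolding cbox_interval by (intro integrable_integral integrable_continuous_interval continuous_intros)
    then have "((\<lambda>t. norm (\<gamma>' ((b - a) *\<^sub>R t + a))) has_integral (1 / \<bar>b - a\<bar> ^ DIM(real)) *\<^sub>R ?I)
        ((\<lambda>x. (1 / (b - a)) *\<^sub>R x + - ((1 / (b - a)) *\<^sub>R a)) ` cbox a b)"
      by (rule has_integral_affinity) (use assms(1) in simp)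
    moreover have "(\<lambda>x. (1 / (b - a)) *\<^sub>R x + - ((1 / (b - a)) *\<^sub>R a)) ` cbox a b = {0..1}"
      using assms(1) image_affinity_atLeastAtMost[of "1 / (b - a)" "- ((1 / (b - a)) *\<^sub>R a)" a b]
      by (simp add: diff_divide_distrib[symmetric] del: image_affinity_atLeastAtMost)
    ultimately have "((\<lambda>t. norm (\<gamma>' (?h t))) has_integral (1 / (b - a)) * ?I) {0..1}"
      using assms(1) by simp
    then have "((\<lambda>t. (b - a) * norm (\<gamma>' (?h t))) has_integral (b - a) * ((1 / (b - a)) * ?I)) {0..1}"
      by (rule has_integral_mult_right)
    then show "((\<lambda>t. norm ((b - a) *\<^sub>R \<gamma>' (?h t))) has_integral ?I) {0..1}"
      using assms(1) by simp
  qed simp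
  then show ?thesis
    unfolding SO_curve_def using pw SO h
    by (intro exI[of _ ?\<beta>]) (auto simp: path_image_def pathstart_def pathfinish_def)
qed

text \<open>Left multiplication by an orthogonal matrix preserves the norm of every velocity; left
  invariance of the distance rests on this.\<close>

lemma SO_curve_mult_left:
  assumes "u \<in> SO" "SO_curve x y l"
  shows "SO_curve (u ** x) (u ** y) l"
proof -
  from assms(2) obtain \<gamma> where \<gamma>: "piecewise_smooth_path \<gamma>" "path_image \<gamma> \<subseteq> SO"
    "pathstart \<gamma> = x" "pathfinish \<gamma> = y" "hs_length \<gamma> = l"
    unfolding SO_curve_def by blast
  let ?\<beta> = "\<lambda>t. u ** \<gamma> t"
  note bl = bounded_linear_matrix_mult_left[of u]
  have "smooth_on_interval ?\<beta> s t" if "smooth_on_interval \<gamma> s t" "s < t" for s t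
    using that by (auto simp: smooth_on_interval_iff_Ck intro: Ck_linear[OF bl])
  moreover have "path ?\<beta>"
    using \<gamma>(1) unfolding piecewise_smooth_path_def path_def
    by (auto intro: bounded_linear.continuous_on[OF bl])
  ultimately have pw: "piecewise_smooth_path ?\<beta>"
    using \<gamma>(1) unfolding piecewise_smooth_path_def by blast
  obtain F \<gamma>' where F: "finite F" "\<And>t. t \<in> {0..1} - F \<Longrightarrow> (\<gamma> has_vector_derivative \<gamma>' t) (at t)"
    "((\<lambda>t. norm (\<gamma>' t)) has_integral hs_length \<gamma>) {0..1}"
    using piecewise_smooth_derivative[OF \<gamma>(1)] by metis
  have "hs_length ?\<beta> = l"
    by (rule hs_length_eqI[OF F(1), of _ "\<lambda>t. u ** \<gamma>' t"])
       (use F \<gamma>(5) in \<open>auto intro!: bounded_linear.has_vector_derivative[OF bl] simp: norm_SO_mult_left[OF assms(1)]\<close>)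
  then show ?thesis
    unfolding SO_curve_def using pw \<gamma> assms(1)
    by (intro exI[of _ ?\<beta>]) (auto simp: path_image_def pathstart_def pathfinish_def intro!: SO_mult)
qed

text \<open>Each half of a joined path is run at double speed over half the time. Nothing is asked
  of k at 0, 1/2 and 1, where the velocity of the join is uncontrolled.\<close>

lemma has_integral_join_halves:
  fixes f g :: "real \<Rightarrow> real"
  assumes "(f has_integral a) {0..1}" "(g has_integral b) {0..1}"
    and "\<And>t. 0 < t \<Longrightarrow> t < 1/2 \<Longrightarrow> k t = 2 * f (2 * t)"
    and "\<And>t. 1/2 < t \<Longrightarrow> t < 1 \<Longrightarrow> k t = 2 * g (2 * t - 1)"
  shows "(k has_integral a + b) {0..1}"
proof -
  have im: "(\<lambda>x. (x - c) / 2) ` {0..1} = {- c / 2..(1 - c) / 2}" for c :: real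
  proof (intro equalityI subsetI)
    fix t assume "t \<in> {- c / 2..(1 - c) / 2}"
    then show "t \<in> (\<lambda>x. (x - c) / 2) ` {0..1}"
      by (intro image_eqI[of _ _ "2 * t + c"]) auto
  qed auto
  have 1: "((\<lambda>t. 2 * f (2 * t + 0)) has_integral 2 * ((1/2) * a)) {0..1/2}"
    using has_integral_affinity[OF assms(1)[folded cbox_interval], of 2 0] im[of 0]
    by (intro has_integral_mult_right) (simp add: cbox_interval image_image)
  have 2: "((\<lambda>t. 2 * g (2 * t + (-1))) has_integral 2 * ((1/2) * b)) {1/2..1}"
    using has_integral_affinity[OF assms(2)[folded cbox_interval], of 2 "-1"] im[of "-1"]
    by (intro has_integral_mult_right) (simp add: cbox_interval diff_divide_distrib add_divide_distrib)
  have "(k has_integral a) {0..1/2}"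
    by (rule has_integral_spike_finite[of "{0,1/2}" _ _ "\<lambda>t. 2 * f (2 * t + 0)"]) (use 1 assms(3) in auto)
  moreover have "(k has_integral b) {1/2..1}"
    by (rule has_integral_spike_finite[of "{1/2,1}" _ _ "\<lambda>t. 2 * g (2 * t + (-1))"]) (use 2 assms(4) in auto)
  ultimately show ?thesis
    using has_integral_combine[of 0 "1/2" 1 k a b] by simp
qed

lemma piecewise_smooth_path_join:
  fixes \<gamma>1 \<gamma>2 :: "real \<Rightarrow> 'a::euclidean_space"
  assumes "piecewise_smooth_path \<gamma>1" "piecewise_smooth_path \<gamma>2" "pathfinish \<gamma>1 = pathstart \<gamma>2"
  shows "piecewise_smooth_path (\<gamma>1 +++ \<gamma>2)"
proof -
  from assms(1) obtain m \<tau> where \<tau>: "\<tau> 0 = 0" "\<tau> m = 1"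
    "\<And>k. k < m \<Longrightarrow> \<tau> k < \<tau> (Suc k)" "\<And>k. k < m \<Longrightarrow> smooth_on_interval \<gamma>1 (\<tau> k) (\<tau> (Suc k))"
    unfolding piecewise_smooth_path_def by blast
  from assms(2) obtain m' \<sigma> where \<sigma>: "\<sigma> 0 = 0" "\<sigma> m' = 1"
    "\<And>k. k < m' \<Longrightarrow> \<sigma> k < \<sigma> (Suc k)" "\<And>k. k < m' \<Longrightarrow> smooth_on_interval \<gamma>2 (\<sigma> k) (\<sigma> (Suc k))"
    unfolding piecewise_smooth_path_def by blast
  \<comment> \<open>The halved break points of \<gamma>1, then those of \<gamma>2; at k = m both
    branches give 1/2. As m' \<noteq> 0, the last break point falls into the second branch and
    equals 1.\<close>
  define \<rho> where "\<rho> k = (if k \<le> m then \<tau> k / 2 else 1/2 + \<sigma> (k - m) / 2)" for k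
  have m': "m' \<noteq> 0" using \<sigma> by (intro notI) auto
  have \<rho>': "\<rho> k = 1/2 + \<sigma> (k - m) / 2" if "m \<le> k" for k
    using that \<tau>(2) \<sigma>(1) by (cases "k = m") (auto simp: \<rho>_def)
  have "\<rho> k < \<rho> (Suc k) \<and> smooth_on_interval (\<gamma>1 +++ \<gamma>2) (\<rho> k) (\<rho> (Suc k))" if k: "k < m + m'" for k
  proof (cases "k < m")
    case True
    then have r: "\<rho> k = \<tau> k / 2" "\<rho> (Suc k) = \<tau> (Suc k) / 2" by (auto simp: \<rho>_def)
    have le: "\<tau> (Suc k) \<le> 1" using breakpoints_mono[of m \<tau> "Suc k" m] \<tau> True by auto
    have "smooth_on_interval (\<lambda>x. \<gamma>1 (2 * x + 0)) (\<tau> k / 2) (\<tau> (Suc k) / 2)"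
      using \<tau>(4)[OF True] by (intro smooth_on_interval_affine) auto
    then have "smooth_on_interval (\<gamma>1 +++ \<gamma>2) (\<tau> k / 2) (\<tau> (Suc k) / 2)"
      by (rule smooth_on_interval_cong) (use le in \<open>auto simp: joinpaths_def\<close>)
    then show ?thesis using \<tau>(3)[OF True] by (simp add: r)
  next
    case False
    define j where "j = k - m"
    have j: "j < m'" "k = m + j" using False k by (auto simp: j_def)
    have r: "\<rho> k = 1/2 + \<sigma> j / 2" "\<rho> (Suc k) = 1/2 + \<sigma> (Suc j) / 2"
      using \<rho>'[of k] \<rho>'[of "Suc k"] by (auto simp: j Suc_diff_le)
    have ge: "0 \<le> \<sigma> j" using breakpoints_mono[of m' \<sigma> 0 j] \<sigma> j by auto
    have "smooth_on_interval (\<lambda>x. \<gamma>2 (2 * x + (-1))) (1/2 + \<sigma> j / 2) (1/2 + \<sigma> (Suc j) / 2)"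
      using \<sigma>(4)[OF j(1)] by (intro smooth_on_interval_affine) auto
    then have "smooth_on_interval (\<gamma>1 +++ \<gamma>2) (1/2 + \<sigma> j / 2) (1/2 + \<sigma> (Suc j) / 2)"
    proof (rule smooth_on_interval_cong)
      fix x assume x: "x \<in> {1/2 + \<sigma> j / 2..1/2 + \<sigma> (Suc j) / 2}"
      show "\<gamma>2 (2 * x + (-1)) = (\<gamma>1 +++ \<gamma>2) x"
      \<comment> \<open>At 1/2 the join takes the value of \<gamma>1, which is that of \<gamma>2
        because the ends match.\<close>
      proof (cases "x = 1/2")
        case True
        show ?thesis unfolding True using assms(3)
          by (simp add: joinpaths_def pathfinish_def pathstart_def)
      next
        case False
        then show ?thesis using x ge by (auto simp: joinpaths_def)
      qed
    qed
    then show ?thesis using \<sigma>(3)[OF j(1)] by (simp add: r)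
  qed
  moreover have "\<rho> 0 = 0" "\<rho> (m + m') = 1"
    using \<tau> \<sigma> m' by (auto simp: \<rho>_def)
  moreover have "path (\<gamma>1 +++ \<gamma>2)"
    using assms by (auto simp: piecewise_smooth_path_def)
  ultimately show ?thesis unfolding piecewise_smooth_path_def by blast
qed

lemma SO_curve_join:
  assumes "SO_curve x y l" "SO_curve y z l'"
  shows "SO_curve x z (l + l')"
proof -
  from assms(1) obtain \<gamma>1 where \<gamma>1: "piecewise_smooth_path \<gamma>1" "path_image \<gamma>1 \<subseteq> SO"
    "pathstart \<gamma>1 = x" "pathfinish \<gamma>1 = y" "hs_length \<gamma>1 = l"
    unfolding SO_curve_def by blast
  from assms(2) obtain \<gamma>2 where \<gamma>2: "piecewise_smooth_path \<gamma>2" "path_image \<gamma>2 \<subseteq> SO"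
    "pathstart \<gamma>2 = y" "pathfinish \<gamma>2 = z" "hs_length \<gamma>2 = l'"
    unfolding SO_curve_def by blast
  obtain F1 d1 where F1: "finite F1" "\<And>t. t \<in> {0..1} - F1 \<Longrightarrow> (\<gamma>1 has_vector_derivative d1 t) (at t)"
    "((\<lambda>t. norm (d1 t)) has_integral l) {0..1}"
    using piecewise_smooth_derivative[OF \<gamma>1(1)] \<gamma>1(5) by metis
  obtain F2 d2 where F2: "finite F2" "\<And>t. t \<in> {0..1} - F2 \<Longrightarrow> (\<gamma>2 has_vector_derivative d2 t) (at t)"
    "((\<lambda>t. norm (d2 t)) has_integral l') {0..1}"
    using piecewise_smooth_derivative[OF \<gamma>2(1)] \<gamma>2(5) by metis
  define d where "d t = (if t < 1/2 then 2 *\<^sub>R d1 (2 * t) else 2 *\<^sub>R d2 (2 * t - 1))" for t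
  have "hs_length (\<gamma>1 +++ \<gamma>2) = l + l'"
  proof (rule hs_length_eqI[of "{1/2} \<union> (\<lambda>t. t / 2) ` F1 \<union> (\<lambda>t. (t + 1) / 2) ` F2" _ d])
    show "((\<lambda>t. norm (d t)) has_integral l + l') {0..1}"
      by (rule has_integral_join_halves[OF F1(3) F2(3)]) (auto simp: d_def)
  next
    fix t :: real assume "t \<in> {0<..<1} - ({1/2} \<union> (\<lambda>t. t / 2) ` F1 \<union> (\<lambda>t. (t + 1) / 2) ` F2)"
    then have t: "0 < t" "t < 1" "t \<noteq> 1/2" and t1: "t \<notin> (\<lambda>t. t / 2) ` F1"
      and t2: "t \<notin> (\<lambda>t. (t + 1) / 2) ` F2" by auto
    have F: "2 * t \<notin> F1" "2 * t - 1 \<notin> F2"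
      using t1 t2 imageI[of "2 * t" F1 "\<lambda>t. t / 2"] imageI[of "2 * t - 1" F2 "\<lambda>t. (t + 1) / 2"]
      by auto
    show "(\<gamma>1 +++ \<gamma>2 has_vector_derivative d t) (at t)"
    proof (cases "t < 1/2")
      case True
      have "((\<lambda>t. 2 * t) has_vector_derivative 2) (at t)" by (auto intro!: derivative_eq_intros)
      moreover have "(\<gamma>1 has_vector_derivative d1 (2 * t)) (at (2 * t))"
        using t F True by (intro F1(2)) auto
      ultimately have "(\<gamma>1 \<circ> (\<lambda>t. 2 * t) has_vector_derivative 2 *\<^sub>R d1 (2 * t)) (at t)"
        by (rule vector_diff_chain_at)
      then have "(\<gamma>1 \<circ> (\<lambda>t. 2 * t) has_vector_derivative d t) (at t)"
        using True by (simp add: d_def)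
      then show ?thesis
        by (rule has_vector_derivative_transform_within_open[of _ _ _ "{..<1/2}"])
           (use True in \<open>auto simp: joinpaths_def\<close>)
    next
      case False
      have "((\<lambda>t. 2 * t - 1) has_vector_derivative 2) (at t)" by (auto intro!: derivative_eq_intros)
      moreover have "(\<gamma>2 has_vector_derivative d2 (2 * t - 1)) (at (2 * t - 1))"
        using t F False by (intro F2(2)) auto
      ultimately have "(\<gamma>2 \<circ> (\<lambda>t. 2 * t - 1) has_vector_derivative 2 *\<^sub>R d2 (2 * t - 1)) (at t)"
        by (rule vector_diff_chain_at)
      then have "(\<gamma>2 \<circ> (\<lambda>t. 2 * t - 1) has_vector_derivative d t) (at t)"
        using False by (simp add: d_def)
      then show ?thesis
        by (rule has_vector_derivative_transform_within_open[of _ _ _ "{1/2<..}"])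
           (use False t in \<open>auto simp: joinpaths_def\<close>)
    qed
  qed (use F1 F2 in auto)
  moreover have "path_image (\<gamma>1 +++ \<gamma>2) \<subseteq> SO"
    using \<gamma>1 \<gamma>2 path_image_join_subset by blast
  ultimately show ?thesis
    unfolding SO_curve_def using \<gamma>1 \<gamma>2 piecewise_smooth_path_join[OF \<gamma>1(1) \<gamma>2(1)]
    by (intro exI[of _ "\<gamma>1 +++ \<gamma>2"]) auto
qed

text \<open>Turning with constant angular speed \<theta>' - \<theta>; the generator has norm sqrt 2
  and the rotations around it do not change the norm. These arcs supply the explicit bounds from
  which finiteness and continuity of the distance follow.\<close>

lemma SO_curve_rotation:
  assumes "i \<noteq> j" "x \<in> SO"
  shows "SO_curve (kac_rotation i j \<theta> ** x) (kac_rotation i j \<theta>' ** x) (sqrt 2 * \<bar>\<theta>' - \<theta>\<bar>)"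
proof -
  let ?\<phi> = "\<lambda>t. \<theta> + t *\<^sub>R (\<theta>' - \<theta>)"
  let ?\<gamma> = "\<lambda>t. kac_rotation i j (?\<phi> t) ** x"
  let ?\<gamma>' = "\<lambda>t. ((\<theta>' - \<theta>) *\<^sub>R (kac_rotation i j (?\<phi> t) ** kac_gen i j)) ** x"
  note bl = bounded_bilinear.bounded_linear_left[OF bounded_bilinear_matrix_mult, of x]
  have ck: "Ck n {0..1} (\<lambda>t. kac_rotation i j (?\<phi> t))" for n
    by (intro Ck_rotation[OF assms(1)] Ck_affine)
  have R: "((\<lambda>t. kac_rotation i j (?\<phi> t)) has_vector_derivative
     (\<theta>' - \<theta>) *\<^sub>R (kac_rotation i j (?\<phi> t) ** kac_gen i j)) (at t within {0..1})" for t
  proof -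
    have "(?\<phi> has_vector_derivative (\<theta>' - \<theta>)) (at t within {0..1})"
      by (auto intro!: derivative_eq_intros)
    then have "(kac_rotation i j \<circ> ?\<phi> has_vector_derivative
        (\<theta>' - \<theta>) *\<^sub>R (kac_rotation i j (?\<phi> t) ** kac_gen i j)) (at t within {0..1})"
      by (rule vector_diff_chain_within) (rule kac_rotation_deriv[OF assms(1)])
    then show ?thesis by (simp only: o_def)
  qed
  have "SO_curve (?\<gamma> 0) (?\<gamma> 1) (integral {0..1} (\<lambda>t. norm (?\<gamma>' t)))"
  proof (rule SO_curve_segment)
    show "smooth_on_interval ?\<gamma> 0 1"
      by (intro Ck_imp_smooth Ck_linear[OF bl] ck) simp
    show "(?\<gamma> has_vector_derivative ?\<gamma>' t) (at t within {0..1})" for t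
      by (rule bounded_linear.has_vector_derivative[OF bl R])
    have "continuous_on {0..1} (\<lambda>t. kac_rotation i j (?\<phi> t))"
      using ck[of 1] by (rule Ck_continuous_on)
    then show "continuous_on {0..1} ?\<gamma>'"
      by (intro bounded_linear.continuous_on[OF bl] continuous_intros
          bounded_bilinear.continuous_on[OF bounded_bilinear_matrix_mult])
    show "?\<gamma> ` {0..1} \<subseteq> SO"
      using assms by (auto intro: SO_mult kac_rotation_in_SO)
  qed simp
  moreover have "norm (?\<gamma>' t) = sqrt 2 * \<bar>\<theta>' - \<theta>\<bar>" for t
    using assms by (simp add: norm_SO_mult_right norm_SO_mult_left kac_rotation_in_SO norm_kac_gen)
  ultimately show ?thesis by simp
qed

section \<open>Givens rotations\<close>

lemma kac_rotation_mult_nth: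
  assumes "i \<noteq> j"
  shows "(kac_rotation i j \<phi> ** r) $ k $ c =
    (if k = i then cos \<phi> * r $ i $ c - sin \<phi> * r $ j $ c
     else if k = j then sin \<phi> * r $ i $ c + cos \<phi> * r $ j $ c else r $ k $ c)"
proof -
  have "(\<Sum>l\<in>UNIV. kac_rotation i j \<phi> $ k $ l * r $ l $ c)
      = (\<Sum>l\<in>{i, j, k}. kac_rotation i j \<phi> $ k $ l * r $ l $ c)"
    by (rule sum.mono_neutral_right) (auto simp: kac_rotation_def axis_def)
  also have "\<dots> = (if k = i then cos \<phi> * r $ i $ c - sin \<phi> * r $ j $ c
     else if k = j then sin \<phi> * r $ i $ c + cos \<phi> * r $ j $ c else r $ k $ c)"
  proof -
    have "{i, j, k} = (if k = i \<or> k = j then {i, j} else insert k {i, j})" by auto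
    then show ?thesis using assms by (auto simp: kac_rotation_def axis_def)
  qed
  finally show ?thesis by (simp add: matrix_matrix_mult_def)
qed

text \<open>The list of planes is fixed and only the angles vary, over a closed interval, so the set
  is parametrised by a cube and subsequences can be extracted angle by angle.\<close>

primrec givens :: "('n::finite \<times> 'n) list \<Rightarrow> 'n sqmat set" where
  "givens [] = {mat 1}"
| "givens (p # ps) = {kac_rotation (fst p) (snd p) \<theta> ** b | \<theta> b. \<theta> \<in> {0..2*pi} \<and> b \<in> givens ps}"

lemma givens_append: "a \<in> givens ps \<Longrightarrow> b \<in> givens qs \<Longrightarrow> a ** b \<in> givens (ps @ qs)"
proof (induction ps arbitrary: a)
  case (Cons p ps)
  then obtain \<theta> a' where "a = kac_rotation (fst p) (snd p) \<theta> ** a'" "\<theta> \<in> {0..2*pi}" "a' \<in> givens ps"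
    by auto
  with Cons show ?case by (auto simp: matrix_mul_assoc[symmetric])
qed simp

lemma givens_in_SO: "a \<in> givens ps \<Longrightarrow> \<forall>(i, j)\<in>set ps. i \<noteq> j \<Longrightarrow> a \<in> SO"
proof (induction ps arbitrary: a)
  case Nil
  then show ?case by (simp add: SO_def)
qed (auto intro!: SO_mult kac_rotation_in_SO)

lemma polar_coordinates:
  obtains \<rho> \<theta> :: real where "0 \<le> \<rho>" "\<theta> \<in> {0..2*pi}" "x = \<rho> * cos \<theta>" "y = \<rho> * sin \<theta>"
proof (cases "x\<^sup>2 + y\<^sup>2 = 0")
  case True
  then have "x = 0" "y = 0" by (simp_all add: sum_power2_eq_zero_iff)
  then show ?thesis using that[of 0 0] by simp
next
  case False
  define \<rho> where "\<rho> = sqrt (x\<^sup>2 + y\<^sup>2)"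
  have \<rho>: "\<rho> > 0" using False by (simp add: \<rho>_def sum_power2_gt_zero_iff)
  have "\<rho>\<^sup>2 = x\<^sup>2 + y\<^sup>2" by (simp add: \<rho>_def)
  then have "(x / \<rho>)\<^sup>2 + (y / \<rho>)\<^sup>2 = 1"
    using \<rho> False by (simp add: power_divide add_divide_distrib[symmetric])
  then obtain t where "0 \<le> t" "t < 2*pi" "x / \<rho> = cos t" "y / \<rho> = sin t"
    using sincos_total_2pi by metis
  then show ?thesis using that[of \<rho> t] \<rho> by (auto simp: field_simps)
qed

definition fixes_axes :: "'n::finite set \<Rightarrow> 'n sqmat \<Rightarrow> bool" where
  "fixes_axes S r \<longleftrightarrow> (\<forall>t\<in>S. \<forall>k. r $ k $ t = (if k = t then 1 else 0))"

text \<open>Let the entries (s, s) and (j, s) have polar coordinates \<rho> and \<theta>. Turning by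
  - \<theta> in the plane (s, j) replaces them by \<rho> and 0. Only rows s and j change: zeros made
  earlier in column s stay, and in the columns of S both rows are zero because s and j lie outside
  S. The list is quantified before r since the planes depend only on J and s; r enters through the
  angles.\<close>

lemma givens_eliminate_column:
  fixes s :: "'n::finite"
  assumes "finite J" "J \<inter> insert s S = {}" "s \<notin> S"
  shows "\<exists>ps. (\<forall>(i, j)\<in>set ps. i \<noteq> j) \<and> (\<forall>r\<in>SO. fixes_axes S r \<longrightarrow>
     (\<exists>g\<in>givens ps. \<exists>r'\<in>SO. r = g ** r' \<and> fixes_axes S r' \<and> (\<forall>j\<in>J. r' $ j $ s = 0) \<and>
        (J \<noteq> {} \<longrightarrow> 0 \<le> r' $ s $ s)))"
  using assms
proof (induction J rule: finite_induct)
  case empty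
  show ?case by (intro exI[of _ "[]"]) auto
next
  case (insert j J)
  have "J \<inter> insert s S = {}" using insert.prems(1) by blast
  from insert.IH[OF this insert.prems(2)]
  obtain ps where ps: "\<forall>(i, j)\<in>set ps. i \<noteq> j" "\<forall>r\<in>SO. fixes_axes S r \<longrightarrow>
     (\<exists>g\<in>givens ps. \<exists>r'\<in>SO. r = g ** r' \<and> fixes_axes S r' \<and> (\<forall>j\<in>J. r' $ j $ s = 0) \<and>
        (J \<noteq> {} \<longrightarrow> 0 \<le> r' $ s $ s))"
    by blast
  have ne: "s \<noteq> j" using insert by auto
  show ?case
  proof (intro exI[of _ "ps @ [(s, j)]"] conjI ballI impI)
    fix r :: "'n sqmat" assume "r \<in> SO" "fixes_axes S r"
    with ps(2) obtain g r' where r': "g \<in> givens ps" "r' \<in> SO" "r = g ** r'" "fixes_axes S r'"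
      "\<And>j. j \<in> J \<Longrightarrow> r' $ j $ s = 0" by blast
    obtain \<rho> \<theta> where \<rho>: "0 \<le> \<rho>" "\<theta> \<in> {0..2*pi}" "r' $ s $ s = \<rho> * cos \<theta>" "r' $ j $ s = \<rho> * sin \<theta>"
      by (rule polar_coordinates)
    let ?r = "kac_rotation s j (- \<theta>) ** r'"
    note nth = kac_rotation_mult_nth[OF ne, of "- \<theta>" r']
    have 1: "g ** kac_rotation s j \<theta> \<in> givens (ps @ [(s, j)])"
      using \<rho>(2) by (intro givens_append[OF r'(1)]) force
    have 2: "?r \<in> SO" using r' ne by (intro SO_mult kac_rotation_in_SO)
    have 3: "r = (g ** kac_rotation s j \<theta>) ** ?r"
      using kac_rotation_add[OF ne, of \<theta> "- \<theta>"]
      by (simp add: r'(3) kac_rotation_0) (metis matrix_mul_assoc matrix_mul_lid)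
    have 4: "fixes_axes S ?r"
      using r'(4) insert.prems by (auto simp: fixes_axes_def nth)
    have 5: "?r $ k $ s = 0" if "k \<in> insert j J" for k
      using that r'(5) insert ne \<rho>(3,4) by (auto simp: nth)
    have "?r $ s $ s = cos \<theta> * (\<rho> * cos \<theta>) + sin \<theta> * (\<rho> * sin \<theta>)"
      using \<rho>(3,4) by (simp add: nth)
    also have "\<dots> = \<rho> * (cos \<theta> * cos \<theta> + sin \<theta> * sin \<theta>)" by algebra
    finally have 6: "0 \<le> ?r $ s $ s"
      using \<rho>(1) by (simp add: sin_cos_squared_add3)
    show "\<exists>g\<in>givens (ps @ [(s, j)]). \<exists>r'\<in>SO. r = g ** r' \<and> fixes_axes S r' \<and>
        (\<forall>j\<in>insert j J. r' $ j $ s = 0) \<and> (insert j J \<noteq> {} \<longrightarrow> 0 \<le> r' $ s $ s)"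
      using 1 2 3 4 5 6 by blast
  qed (use ps ne in auto)
qed

text \<open>The columns of r are orthonormal: orthogonality to the fixed axes clears column s in the
  rows of S, and unit length leaves 1 or -1 for \<open>r $ s $ s\<close>. Elimination has made this
  entry nonnegative except at the last axis, where no row is left to rotate with; there r is
  diagonal and its determinant decides the sign.\<close>

lemma fixes_axes_insert:
  fixes r :: "'n::finite sqmat"
  assumes r: "r \<in> SO" and S: "fixes_axes S r" "s \<notin> S" and z: "\<And>j. j \<notin> insert s S \<Longrightarrow> r $ j $ s = 0"
    and nn: "- insert s S \<noteq> {} \<Longrightarrow> 0 \<le> r $ s $ s"
  shows "fixes_axes (insert s S) r"
proof -
  have orth: "(\<Sum>k\<in>UNIV. r $ k $ a * r $ k $ b) = (if a = b then 1 else 0)" for a b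
    using SO_transpose_mult[OF r]
    by (auto simp: vec_eq_iff matrix_matrix_mult_def transpose_def mat_def)
  have off: "r $ k $ s = 0" if "k \<noteq> s" for k
  proof (cases "k \<in> S")
    case True
    have "(\<Sum>l\<in>UNIV. r $ l $ k * r $ l $ s) = (\<Sum>l\<in>UNIV. if l = k then r $ l $ s else 0)"
      using S(1) True by (intro sum.cong) (auto simp: fixes_axes_def)
    then show ?thesis using orth[of k s] that by simp
  qed (use z that in auto)
  have "(\<Sum>k\<in>UNIV. r $ k $ s * r $ k $ s) = (\<Sum>k\<in>UNIV. if k = s then r $ s $ s * r $ s $ s else 0)"
    using off by (intro sum.cong) auto
  then have "r $ s $ s * r $ s $ s = 1" using orth[of s s] by simp
  then have "(r $ s $ s - 1) * (r $ s $ s + 1) = 0" by (simp add: algebra_simps)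
  then have pm: "r $ s $ s = 1 \<or> r $ s $ s = -1" by auto
  have "r $ s $ s = 1"
  proof (cases "- insert s S = {}")
    case True
    have "det r = (\<Prod>i\<in>UNIV. r $ i $ i)"
    proof (rule det_diagonal)
      fix i j :: 'n assume "i \<noteq> j"
      then show "r $ i $ j = 0" using off S(1) True by (cases "j = s") (auto simp: fixes_axes_def)
    qed
    also have "\<dots> = (\<Prod>i\<in>UNIV. if i = s then r $ s $ s else 1)"
      using S(1) True by (intro prod.cong) (auto simp: fixes_axes_def)
    finally show ?thesis using r by (simp add: SO_def)
  next
    case False
    then show ?thesis using nn pm by auto
  qed
  then show ?thesis using S(1) off by (auto simp: fixes_axes_def)
qed

lemma givens_fix_axes:
  fixes S :: "'n::finite set"
  assumes "finite S"
  shows "\<exists>ps. (\<forall>(i, j)\<in>set ps. i \<noteq> j) \<and>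
     (\<forall>a\<in>SO. \<exists>g\<in>givens ps. \<exists>r\<in>SO. a = g ** r \<and> fixes_axes S r)"
  using assms
proof (induction S rule: finite_induct)
  case empty
  show ?case by (intro exI[of _ "[]"]) (auto simp: fixes_axes_def)
next
  case (insert s S)
  then obtain ps where ps: "\<forall>(i, j)\<in>set ps. i \<noteq> j"
    "\<And>a. a \<in> SO \<Longrightarrow> \<exists>g\<in>givens ps. \<exists>r\<in>SO. a = g ** r \<and> fixes_axes S r" by blast
  have "- insert s S \<inter> insert s S = {}" by auto
  from givens_eliminate_column[OF finite this insert.hyps(2)]
  obtain qs where qs: "\<forall>(i, j)\<in>set qs. i \<noteq> j" "\<And>r. r \<in> SO \<Longrightarrow> fixes_axes S r \<Longrightarrow>
     (\<exists>g\<in>givens qs. \<exists>r'\<in>SO. r = g ** r' \<and> fixes_axes S r' \<and> (\<forall>j\<in>- insert s S. r' $ j $ s = 0) \<and>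
        (- insert s S \<noteq> {} \<longrightarrow> 0 \<le> r' $ s $ s))"
    by blast
  show ?case
  proof (intro exI[of _ "ps @ qs"] conjI ballI)
    fix a :: "'n sqmat" assume "a \<in> SO"
    then obtain g r where g: "g \<in> givens ps" "r \<in> SO" "a = g ** r" "fixes_axes S r" using ps(2) by blast
    then obtain h r' where h: "h \<in> givens qs" "r' \<in> SO" "r = h ** r'" "fixes_axes S r'"
      "\<forall>j\<in>- insert s S. r' $ j $ s = 0" "- insert s S \<noteq> {} \<longrightarrow> 0 \<le> r' $ s $ s" using qs(2) by blast
    have "fixes_axes (insert s S) r'"
      using h by (intro fixes_axes_insert insert.hyps) auto
    moreover have "a = (g ** h) ** r'" by (simp add: g h matrix_mul_assoc)
    ultimately show "\<exists>g\<in>givens (ps @ qs). \<exists>r\<in>SO. a = g ** r \<and> fixes_axes (insert s S) r"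
      using g h givens_append by blast
  qed (use ps(1) qs(1) in auto)
qed

text \<open>Once all axes are fixed, only the identity remains. One list of planes serves the whole
  group, which yields both connectedness by arcs and compactness.\<close>

lemma SO_eq_givens:
  obtains ps :: "('n::finite \<times> 'n) list" where "\<forall>(i, j)\<in>set ps. i \<noteq> j" "givens ps = SO"
proof -
  obtain ps :: "('n \<times> 'n) list" where ps: "\<forall>(i, j)\<in>set ps. i \<noteq> j"
    "\<And>a. a \<in> SO \<Longrightarrow> \<exists>g\<in>givens ps. \<exists>r\<in>SO. a = g ** r \<and> fixes_axes UNIV r"
    using givens_fix_axes[of "UNIV :: 'n set"] by auto
  have "r = mat 1" if "fixes_axes UNIV r" for r :: "'n sqmat"
    using that by (auto simp: fixes_axes_def vec_eq_iff mat_def)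
  then have "SO \<subseteq> givens ps" using ps(2) by fastforce
  then show ?thesis using that[OF ps(1)] givens_in_SO[OF _ ps(1)] by blast
qed

section \<open>The Riemannian distance is a continuous metric\<close>

lemma SO_curve_refl:
  fixes x :: "'n::finite sqmat"
  assumes "x \<in> SO" shows "SO_curve x x 0"
proof -
  have "SO_curve x x (integral {0..1} (\<lambda>t::real. norm (0 :: 'n sqmat)))"
    by (rule SO_curve_segment[where \<gamma> = "\<lambda>_. x"])
       (use assms in \<open>auto intro!: Ck_imp_smooth Ck_const\<close>)
  then show ?thesis by simp
qed

lemma SO_curve_rotate:
  assumes "i \<noteq> j" "x \<in> SO"
  shows "\<exists>l. SO_curve x (kac_rotation i j \<theta> ** x) l"
  using SO_curve_rotation[OF assms, of 0 \<theta>] by (auto simp: kac_rotation_0)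

text \<open>A Givens product is joined to the identity factor by factor, and left translation by x
  moves the start point. Otherwise the infimum defining the distance could range over the empty
  set.\<close>

lemma SO_curve_exists:
  fixes x y :: "'n::finite sqmat"
  assumes "x \<in> SO" "y \<in> SO"
  shows "\<exists>l. SO_curve x y l"
proof -
  obtain ps :: "('n \<times> 'n) list" where ps: "\<forall>(i, j)\<in>set ps. i \<noteq> j" "givens ps = SO"
    by (rule SO_eq_givens)
  have I: "mat 1 \<in> (SO :: 'n sqmat set)" by (simp add: SO_def)
  have "\<exists>l. SO_curve (mat 1) a l" if "a \<in> givens qs" "\<forall>(i, j)\<in>set qs. i \<noteq> j"
    for a :: "'n sqmat" and qs
    using that
  proof (induction qs arbitrary: a)
    case Nil
    then show ?case using SO_curve_refl[OF I] by auto
  next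
    case (Cons q qs)
    obtain i j where q: "q = (i, j)" by force
    have ij: "i \<noteq> j" using Cons.prems q by auto
    from Cons.prems obtain \<theta> b where b: "a = kac_rotation i j \<theta> ** b" "b \<in> givens qs" by (auto simp: q)
    then obtain l where "SO_curve (mat 1) b l" using Cons by auto
    moreover have "b \<in> SO" using givens_in_SO[OF b(2)] Cons.prems by auto
    ultimately show ?case using SO_curve_rotate[OF ij, of b \<theta>] b(1) SO_curve_join by blast
  qed
  then have "\<exists>l. SO_curve (mat 1) a l" if "a \<in> SO" for a :: "'n sqmat"
    using that ps by blast
  then obtain l where "SO_curve (mat 1) (transpose x ** y) l"
    using assms by (meson SO_mult SO_transpose)
  from SO_curve_mult_left[OF assms(1) this] show ?thesis
    by (auto simp: matrix_mul_assoc SO_mult_transpose[OF assms(1)])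
qed

lemma SO_dist_nonneg: "x \<in> SO \<Longrightarrow> y \<in> SO \<Longrightarrow> 0 \<le> SO_dist x y"
  unfolding SO_dist_eq_Inf using SO_curve_exists SO_curve_nonneg
  by (intro cInf_greatest) auto

lemma SO_dist_approx:
  assumes "x \<in> SO" "y \<in> SO" "0 < e"
  obtains l where "SO_curve x y l" "l < SO_dist x y + e"
proof -
  have "{l. SO_curve x y l} \<noteq> {}" using SO_curve_exists[OF assms(1,2)] by auto
  moreover have "bdd_below {l. SO_curve x y l}" by (auto intro!: bdd_belowI[of _ 0] SO_curve_nonneg)
  moreover have "Inf {l. SO_curve x y l} < SO_dist x y + e" using assms(3) by (simp add: SO_dist_eq_Inf)
  ultimately show ?thesis using that by (auto simp: cInf_less_iff)
qed

lemma SO_dist_triangle: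
  assumes "x \<in> SO" "y \<in> SO" "z \<in> SO"
  shows "SO_dist x z \<le> SO_dist x y + SO_dist y z"
proof (rule field_le_epsilon)
  fix e :: real assume "0 < e"
  then have "0 < e / 2" by simp
  obtain l where "SO_curve x y l" "l < SO_dist x y + e / 2" using SO_dist_approx assms \<open>0 < e / 2\<close> by blast
  moreover obtain l' where "SO_curve y z l'" "l' < SO_dist y z + e / 2" using SO_dist_approx assms \<open>0 < e / 2\<close> by blast
  ultimately show "SO_dist x z \<le> SO_dist x y + SO_dist y z + e"
    using SO_dist_le[OF SO_curve_join] by fastforce
qed

lemma SO_dist_mult_left_le:
  assumes "u \<in> SO" "x \<in> SO" "y \<in> SO"
  shows "SO_dist (u ** x) (u ** y) \<le> SO_dist x y"
proof (rule field_le_epsilon)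
  fix e :: real assume "0 < e"
  then obtain l where "SO_curve x y l" "l < SO_dist x y + e" using SO_dist_approx assms by blast
  then show "SO_dist (u ** x) (u ** y) \<le> SO_dist x y + e"
    using SO_dist_le[OF SO_curve_mult_left[OF assms(1)]] by fastforce
qed

text \<open>Passes through R(i, j, \<theta>) y: left invariance for the first leg, a circular arc
  for the second. It makes rotation jointly continuous in angle and point for
  \<open>SO_dist\<close>.\<close>

lemma SO_dist_rotation_le:
  assumes "i \<noteq> j" "x \<in> SO" "y \<in> SO"
  shows "SO_dist (kac_rotation i j \<theta> ** x) (kac_rotation i j \<theta>' ** y) \<le> SO_dist x y + sqrt 2 * \<bar>\<theta>' - \<theta>\<bar>"
proof -
  let ?R = "kac_rotation i j"
  have "SO_dist (?R \<theta> ** x) (?R \<theta>' ** y) \<le> SO_dist (?R \<theta> ** x) (?R \<theta> ** y) + SO_dist (?R \<theta> ** y) (?R \<theta>' ** y)"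
    using assms by (intro SO_dist_triangle SO_mult kac_rotation_in_SO)
  also have "\<dots> \<le> SO_dist x y + sqrt 2 * \<bar>\<theta>' - \<theta>\<bar>"
    using assms by (intro add_mono SO_dist_mult_left_le SO_dist_le SO_curve_rotation kac_rotation_in_SO)
  finally show ?thesis .
qed

lemma SO_dist_refl:
  fixes x :: "'n::finite sqmat"
  assumes "x \<in> SO"
  shows "SO_dist x x = 0"
  using SO_dist_le[OF SO_curve_refl[OF assms]] SO_dist_nonneg[OF assms assms] by simp

text \<open>Convergence in the Euclidean norm and in the distance at once: rotations act continuously for both,
  so products of boundedly many Givens rotations are sequentially compact for both, and hence the two
  topologies of the rotation group agree.\<close>
definition SO_conv :: "(nat \<Rightarrow> 'n::finite sqmat) \<Rightarrow> 'n sqmat \<Rightarrow> bool" where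
  "SO_conv X x \<longleftrightarrow> X \<longlonglongrightarrow> x \<and> (\<lambda>m. SO_dist (X m) x) \<longlonglongrightarrow> 0 \<and> (\<lambda>m. SO_dist x (X m)) \<longlonglongrightarrow> 0"

lemma SO_conv_rotation:
  assumes "i \<noteq> j" "SO_conv X x" "\<theta> \<longlonglongrightarrow> t" "\<And>m. X m \<in> SO" "x \<in> SO"
  shows "SO_conv (\<lambda>m. kac_rotation i j (\<theta> m) ** X m) (kac_rotation i j t ** x)"
  unfolding SO_conv_def
proof (intro conjI)
  have "(\<lambda>m. (\<theta> m, X m)) \<longlonglongrightarrow> (t, x)"
    using assms by (intro tendsto_Pair) (auto simp: SO_conv_def)
  from continuous_on_tendsto_compose[OF continuous_kac_rotation_mult[of i j] this]
  show "(\<lambda>m. kac_rotation i j (\<theta> m) ** X m) \<longlonglongrightarrow> kac_rotation i j t ** x" by simp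
  have "(\<lambda>m. SO_dist (X m) x + sqrt 2 * \<bar>t - \<theta> m\<bar>) \<longlonglongrightarrow> 0 + sqrt 2 * \<bar>t - t\<bar>"
    "(\<lambda>m. SO_dist x (X m) + sqrt 2 * \<bar>\<theta> m - t\<bar>) \<longlonglongrightarrow> 0 + sqrt 2 * \<bar>t - t\<bar>"
    by (rule tendsto_add tendsto_mult tendsto_rabs tendsto_diff tendsto_const assms(3)
        assms(2)[unfolded SO_conv_def, THEN conjunct2, THEN conjunct1]
        assms(2)[unfolded SO_conv_def, THEN conjunct2, THEN conjunct2])+
  then have c: "(\<lambda>m. SO_dist (X m) x + sqrt 2 * \<bar>t - \<theta> m\<bar>) \<longlonglongrightarrow> 0"
    "(\<lambda>m. SO_dist x (X m) + sqrt 2 * \<bar>\<theta> m - t\<bar>) \<longlonglongrightarrow> 0"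
    by (simp_all only: diff_self abs_zero mult_zero_right add_0_left)
  show "(\<lambda>m. SO_dist (kac_rotation i j (\<theta> m) ** X m) (kac_rotation i j t ** x)) \<longlonglongrightarrow> 0"
    by (rule tendsto_sandwich[OF _ _ tendsto_const c(1)])
       (use assms in \<open>intro always_eventually allI SO_dist_nonneg SO_mult kac_rotation_in_SO SO_dist_rotation_le; simp\<close>)+
  show "(\<lambda>m. SO_dist (kac_rotation i j t ** x) (kac_rotation i j (\<theta> m) ** X m)) \<longlonglongrightarrow> 0"
    by (rule tendsto_sandwich[OF _ _ tendsto_const c(2)])
       (use assms in \<open>intro always_eventually allI SO_dist_nonneg SO_mult kac_rotation_in_SO SO_dist_rotation_le; simp\<close>)+
qed

lemma SO_conv_subseq: "SO_conv X x \<Longrightarrow> strict_mono r \<Longrightarrow> SO_conv (X \<circ> r) x"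
  unfolding SO_conv_def
  using LIMSEQ_subseq_LIMSEQ[of X x r] LIMSEQ_subseq_LIMSEQ[of "\<lambda>m. SO_dist (X m) x" 0 r]
    LIMSEQ_subseq_LIMSEQ[of "\<lambda>m. SO_dist x (X m)" 0 r]
  by (auto simp: o_def)

text \<open>Induction on the planes: a subsequence for the remaining product, then a further one for
  the leading angle. The angles converge inside a closed interval, so the limit stays in the same
  set.\<close>

lemma givens_SO_conv_subseq:
  fixes X :: "nat \<Rightarrow> 'n::finite sqmat"
  assumes "\<forall>(i, j)\<in>set ps. i \<noteq> j" "\<And>m. X m \<in> givens ps"
  shows "\<exists>x r. strict_mono r \<and> SO_conv (X \<circ> r) x \<and> x \<in> givens ps"
  using assms
proof (induction ps arbitrary: X)
  case Nil
  then show ?case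
    by (intro exI[of _ "mat 1"] exI[of _ id]) (auto simp: SO_conv_def strict_mono_id SO_dist_refl SO_def o_def)
next
  case (Cons p ps)
  obtain i j where p: "p = (i, j)" by force
  have ij: "i \<noteq> j" using Cons.prems(1) p by auto
  have "\<forall>m. \<exists>\<theta> b. X m = kac_rotation i j \<theta> ** b \<and> \<theta> \<in> {0..2*pi} \<and> b \<in> givens ps"
    using Cons.prems(2) by (auto simp: p)
  then obtain \<theta> b where b: "\<And>m. X m = kac_rotation i j (\<theta> m) ** b m" "\<And>m. \<theta> m \<in> {0..2*pi}" "\<And>m. b m \<in> givens ps"
    by metis
  have ps: "\<forall>(i, j)\<in>set ps. i \<noteq> j" using Cons.prems(1) by auto
  obtain x r where r: "strict_mono r" "SO_conv (b \<circ> r) x" "x \<in> givens ps"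
    using Cons.IH[OF ps, of b] b(3) by blast
  have "compact {0..2*pi}" by simp
  then obtain t r' where r': "t \<in> {0..2*pi}" "strict_mono r'" "((\<theta> \<circ> r) \<circ> r') \<longlonglongrightarrow> t"
    using b(2) unfolding compact_eq_seq_compact_metric seq_compact_def by (metis comp_apply)
  have rr: "strict_mono (r \<circ> r')" using r r' by (simp add: strict_mono_o)
  have "SO_conv (b \<circ> (r \<circ> r')) x" using SO_conv_subseq[OF r(2) r'(2)] by (simp add: o_assoc)
  from SO_conv_rotation[OF ij this r'(3)]
  have "SO_conv (X \<circ> (r \<circ> r')) (kac_rotation i j t ** x)"
    using givens_in_SO[OF b(3) ps] givens_in_SO[OF r(3) ps] by (simp add: o_def b(1))
  moreover have "kac_rotation i j t ** x \<in> givens (p # ps)"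
    using r'(1) r(3) by (auto simp only: givens.simps p fst_conv snd_conv)
  ultimately show ?case using rr by blast
qed

lemma SO_conv_subseq_exists:
  fixes X :: "nat \<Rightarrow> 'n::finite sqmat"
  assumes "\<And>m. X m \<in> SO"
  shows "\<exists>x r. strict_mono r \<and> SO_conv (X \<circ> r) x \<and> x \<in> SO"
proof -
  obtain ps :: "('n \<times> 'n) list" where "\<forall>(i, j)\<in>set ps. i \<noteq> j" "givens ps = SO"
    by (rule SO_eq_givens)
  then show ?thesis using givens_SO_conv_subseq[of ps X] assms by auto
qed

lemma compact_SO: "compact (SO :: 'n::finite sqmat set)"
  unfolding compact_eq_seq_compact_metric seq_compact_def
  using SO_conv_subseq_exists unfolding SO_conv_def by metis

text \<open>Otherwise a subsequence of the distances stays away from 0, but it has a further subsequence that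
  converges in both senses, necessarily to \<open>x\<close>.\<close>
lemma SO_dist_tendsto_0:
  fixes X :: "nat \<Rightarrow> 'n::finite sqmat"
  assumes X: "\<And>m. X m \<in> SO" and x: "x \<in> SO" and lim: "X \<longlonglongrightarrow> x"
  shows "(\<lambda>m. SO_dist (X m) x + SO_dist x (X m)) \<longlonglongrightarrow> 0"
proof (rule ccontr)
  let ?d = "\<lambda>m. SO_dist (X m) x + SO_dist x (X m)"
  have nn: "0 \<le> ?d m" for m using X x by (intro add_nonneg_nonneg SO_dist_nonneg)
  assume "\<not> ?d \<longlonglongrightarrow> 0"
  then obtain e where e: "0 < e" "\<And>N. \<exists>m\<ge>N. e \<le> ?d m"
    using nn unfolding LIMSEQ_def dist_real_def by (metis abs_of_nonneg diff_0_right linorder_not_le)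
  have "infinite {m. e \<le> ?d m}"
    unfolding infinite_nat_iff_unbounded_le using e(2) by auto
  from infinite_enumerate[OF this]
  obtain r :: "nat \<Rightarrow> nat" where r: "strict_mono r" "\<And>m. e \<le> ?d (r m)"
    by auto
  obtain y s where s: "strict_mono s" "SO_conv (X \<circ> r \<circ> s) y" "y \<in> SO"
    using SO_conv_subseq_exists[of "X \<circ> r"] X by auto
  have "(X \<circ> r \<circ> s) \<longlonglongrightarrow> x"
    by (rule LIMSEQ_subseq_LIMSEQ[OF LIMSEQ_subseq_LIMSEQ[OF lim r(1)] s(1)])
  then have "y = x" using s(2) LIMSEQ_unique[of "X \<circ> r \<circ> s" y x] unfolding SO_conv_def by blast
  with s(2) have "(\<lambda>m. SO_dist ((X \<circ> r \<circ> s) m) x + SO_dist x ((X \<circ> r \<circ> s) m)) \<longlonglongrightarrow> 0 + 0"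
    unfolding SO_conv_def by (intro tendsto_add) blast+
  moreover have "e \<le> SO_dist ((X \<circ> r \<circ> s) m) x + SO_dist x ((X \<circ> r \<circ> s) m)" for m
    using r(2)[of "s m"] by simp
  ultimately have "e \<le> 0" by (intro LIMSEQ_le_const[of _ 0]) auto
  with e(1) show False by simp
qed

text \<open>The sequential statement in terms of Euclidean balls, by a counterexample for each
  radius 1 / (m + 1). Both orders of the arguments are bounded because symmetry of
  \<open>SO_dist\<close> is not established.\<close>

lemma SO_dist_small:
  fixes x :: "'n::finite sqmat"
  assumes x: "x \<in> SO" and e: "0 < e"
  obtains \<delta> where "0 < \<delta>" "\<And>y. y \<in> SO \<Longrightarrow> dist y x < \<delta> \<Longrightarrow> SO_dist y x < e \<and> SO_dist x y < e"
proof (rule ccontr)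
  assume "\<not> thesis"
  with that have "\<exists>y\<in>SO. dist y x < \<delta> \<and> \<not> (SO_dist y x < e \<and> SO_dist x y < e)" if \<delta>: "0 < \<delta>" for \<delta>
    using \<delta> by blast
  then have "\<forall>m. \<exists>y\<in>SO. dist y x < inverse (real (Suc m)) \<and> \<not> (SO_dist y x < e \<and> SO_dist x y < e)"
    by simp
  then obtain X where X: "\<And>m. X m \<in> SO" "\<And>m. dist (X m) x < inverse (real (Suc m))"
    "\<And>m. \<not> (SO_dist (X m) x < e \<and> SO_dist x (X m) < e)" by metis
  have "(\<lambda>m. dist (X m) x) \<longlonglongrightarrow> 0"
    by (rule tendsto_sandwich[OF _ _ tendsto_const LIMSEQ_inverse_real_of_nat])
       (use X(2) in \<open>auto intro!: always_eventually less_imp_le\<close>)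
  then have "X \<longlonglongrightarrow> x" by (rule tendsto_dist_iff[THEN iffD2])
  then have "(\<lambda>m. SO_dist (X m) x + SO_dist x (X m)) \<longlonglongrightarrow> 0"
    by (rule SO_dist_tendsto_0[OF X(1) x])
  then have "\<forall>\<^sub>F m in sequentially. SO_dist (X m) x + SO_dist x (X m) < e"
    using e by (rule order_tendstoD(2))
  then obtain m where "SO_dist (X m) x + SO_dist x (X m) < e"
    using eventually_happens'[OF sequentially_bot] by blast
  then show False
    using X(3)[of m] SO_dist_nonneg[OF X(1) x, of m] SO_dist_nonneg[OF x X(1), of m] by auto
qed

text \<open>Moving both points changes the distance by at most the two displacements, by two
  triangle inequalities in each direction. Measurability and boundedness of the cost rest on
  this.\<close>

lemma continuous_on_SO_dist:
  "continuous_on (SO \<times> SO) (\<lambda>p :: 'n::finite sqmat \<times> 'n sqmat. SO_dist (fst p) (snd p))"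
  unfolding continuous_on_iff
proof (intro ballI allI impI)
  fix p :: "'n sqmat \<times> 'n sqmat" and e :: real
  assume p: "p \<in> SO \<times> SO" and "0 < e"
  then have e: "0 < e / 2" by simp
  obtain x y where xy: "p = (x, y)" "x \<in> SO" "y \<in> SO" using p by auto
  obtain d where d: "0 < d" "\<And>z. z \<in> SO \<Longrightarrow> dist z x < d \<Longrightarrow> SO_dist z x < e / 2 \<and> SO_dist x z < e / 2"
    using SO_dist_small[OF xy(2) e] by blast
  obtain d' where d': "0 < d'" "\<And>z. z \<in> SO \<Longrightarrow> dist z y < d' \<Longrightarrow> SO_dist z y < e / 2 \<and> SO_dist y z < e / 2"
    using SO_dist_small[OF xy(3) e] by blast
  show "\<exists>d>0. \<forall>q\<in>SO \<times> SO. dist q p < d \<longrightarrow> dist (SO_dist (fst q) (snd q)) (SO_dist (fst p) (snd p)) < e"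
  proof (intro exI[of _ "min d d'"] conjI ballI impI)
    fix q :: "'n sqmat \<times> 'n sqmat" assume "q \<in> SO \<times> SO" and dq: "dist q p < min d d'"
    then obtain x' y' where q: "q = (x', y')" "x' \<in> SO" "y' \<in> SO" by auto
    have "dist x' x < d" "dist y' y < d'"
      using dq dist_fst_le[of q p] dist_snd_le[of q p] by (auto simp: q xy)
    then have *: "SO_dist x' x < e / 2" "SO_dist x x' < e / 2" "SO_dist y' y < e / 2" "SO_dist y y' < e / 2"
      using d d' q by blast+
    have "SO_dist x' y' \<le> SO_dist x' x + (SO_dist x y + SO_dist y y')"
      using SO_dist_triangle[OF q(2) xy(2) q(3)] SO_dist_triangle[OF xy(2) xy(3) q(3)] by simp
    moreover have "SO_dist x y \<le> SO_dist x x' + (SO_dist x' y' + SO_dist y' y)"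
      using SO_dist_triangle[OF xy(2) q(2) xy(3)] SO_dist_triangle[OF q(2) q(3) xy(3)] by simp
    ultimately show "dist (SO_dist (fst q) (snd q)) (SO_dist (fst p) (snd p)) < e"
      using * by (simp add: q xy dist_real_def)
  qed (use d d' in auto)
qed

text \<open>The bound B makes the cost integrable and turns the cross terms of the error estimates
  into multiples of e.\<close>

lemma SO_dist_bounded:
  obtains B where "0 < B" "\<And>x y :: 'n::finite sqmat. x \<in> SO \<Longrightarrow> y \<in> SO \<Longrightarrow> SO_dist x y \<le> B"
proof -
  have "compact ((\<lambda>p :: 'n sqmat \<times> 'n sqmat. SO_dist (fst p) (snd p)) ` (SO \<times> SO))"
    by (intro compact_continuous_image continuous_on_SO_dist compact_Times compact_SO)
  then have "bounded ((\<lambda>p :: 'n sqmat \<times> 'n sqmat. SO_dist (fst p) (snd p)) ` (SO \<times> SO))"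
    by (rule compact_imp_bounded)
  then obtain B where "0 < B" "\<And>p :: 'n sqmat \<times> 'n sqmat. p \<in> SO \<times> SO \<Longrightarrow> norm (SO_dist (fst p) (snd p)) \<le> B"
    unfolding bounded_pos by blast
  then show ?thesis using that[of B] by force
qed

text \<open>A finite subcover by Euclidean balls on which the distance to the centre is below e. A
  point is labelled by the first ball that contains it, so the label is measurable, and angles can
  be selected for pairs of labels instead of pairs of points.\<close>

lemma SO_cells:
  assumes e: "0 < e"
  obtains c :: "'n::finite sqmat \<Rightarrow> nat" and p :: "nat \<Rightarrow> 'n sqmat"
  where "c \<in> SO_borel \<rightarrow>\<^sub>M count_space UNIV" "\<And>k. p k \<in> SO"
    "\<And>x. x \<in> SO \<Longrightarrow> SO_dist x (p (c x)) < e \<and> SO_dist (p (c x)) x < e"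
proof -
  have "\<forall>x\<in>SO. \<exists>\<delta>>0. \<forall>y\<in>SO. dist y x < \<delta> \<longrightarrow> SO_dist y (x :: 'n sqmat) < e \<and> SO_dist x y < e"
    using SO_dist_small[OF _ e] by metis
  then obtain \<delta> where \<delta>: "\<And>x :: 'n sqmat. x \<in> SO \<Longrightarrow> 0 < \<delta> x"
    "\<And>x y. x \<in> SO \<Longrightarrow> y \<in> SO \<Longrightarrow> dist y x < \<delta> x \<Longrightarrow> SO_dist y (x :: 'n sqmat) < e \<and> SO_dist x y < e"
    by metis
  obtain C where C: "C \<subseteq> SO" "finite C" "(SO :: 'n sqmat set) \<subseteq> (\<Union>x\<in>C. ball x (\<delta> x))"
  proof (rule compactE_image[OF compact_SO, of "SO :: 'n sqmat set" "\<lambda>x. ball x (\<delta> x)"])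
    show "(SO :: 'n sqmat set) \<subseteq> (\<Union>x\<in>SO. ball x (\<delta> x))" using \<delta>(1) by force
  qed (use that in auto)
  obtain xs where xs: "set xs = C" using finite_list[OF C(2)] by blast
  \<comment> \<open>\<open>mat 1\<close> pads the finite list so that every p k is a rotation; by
    the cover, the least index of a point of SO falls inside the list.\<close>
  define p where "p k = (if k < length xs then xs ! k else mat 1)" for k
  have I: "mat 1 \<in> (SO :: 'n sqmat set)" by (simp add: SO_def)
  define c where "c x = (LEAST k. x \<in> ball (p k) (\<delta> (p k)))" for x
  have p: "p k \<in> SO" for k using C(1) xs nth_mem I by (auto simp: p_def)
  show thesis
  proof
    show "c \<in> SO_borel \<rightarrow>\<^sub>M count_space UNIV"
      unfolding c_def
    proof (rule measurable_Least)
      fix k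
      have "(\<lambda>x. x \<in> ball (p k) (\<delta> (p k))) \<in> borel \<rightarrow>\<^sub>M count_space UNIV"
        by (simp add: pred_def)
      then show "Measurable.pred SO_borel (\<lambda>x. x \<in> ball (p k) (\<delta> (p k)))"
        by (rule measurable_restrict_space1)
    qed
  next
    fix x :: "'n sqmat" assume x: "x \<in> SO"
    then obtain y where "y \<in> C" "x \<in> ball y (\<delta> y)" using C(3) by blast
    moreover then obtain k where "k < length xs" "xs ! k = y" using xs by (auto simp: in_set_conv_nth)
    ultimately have "x \<in> ball (p k) (\<delta> (p k))" by (simp add: p_def)
    then have "x \<in> ball (p (c x)) (\<delta> (p (c x)))" unfolding c_def by (rule LeastI)
    then show "SO_dist x (p (c x)) < e \<and> SO_dist (p (c x)) x < e"
      using \<delta>(2)[OF p x] by (simp add: dist_commute)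
  qed (rule p)
qed

section \<open>Rotating along a curve\<close>

lemma power2_norm_matrix: "(norm (a :: real^'n::finite^'m::finite))\<^sup>2 = (\<Sum>i\<in>UNIV. \<Sum>j\<in>UNIV. (a $ i $ j)\<^sup>2)"
  unfolding power2_norm_eq_inner by (simp only: inner_vec_def inner_real_def power2_eq_square)

text \<open>Differentiate the constant \<open>\<gamma> t ** transpose (\<gamma> t)\<close>; on a
  nondegenerate interval the derivative is unique, hence 0. With v = H \<gamma> this puts H into the
  Lie algebra of the group.\<close>

lemma antisym_velocity:
  assumes "\<And>t. t \<in> {a..b} \<Longrightarrow> \<gamma> t \<in> SO" "t \<in> {a..b}" "a < b"
    and "(\<gamma> has_vector_derivative v) (at t within {a..b})"
  shows "transpose (v ** transpose (\<gamma> t)) = - (v ** transpose (\<gamma> t))"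
proof -
  from bounded_linear.has_vector_derivative[OF bounded_linear_transpose assms(4)]
  have "((\<lambda>t. \<gamma> t ** transpose (\<gamma> t)) has_vector_derivative
      \<gamma> t ** transpose v + v ** transpose (\<gamma> t)) (at t within {a..b})"
    by (rule bounded_bilinear.has_vector_derivative[OF bounded_bilinear_matrix_mult assms(4)])
  moreover have "((\<lambda>t. \<gamma> t ** transpose (\<gamma> t)) has_vector_derivative 0) (at t within {a..b})"
    by (rule has_vector_derivative_transform[OF assms(2) _ has_vector_derivative_const])
       (use assms(1) in \<open>simp add: SO_mult_transpose\<close>)
  ultimately have "\<gamma> t ** transpose v + v ** transpose (\<gamma> t) = 0"
    using assms(2,3) by (intro vector_derivative_unique_within_closed_interval[of a b t]) auto
  then show ?thesis
    by (simp add: matrix_transpose_mul eq_neg_iff_add_eq_0)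
qed

text \<open>The coefficient subtracts the orthogonal projection of h on J, so the squared norm falls
  by \<open>(h \<bullet> J)\<^sup>2 / 2\<close>, where 2 is the squared norm of J; skew-symmetry
  gives \<open>h \<bullet> J = - 2 * h $ i $ j\<close>.\<close>

lemma norm_add_kac_gen:
  assumes "i \<noteq> j" "transpose h = - h"
  shows "(norm ((- (h \<bullet> kac_gen i j) / 2) *\<^sub>R kac_gen i j + h))\<^sup>2 = (norm h)\<^sup>2 - 2 * (h $ i $ j)\<^sup>2"
proof -
  have "transpose h $ i $ j = (- h) $ i $ j" by (simp only: assms(2))
  then have "h $ j $ i = - h $ i $ j" by (simp add: transpose_def)
  then have h: "h \<bullet> kac_gen i j = - 2 * h $ i $ j"
    using inner_kac_gen[OF assms(1), of h] by simp
  have "kac_gen i j \<bullet> kac_gen i j = 2"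
    using norm_kac_gen[OF assms(1)] by (simp add: norm_eq_sqrt_inner)
  then show ?thesis
    unfolding power2_norm_eq_inner
    by (simp add: inner_add_left inner_add_right inner_commute[of "kac_gen i j" h] h power2_eq_square)
qed

text \<open>The diagonal vanishes and each square occurs twice in the norm, so over the C pairs
  exactly one copy of \<open>(norm h)\<^sup>2\<close> is lost. Summing over all i, j with zeros
  outside i < j gives the squared norm of an upper triangular matrix, the shape in which the speeds
  are collected.\<close>

lemma sum_less_pairs_antisym:
  fixes h :: "'n::{finite,linorder} sqmat"
  assumes "transpose h = - h"
  shows "(\<Sum>i\<in>UNIV. \<Sum>j\<in>UNIV. if i < j then (norm h)\<^sup>2 - 2 * (h $ i $ j)\<^sup>2 else 0)
       = (real (CARD('n) choose 2) - 1) * (norm h)\<^sup>2"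
proof -
  have anti: "h $ j $ i = - h $ i $ j" for i j
  proof -
    have "transpose h $ i $ j = (- h) $ i $ j" by (simp only: assms)
    then show ?thesis by (simp add: transpose_def)
  qed
  have diag: "h $ i $ i = 0" for i using anti[of i i] by linarith
  have swap: "(h $ j $ i)\<^sup>2 = (h $ i $ j)\<^sup>2" for i j by (subst anti) simp
  let ?u = "\<lambda>i j. if i < j then (h $ i $ j)\<^sup>2 else 0"
  have "(norm h)\<^sup>2 = (\<Sum>i\<in>UNIV. \<Sum>j\<in>UNIV. ?u i j + ?u j i)"
    unfolding power2_norm_matrix
  proof (intro sum.cong refl)
    fix i j
    show "(h $ i $ j)\<^sup>2 = ?u i j + ?u j i"
      by (cases i j rule: linorder_cases) (simp_all add: diag swap[of i j])
  qed
  also have "\<dots> = (\<Sum>i\<in>UNIV. \<Sum>j\<in>UNIV. ?u i j) + (\<Sum>i\<in>UNIV. \<Sum>j\<in>UNIV. ?u j i)"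
    by (simp add: sum.distrib)
  also have "(\<Sum>i\<in>UNIV. \<Sum>j\<in>UNIV. ?u j i) = (\<Sum>i\<in>UNIV. \<Sum>j\<in>UNIV. ?u i j)"
    by (rule sum.swap)
  finally have 1: "(norm h)\<^sup>2 = 2 * (\<Sum>i\<in>UNIV. \<Sum>j\<in>UNIV. ?u i j)" by simp
  have "(\<Sum>i\<in>UNIV. \<Sum>j\<in>UNIV. if i < (j::'n) then (norm h)\<^sup>2 else 0)
      = (\<Sum>p\<in>UNIV \<times> UNIV. if fst p < (snd p :: 'n) then (norm h)\<^sup>2 else 0)"
    unfolding sum.cartesian_product by (intro sum.cong) auto
  also have "\<dots> = (\<Sum>p\<in>{(i, j). i < (j::'n)}. (norm h)\<^sup>2)"
    by (rule sum.mono_neutral_cong_right) auto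
  finally have 2: "(\<Sum>i\<in>UNIV. \<Sum>j\<in>UNIV. if i < (j::'n) then (norm h)\<^sup>2 else 0)
      = real (CARD('n) choose 2) * (norm h)\<^sup>2"
    by (simp add: card_less_pairs)
  have "(\<Sum>i\<in>UNIV. \<Sum>j\<in>UNIV. if i < j then (norm h)\<^sup>2 - 2 * (h $ i $ j)\<^sup>2 else 0)
     = (\<Sum>i\<in>UNIV. \<Sum>j\<in>UNIV. (if i < j then (norm h)\<^sup>2 else 0) - 2 * ?u i j)"
    by (intro sum.cong) auto
  also have "\<dots> = real (CARD('n) choose 2) * (norm h)\<^sup>2 - 2 * (\<Sum>i\<in>UNIV. \<Sum>j\<in>UNIV. ?u i j)"
    by (simp add: sum_subtractf 2 sum_distrib_left)
  finally show ?thesis using 1 by (simp add: algebra_simps)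
qed

text \<open>The angle \<open>\<phi> i j\<close> is driven so that the rotated curve has no velocity component along
  \<open>kac_gen i j\<close>.\<close>
lemma rotated_segment:
  fixes \<gamma> :: "real \<Rightarrow> 'n::{finite,linorder} sqmat"
  assumes st: "s < t" and sm: "smooth_on_interval \<gamma> s t"
    and d: "\<And>u. u \<in> {s..t} \<Longrightarrow> (\<gamma> has_vector_derivative \<gamma>' u) (at u within {s..t})"
    and ck: "\<And>n. Ck n {s..t} \<gamma>'" and SO: "\<And>u. u \<in> {s..t} \<Longrightarrow> \<gamma> u \<in> SO"
  shows "\<exists>\<phi> (\<delta> :: 'n sqmat).
    norm \<delta> \<le> sqrt (real (CARD('n) choose 2) - 1) * integral {s..t} (\<lambda>u. norm (\<gamma>' u)) \<and>
    (\<forall>i j. i < j \<longrightarrow> SO_dist (\<gamma> s) (kac_rotation i j (\<phi> i j) ** \<gamma> t) \<le> \<delta> $ i $ j)"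
proof -
  define H where "H u = \<gamma>' u ** transpose (\<gamma> u)" for u
  have ck_\<gamma>: "Ck n {s..t} \<gamma>" for n using sm by (rule smooth_imp_Ck)
  have ck_H: "Ck n {s..t} H" for n
    unfolding H_def
    by (intro Ck_bilinear[OF bounded_bilinear_matrix_mult] ck Ck_linear[OF bounded_linear_transpose] ck_\<gamma>)
  have anti: "transpose (H u) = - H u" if "u \<in> {s..t}" for u
    unfolding H_def by (rule antisym_velocity[OF SO that st d[OF that]])
  have H_\<gamma>: "H u ** \<gamma> u = \<gamma>' u" if "u \<in> {s..t}" for u
    unfolding H_def by (simp add: matrix_mul_assoc[symmetric] SO_transpose_mult[OF SO[OF that]])
  have norm_H: "norm (H u) = norm (\<gamma>' u)" if "u \<in> {s..t}" for u
    using norm_SO_mult_right[OF SO[OF that], of "H u"] H_\<gamma>[OF that] by simp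
  define \<psi> where "\<psi> i j u = - (H u \<bullet> kac_gen i j) / 2" for i j u
  \<comment> \<open>\<phi> i j s = 0, so the rotated curve starts at \<gamma> s itself.\<close>
  define \<phi> where "\<phi> i j u = integral {s..u} (\<psi> i j)" for i j u
  have ck_\<psi>: "Ck n {s..t} (\<psi> i j)" for n i j
  proof -
    have "bounded_linear (\<lambda>h. - (h \<bullet> kac_gen i j) / 2)"
      by (simp add: linear_conv_bounded_linear[symmetric])
         (auto intro!: linearI simp: inner_add_left add_divide_distrib)
    then show ?thesis unfolding \<psi>_def using ck_H by (rule Ck_linear)
  qed
  have d_\<phi>: "(\<phi> i j has_vector_derivative \<psi> i j u) (at u within {s..t})" if "u \<in> {s..t}" for i j u
    unfolding \<phi>_def
    by (rule integral_has_vector_derivative[OF Ck_continuous_on[OF ck_\<psi>] that])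
  have ck_\<phi>: "Ck n {s..t} (\<phi> i j)" for n i j
    by (rule Ck_mono, rule Ck_SucI[OF d_\<phi> ck_\<psi>])
  define W where "W i j u = \<psi> i j u *\<^sub>R kac_gen i j + H u" for i j u
  have cont_H: "continuous_on {s..t} H" by (rule Ck_continuous_on[OF ck_H])
  have cont_W: "continuous_on {s..t} (W i j)" for i j
    unfolding W_def by (intro continuous_intros Ck_continuous_on[OF ck_\<psi>] cont_H)
  have norm_W: "(norm (W i j u))\<^sup>2 = (norm (H u))\<^sup>2 - 2 * (H u $ i $ j)\<^sup>2" if "u \<in> {s..t}" "i < j" for i j u
    unfolding W_def \<psi>_def using that by (intro norm_add_kac_gen anti) auto
  have dist: "SO_dist (\<gamma> s) (kac_rotation i j (\<phi> i j t) ** \<gamma> t) \<le> integral {s..t} (\<lambda>u. norm (W i j u))"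
    if ij: "i < j" for i j
  proof -
    let ?R = "\<lambda>u. kac_rotation i j (\<phi> i j u)"
    let ?\<beta> = "\<lambda>u. ?R u ** \<gamma> u"
    let ?\<beta>' = "\<lambda>u. ?R u ** W i j u ** \<gamma> u"
    have ne: "i \<noteq> j" using ij by simp
    have ckR: "Ck n {s..t} ?R" for n by (rule Ck_rotation[OF ne ck_\<phi>])
    have R: "?R u \<in> SO" for u by (rule kac_rotation_in_SO[OF ne])
    have "SO_curve (?\<beta> s) (?\<beta> t) (integral {s..t} (\<lambda>u. norm (?\<beta>' u)))"
    proof (rule SO_curve_segment[OF st])
      show "smooth_on_interval ?\<beta> s t"
        by (intro Ck_imp_smooth[OF st] Ck_bilinear[OF bounded_bilinear_matrix_mult] ckR ck_\<gamma>)
      fix u assume u: "u \<in> {s..t}"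
      have "(kac_rotation i j \<circ> \<phi> i j has_vector_derivative
          \<psi> i j u *\<^sub>R (?R u ** kac_gen i j)) (at u within {s..t})"
        by (rule vector_diff_chain_within[OF d_\<phi>[OF u] kac_rotation_deriv[OF ne]])
      then have "(?R has_vector_derivative \<psi> i j u *\<^sub>R (?R u ** kac_gen i j)) (at u within {s..t})"
        by (simp only: o_def)
      from bounded_bilinear.has_vector_derivative[OF bounded_bilinear_matrix_mult this d[OF u]]
      have "(?\<beta> has_vector_derivative ?R u ** \<gamma>' u + (\<psi> i j u *\<^sub>R (?R u ** kac_gen i j)) ** \<gamma> u)
          (at u within {s..t})" .
      also have "?R u ** \<gamma>' u + (\<psi> i j u *\<^sub>R (?R u ** kac_gen i j)) ** \<gamma> u = ?\<beta>' u"
      proof -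
        interpret bounded_bilinear "(**) :: 'n sqmat \<Rightarrow> 'n sqmat \<Rightarrow> 'n sqmat"
          by (rule bounded_bilinear_matrix_mult)
        show ?thesis
          by (simp add: W_def add_left add_right scaleR_left scaleR_right H_\<gamma>[OF u] matrix_mul_assoc[symmetric])
      qed
      finally show "(?\<beta> has_vector_derivative ?\<beta>' u) (at u within {s..t})" .
    next
      show "continuous_on {s..t} ?\<beta>'"
        by (intro bounded_bilinear.continuous_on[OF bounded_bilinear_matrix_mult] cont_W
            Ck_continuous_on[OF ckR] Ck_continuous_on[OF ck_\<gamma>])
      show "?\<beta> ` {s..t} \<subseteq> SO" using SO R SO_mult by blast
    qed
    \<comment> \<open>The rotation on the left and \<gamma> on the right are orthogonal and drop out
      of the norm.\<close>
    moreover have "integral {s..t} (\<lambda>u. norm (?\<beta>' u)) = integral {s..t} (\<lambda>u. norm (W i j u))"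
      by (intro integral_cong) (simp add: norm_SO_mult_right[OF SO] norm_SO_mult_left[OF R])
    ultimately show ?thesis using SO_dist_le by (fastforce simp: \<phi>_def kac_rotation_0)
  qed
  \<comment> \<open>The speeds of all rotated curves as one matrix, whose norm is the Euclidean norm
    over the pairs i < j.\<close>
  define S where "S u = (\<chi> i j. if i < j then norm (W i j u) else 0)" for u
  have cont_S: "continuous_on {s..t} S"
    unfolding S_def
  proof (intro continuous_on_vec_lambda)
    fix i j :: 'n
    show "continuous_on {s..t} (\<lambda>u. if i < j then norm (W i j u) else 0)"
      using cont_W by (cases "i < j") (auto intro: continuous_intros)
  qed
  have norm_S: "norm (S u) = sqrt (real (CARD('n) choose 2) - 1) * norm (\<gamma>' u)" if u: "u \<in> {s..t}" for u
  proof -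
    have "(norm (S u))\<^sup>2 = (\<Sum>i\<in>UNIV. \<Sum>j\<in>UNIV. if i < j then (norm (H u))\<^sup>2 - 2 * (H u $ i $ j)\<^sup>2 else 0)"
      unfolding power2_norm_matrix[of "S u"] by (intro sum.cong refl) (auto simp: S_def norm_W[OF u])
    also have "\<dots> = (real (CARD('n) choose 2) - 1) * (norm (\<gamma>' u))\<^sup>2"
      by (simp add: sum_less_pairs_antisym[OF anti[OF u]] norm_H[OF u])
    finally have "sqrt ((norm (S u))\<^sup>2) = sqrt ((real (CARD('n) choose 2) - 1) * (norm (\<gamma>' u))\<^sup>2)" by simp
    then show ?thesis by (simp add: real_sqrt_mult)
  qed
  have int_\<gamma>': "(\<lambda>u. norm (\<gamma>' u)) integrable_on {s..t}"
    by (intro integrable_continuous_interval continuous_intros Ck_continuous_on[OF ck])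
  have int_S: "S integrable_on {s..t}" by (rule integrable_continuous_interval[OF cont_S])
  \<comment> \<open>The entries of the integral of S are the lengths of the rotated curves; bounding
    its norm by the integral of the norm estimates all of them jointly.\<close>
  have "norm (integral {s..t} S) \<le> integral {s..t} (\<lambda>u. sqrt (real (CARD('n) choose 2) - 1) * norm (\<gamma>' u))"
    using int_S by (rule integral_norm_bound_integral) (use int_\<gamma>' norm_S in \<open>auto intro: integrable_on_mult_right\<close>)
  also have "\<dots> = sqrt (real (CARD('n) choose 2) - 1) * integral {s..t} (\<lambda>u. norm (\<gamma>' u))"
    by (rule integral_mult_right)
  finally have 1: "norm (integral {s..t} S) \<le> sqrt (real (CARD('n) choose 2) - 1) * integral {s..t} (\<lambda>u. norm (\<gamma>' u))" .
  have 2: "integral {s..t} S $ i $ j = integral {s..t} (\<lambda>u. norm (W i j u))" if "i < j" for i j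
  proof -
    have "bounded_linear (\<lambda>a :: 'n sqmat. a $ i $ j)"
      by (intro bounded_linear_compose[OF bounded_linear_vec_nth bounded_linear_vec_nth])
    from integral_linear[OF int_S this] show ?thesis
      using that by (simp add: o_def S_def)
  qed
  show ?thesis
    by (intro exI[of _ "\<lambda>i j. \<phi> i j t"] exI[of _ "integral {s..t} S"] conjI 1 allI impI)
       (simp add: 2 dist)
qed

text \<open>Over successive pieces the angles add, and left invariance places the next piece behind
  the rotation already made. The bounds are kept as a matrix \<delta> because such matrices add
  entrywise and their norms obey the triangle inequality, whereas sums of squares would not add
  up.\<close>

lemma rotated_curve:
  fixes x y :: "'n::{finite,linorder} sqmat"
  assumes "SO_curve x y l"
  shows "\<exists>\<phi> (\<delta> :: 'n sqmat). norm \<delta> \<le> sqrt (real (CARD('n) choose 2) - 1) * l \<and>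
    (\<forall>i j. i < j \<longrightarrow> SO_dist x (kac_rotation i j (\<phi> i j) ** y) \<le> \<delta> $ i $ j)"
proof -
  let ?K = "sqrt (real (CARD('n) choose 2) - 1)"
  from assms obtain \<gamma> where \<gamma>: "piecewise_smooth_path \<gamma>" "path_image \<gamma> \<subseteq> SO"
    "pathstart \<gamma> = x" "pathfinish \<gamma> = y" "hs_length \<gamma> = l"
    unfolding SO_curve_def by blast
  then obtain m \<tau> where \<tau>: "\<tau> 0 = 0" "\<tau> m = 1"
    "\<And>k. k < m \<Longrightarrow> \<tau> k < \<tau> (Suc k)" "\<And>k. k < m \<Longrightarrow> smooth_on_interval \<gamma> (\<tau> k) (\<tau> (Suc k))"
    unfolding piecewise_smooth_path_def by blast
  have SO: "\<gamma> u \<in> SO" if "u \<in> {0..1}" for u using \<gamma>(2) that by (auto simp: path_image_def)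
  have int: "speed \<gamma> integrable_on {0..1}" by (rule speed_integrable_breakpoints[OF \<tau>])
  have "k \<le> m \<Longrightarrow> \<exists>\<phi> (\<delta> :: 'n sqmat). norm \<delta> \<le> ?K * integral {0..\<tau> k} (speed \<gamma>) \<and>
    (\<forall>i j. i < j \<longrightarrow> SO_dist x (kac_rotation i j (\<phi> i j) ** \<gamma> (\<tau> k)) \<le> \<delta> $ i $ j)" for k
  proof (induction k)
    case 0
    have "\<gamma> 0 = x" "x \<in> SO" using \<gamma>(3) SO[of 0] by (auto simp: pathstart_def)
    then show ?case
      by (intro exI[of _ "\<lambda>_ _. 0"] exI[of _ 0]) (simp add: \<tau>(1) kac_rotation_0 SO_dist_refl)
  next
    case (Suc k)
    then have k: "k < m" by simp
    have t: "0 \<le> \<tau> k" "\<tau> k < \<tau> (Suc k)" "\<tau> (Suc k) \<le> 1"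
      using breakpoints_mono[of m \<tau> 0 k] breakpoints_mono[of m \<tau> "Suc k" m] \<tau> k by auto
    let ?I = "{\<tau> k..\<tau> (Suc k)}"
    obtain \<gamma>' where g: "\<And>u. u \<in> ?I \<Longrightarrow> (\<gamma> has_vector_derivative \<gamma>' u) (at u within ?I)"
      "\<And>n. Ck n ?I \<gamma>'"
      using smooth_obtain_derivative[OF \<tau>(4,3)[OF k]] by blast
    have SO': "\<gamma> u \<in> SO" if "u \<in> ?I" for u using SO that t by auto
    obtain \<phi> and \<delta> :: "'n sqmat" where 1: "norm \<delta> \<le> ?K * integral {0..\<tau> k} (speed \<gamma>)"
      "\<And>i j. i < j \<Longrightarrow> SO_dist x (kac_rotation i j (\<phi> i j) ** \<gamma> (\<tau> k)) \<le> \<delta> $ i $ j"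
      using Suc by auto
    obtain \<phi>' and \<delta>' :: "'n sqmat" where 2: "norm \<delta>' \<le> ?K * integral ?I (\<lambda>u. norm (\<gamma>' u))"
      "\<And>i j. i < j \<Longrightarrow> SO_dist (\<gamma> (\<tau> k)) (kac_rotation i j (\<phi>' i j) ** \<gamma> (\<tau> (Suc k))) \<le> \<delta>' $ i $ j"
      using rotated_segment[OF t(2) \<tau>(4)[OF k] g SO'] by blast
    have "integral ?I (speed \<gamma>) = integral ?I (\<lambda>u. norm (\<gamma>' u))"
      using speed_has_integral_piece[of "\<tau> k" "\<tau> (Suc k)" \<gamma> \<gamma>'] g Ck_continuous_on t
      by (intro integral_unique) blast
    moreover have "integral {0..\<tau> k} (speed \<gamma>) + integral ?I (speed \<gamma>) = integral {0..\<tau> (Suc k)} (speed \<gamma>)"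
      using t integrable_on_subinterval[OF int, of 0 "\<tau> (Suc k)"]
      by (intro Henstock_Kurzweil_Integration.integral_combine) auto
    ultimately have "?K * integral {0..\<tau> k} (speed \<gamma>) + ?K * integral ?I (\<lambda>u. norm (\<gamma>' u))
        = ?K * integral {0..\<tau> (Suc k)} (speed \<gamma>)"
      by (simp add: distrib_left[symmetric])
    then have n: "norm (\<delta> + \<delta>') \<le> ?K * integral {0..\<tau> (Suc k)} (speed \<gamma>)"
      using 1(1) 2(1) norm_triangle_ineq[of \<delta> \<delta>'] by linarith
    have "SO_dist x (kac_rotation i j (\<phi> i j + \<phi>' i j) ** \<gamma> (\<tau> (Suc k))) \<le> (\<delta> + \<delta>') $ i $ j"
      if ij: "i < j" for i j
    proof -
      have ne: "i \<noteq> j" using ij by simp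
      let ?R = "kac_rotation i j"
      have x: "x \<in> SO" using \<gamma>(3) SO[of 0] by (auto simp: pathstart_def)
      have SO1: "\<gamma> (\<tau> k) \<in> SO" "\<gamma> (\<tau> (Suc k)) \<in> SO" using SO' t by auto
      have eq: "?R (\<phi> i j + \<phi>' i j) ** \<gamma> (\<tau> (Suc k)) = ?R (\<phi> i j) ** (?R (\<phi>' i j) ** \<gamma> (\<tau> (Suc k)))"
        by (simp add: kac_rotation_add[OF ne, symmetric] matrix_mul_assoc)
      have "SO_dist x (?R (\<phi> i j + \<phi>' i j) ** \<gamma> (\<tau> (Suc k)))
          \<le> SO_dist x (?R (\<phi> i j) ** \<gamma> (\<tau> k))
            + SO_dist (?R (\<phi> i j) ** \<gamma> (\<tau> k)) (?R (\<phi> i j) ** (?R (\<phi>' i j) ** \<gamma> (\<tau> (Suc k))))"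
        unfolding eq using x SO1 ne by (intro SO_dist_triangle SO_mult kac_rotation_in_SO)
      also have "\<dots> \<le> SO_dist x (?R (\<phi> i j) ** \<gamma> (\<tau> k))
            + SO_dist (\<gamma> (\<tau> k)) (?R (\<phi>' i j) ** \<gamma> (\<tau> (Suc k)))"
        using SO1 ne by (intro add_left_mono SO_dist_mult_left_le SO_mult kac_rotation_in_SO)
      also have "\<dots> \<le> \<delta> $ i $ j + \<delta>' $ i $ j"
        by (intro add_mono 1(2) 2(2) ij)
      finally show ?thesis by simp
    qed
    with n show ?case
      by (intro exI[of _ "\<lambda>i j. \<phi> i j + \<phi>' i j"] exI[of _ "\<delta> + \<delta>'"]) blast
  qed
  from this[of m] show ?thesis using \<gamma>(4,5) by (simp add: \<tau>(2) hs_length_eq pathfinish_def)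
qed

text \<open>Brings the angle into the range in which \<open>nn_integral_period_2pi\<close> allows a
  shift.\<close>

lemma kac_rotation_mod_2pi:
  obtains \<phi>' where "0 \<le> \<phi>'" "\<phi>' < 2*pi" "\<And>\<theta>. kac_rotation i j (\<theta> + \<phi>') = kac_rotation i j (\<theta> + \<phi>)"
proof -
  obtain t where t: "0 \<le> t" "t < 2*pi" "cos \<phi> = cos t" "sin \<phi> = sin t"
    using sincos_total_2pi[of "cos \<phi>" "sin \<phi>"] by auto
  have "cos (\<theta> + t) = cos (\<theta> + \<phi>)" "sin (\<theta> + t) = sin (\<theta> + \<phi>)" for \<theta>
    by (simp_all add: cos_add sin_add t)
  then have "kac_rotation i j (\<theta> + t) = kac_rotation i j (\<theta> + \<phi>)" for \<theta>
    by (simp only: kac_rotation_def)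
  then show ?thesis by (rule that[OF t(1,2)])
qed

lemma rotated_pair:
  fixes x y :: "'n::{finite,linorder} sqmat"
  assumes n: "2 \<le> CARD('n)" and xy: "x \<in> SO" "y \<in> SO" and e: "0 < e"
  shows "\<exists>\<phi>. (\<forall>i j. 0 \<le> \<phi> i j \<and> \<phi> i j < 2*pi) \<and>
    (\<Sum>(i, j)\<in>{(i, j). i < j}. (SO_dist x (kac_rotation i j (\<phi> i j) ** y))\<^sup>2)
      \<le> (real (CARD('n) choose 2) - 1) * (SO_dist x y + e)\<^sup>2"
proof -
  let ?C = "real (CARD('n) choose 2)"
  have C: "1 \<le> ?C" using n zero_less_binomial[of 2 "CARD('n)"] by linarith
  obtain l where l: "SO_curve x y l" "l < SO_dist x y + e" using SO_dist_approx[OF xy e] by blast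
  obtain \<phi> and \<delta> :: "'n sqmat" where 1: "norm \<delta> \<le> sqrt (?C - 1) * l"
    "\<And>i j. i < j \<Longrightarrow> SO_dist x (kac_rotation i j (\<phi> i j) ** y) \<le> \<delta> $ i $ j"
    using rotated_curve[OF l(1)] by blast
  have "\<exists>\<phi>'. 0 \<le> \<phi>' \<and> \<phi>' < 2*pi \<and> kac_rotation i j \<phi>' = kac_rotation i j (\<phi> i j)" for i j
    by (rule kac_rotation_mod_2pi[of i j "\<phi> i j"]) (metis add_0)
  then obtain \<phi>' where \<phi>': "\<And>i j. 0 \<le> \<phi>' i j \<and> \<phi>' i j < 2*pi"
    "\<And>i j. kac_rotation i j (\<phi>' i j) = kac_rotation i j (\<phi> i j)" by metis
  have "(\<Sum>(i, j)\<in>{(i, j). i < j}. (SO_dist x (kac_rotation i j (\<phi>' i j) ** y))\<^sup>2)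
      \<le> (\<Sum>(i, j)\<in>{(i, j). i < j}. (\<delta> $ i $ j)\<^sup>2)"
  proof (rule sum_mono)
    fix p :: "'n \<times> 'n" assume "p \<in> {(i, j). i < j}"
    then obtain i j where p: "p = (i, j)" "i < j" by auto
    then have "0 \<le> SO_dist x (kac_rotation i j (\<phi>' i j) ** y)"
      using xy by (intro SO_dist_nonneg SO_mult kac_rotation_in_SO) auto
    then show "(case p of (i, j) \<Rightarrow> (SO_dist x (kac_rotation i j (\<phi>' i j) ** y))\<^sup>2) \<le> (case p of (i, j) \<Rightarrow> (\<delta> $ i $ j)\<^sup>2)"
      using 1(2)[OF p(2)] by (simp add: p \<phi>'(2) power_mono)
  qed
  \<comment> \<open>The squares of the remaining entries of \<delta> only enlarge the sum.\<close>
  also have "\<dots> \<le> (\<Sum>(i, j)\<in>UNIV \<times> UNIV. (\<delta> $ i $ j)\<^sup>2)"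
    by (rule sum_mono2) auto
  also have "\<dots> = (norm \<delta>)\<^sup>2"
    by (simp add: power2_norm_matrix sum.cartesian_product)
  also have "\<dots> \<le> (sqrt (?C - 1) * l)\<^sup>2"
    using 1(1) by (intro power_mono) auto
  also have "\<dots> = (?C - 1) * l\<^sup>2" using C by (simp add: power_mult_distrib)
  also have "\<dots> \<le> (?C - 1) * (SO_dist x y + e)\<^sup>2"
    using C l SO_curve_nonneg[OF l(1)] by (intro mult_left_mono power_mono) auto
  finally show ?thesis using \<phi>'(1) by blast
qed

section \<open>Coupling one step of the walk\<close>

text \<open>The part of the shifted interval beyond 2\<pi> is moved back by one period and fills the
  gap between 0 and \<phi>; since \<phi> is below one period there is a single such part.\<close>

lemma nn_integral_period_2pi:
  fixes f :: "real \<Rightarrow> ennreal"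
  assumes f[measurable]: "f \<in> borel_measurable borel" and per: "\<And>t. f (t + 2*pi) = f t"
    and \<phi>: "0 \<le> \<phi>" "\<phi> < 2*pi"
  shows "(\<integral>\<^sup>+t\<in>{0..2*pi}. f (t + \<phi>) \<partial>lborel) = (\<integral>\<^sup>+t\<in>{0..2*pi}. f t \<partial>lborel)"
proof -
  \<comment> \<open>Half-open intervals join without overlap; the end point given up is a null
    set.\<close>
  have half: "(\<integral>\<^sup>+t\<in>{0..2*pi}. g t \<partial>lborel) = (\<integral>\<^sup>+t\<in>{0<..2*pi}. g t \<partial>lborel)" for g :: "real \<Rightarrow> ennreal"
    by (intro nn_integral_cong_AE) (use AE_lborel_singleton[of "0::real"] in \<open>auto simp: indicator_def\<close>)
  have split: "(\<integral>\<^sup>+t\<in>{a<..b}. f t \<partial>lborel) + (\<integral>\<^sup>+t\<in>{b<..c}. f t \<partial>lborel) = (\<integral>\<^sup>+t\<in>{a<..c}. f t \<partial>lborel)"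
    if "a \<le> b" "b \<le> c" for a b c
  proof -
    have "(\<integral>\<^sup>+t\<in>{a<..b}. f t \<partial>lborel) + (\<integral>\<^sup>+t\<in>{b<..c}. f t \<partial>lborel)
        = (\<integral>\<^sup>+t. f t * indicator {a<..b} t + f t * indicator {b<..c} t \<partial>lborel)"
      by (rule nn_integral_add[symmetric]) auto
    also have "\<dots> = (\<integral>\<^sup>+t\<in>{a<..c}. f t \<partial>lborel)"
      using that by (intro nn_integral_cong) (auto simp: indicator_def)
    finally show ?thesis .
  qed
  have shift: "(\<integral>\<^sup>+t\<in>{a<..b}. f (t + c) \<partial>lborel) = (\<integral>\<^sup>+t\<in>{a + c<..b + c}. f t \<partial>lborel)" for a b c
    by (subst (2) nn_integral_real_affine[of _ 1 c])
       (auto intro!: nn_integral_cong simp: indicator_def add.commute)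
  have "(\<integral>\<^sup>+t\<in>{0..2*pi}. f (t + \<phi>) \<partial>lborel) = (\<integral>\<^sup>+t\<in>{\<phi><..2*pi + \<phi>}. f t \<partial>lborel)"
    by (simp only: half[of "\<lambda>t. f (t + \<phi>)"] shift[where a = 0 and b = "2*pi" and c = \<phi>] add_0_left)
  also have "\<dots> = (\<integral>\<^sup>+t\<in>{\<phi><..2*pi}. f t \<partial>lborel) + (\<integral>\<^sup>+t\<in>{0 + 2*pi<..\<phi> + 2*pi}. f t \<partial>lborel)"
    using split[of \<phi> "2*pi" "2*pi + \<phi>"] \<phi> by (simp add: add.commute)
  also have "\<dots> = (\<integral>\<^sup>+t\<in>{0<..\<phi>}. f t \<partial>lborel) + (\<integral>\<^sup>+t\<in>{\<phi><..2*pi}. f t \<partial>lborel)"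
    unfolding shift[symmetric] per by (rule add.commute)
  also have "\<dots> = (\<integral>\<^sup>+t\<in>{0..2*pi}. f t \<partial>lborel)"
    using split[of 0 \<phi> "2*pi"] \<phi> half[of f] by simp
  finally show ?thesis .
qed

section \<open>The common source of randomness of one coupled step\<close>

text \<open>Adjoins to \<eta> an independent uniform pair of axes and a uniform angle; both
  coordinates of the new coupling are functions of this one source.\<close>

definition with_kac_choice :: "'a measure \<Rightarrow> ('a \<times> ('n::{finite,linorder} \<times> 'n) \<times> real) measure" where
  "with_kac_choice \<eta> = \<eta> \<Otimes>\<^sub>M (measure_pmf (pmf_of_set {(i, j). i < j}) \<Otimes>\<^sub>M uniform_measure lborel {0..2*pi})"

lemma prob_space_uniform_angle: "prob_space (uniform_measure lborel {0..2*pi})"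
  by (rule prob_space_uniform_measure) auto

lemma prob_space_with_kac_choice: "prob_space \<eta> \<Longrightarrow> prob_space (with_kac_choice \<eta>)"
  unfolding with_kac_choice_def
  by (intro prob_space_pair prob_space_uniform_angle prob_space_measure_pmf)

lemma less_pairs_nonempty:
  assumes "2 \<le> CARD('n::{finite,linorder})"
  shows "{(i, j). i < (j::'n)} \<noteq> {}"
  using card_less_pairs[where 'n = 'n] zero_less_binomial[OF assms] by (metis card.empty less_irrefl)

text \<open>The factors 1 / (2\<pi>) and 1 / C come from the uniform angle and the uniform pair. The
  right side has the form of \<open>kac_kernel_fun\<close>, so marginals can be compared plane by
  plane.\<close>

lemma nn_integral_with_kac_choice:
  fixes g :: "'a \<times> ('n::{finite,linorder} \<times> 'n) \<times> real \<Rightarrow> ennreal"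
  assumes n: "2 \<le> CARD('n)" and g: "g \<in> borel_measurable (with_kac_choice \<eta>)"
  shows "(\<integral>\<^sup>+q. g q \<partial>with_kac_choice \<eta>) =
    (\<integral>\<^sup>+z. ennreal (1 / (2 * pi * real (CARD('n) choose 2))) *
      (\<Sum>p\<in>{(i, j). i < j}. \<integral>\<^sup>+\<theta>\<in>{0..2*pi}. g (z, p, \<theta>) \<partial>lborel) \<partial>\<eta>)"
proof -
  let ?P = "{(i, j). i < (j::'n)}"
  let ?U = "measure_pmf (pmf_of_set ?P)"
  let ?V = "uniform_measure lborel {0..2*pi}"
  interpret V: prob_space ?V by (rule prob_space_uniform_angle)
  interpret UV: prob_space "?U \<Otimes>\<^sub>M ?V"
    by (intro prob_space_pair prob_space_uniform_angle prob_space_measure_pmf)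
  have g': "g \<in> borel_measurable (\<eta> \<Otimes>\<^sub>M (?U \<Otimes>\<^sub>M ?V))"
    using g by (simp add: with_kac_choice_def)
  have C: "0 < real (CARD('n) choose 2)"
    using zero_less_binomial[OF n] by simp
  have "(\<integral>\<^sup>+w. g (z, w) \<partial>(?U \<Otimes>\<^sub>M ?V)) = ennreal (1 / (2 * pi * real (CARD('n) choose 2))) *
      (\<Sum>p\<in>?P. \<integral>\<^sup>+\<theta>\<in>{0..2*pi}. g (z, p, \<theta>) \<partial>lborel)" if z: "z \<in> space \<eta>" for z
  proof -
    have gz: "(\<lambda>w. g (z, w)) \<in> borel_measurable (?U \<Otimes>\<^sub>M ?V)"
      using measurable_compose[OF measurable_Pair1'[OF z] g'] by simp
    have gzp: "(\<lambda>\<theta>. g (z, p, \<theta>)) \<in> borel_measurable lborel" for p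
    proof -
      have "p \<in> space ?U" by simp
      from measurable_compose[OF measurable_Pair1'[OF this] gz]
      have "(\<lambda>\<theta>. g (z, p, \<theta>)) \<in> borel_measurable ?V" .
      then show ?thesis by (simp cong: measurable_cong_sets)
    qed
    have "(\<integral>\<^sup>+w. g (z, w) \<partial>(?U \<Otimes>\<^sub>M ?V)) = (\<integral>\<^sup>+p. \<integral>\<^sup>+\<theta>. g (z, p, \<theta>) \<partial>?V \<partial>?U)"
      by (rule V.nn_integral_fst[OF gz, symmetric])
    also have "\<dots> = (\<Sum>p\<in>?P. \<integral>\<^sup>+\<theta>. g (z, p, \<theta>) \<partial>?V) / ennreal (real (card ?P))"
      by (subst nn_integral_pmf_of_set[OF less_pairs_nonempty[OF n]]) (auto simp: ennreal_of_nat_eq_real_of_nat)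
    also have "\<dots> = (\<Sum>p\<in>?P. (\<integral>\<^sup>+\<theta>\<in>{0..2*pi}. g (z, p, \<theta>) \<partial>lborel) * ennreal (inverse (2 * pi)))
        * ennreal (inverse (real (CARD('n) choose 2)))"
      using C by (subst nn_integral_uniform_measure[OF gzp])
        (auto simp: card_less_pairs divide_ennreal_def inverse_ennreal)
    also have "\<dots> = ennreal (1 / (2 * pi * real (CARD('n) choose 2))) *
      (\<Sum>p\<in>?P. \<integral>\<^sup>+\<theta>\<in>{0..2*pi}. g (z, p, \<theta>) \<partial>lborel)"
    proof -
      have "ennreal (1 / (2 * pi * real (CARD('n) choose 2)))
          = ennreal (inverse (2 * pi)) * ennreal (inverse (real (CARD('n) choose 2)))"
        using C by (simp add: ennreal_mult'[symmetric] field_simps)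
      then show ?thesis by (simp only: sum_distrib_right[symmetric]) (simp only: mult_ac)
    qed
    finally show ?thesis .
  qed
  then show ?thesis
    unfolding with_kac_choice_def UV.nn_integral_fst[OF g', symmetric]
    by (intro nn_integral_cong) simp
qed

text \<open>Set to the identity unless the pair is increasing, so that it always lies in SO;
  \<open>kac_rotation i i\<close> need not. The uniform pair has no mass on the added cases.\<close>

definition kac_rot :: "'n::{finite,linorder} \<times> 'n \<Rightarrow> real \<Rightarrow> 'n sqmat" where
  "kac_rot p \<theta> = (if fst p < snd p then kac_rotation (fst p) (snd p) \<theta> else mat 1)"

lemma kac_rot_in_SO: "kac_rot p \<theta> \<in> SO"
  unfolding kac_rot_def using kac_rotation_in_SO[of "fst p" "snd p" \<theta>] by (auto simp: SO_def)

lemma measurable_kac_rot: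
  assumes f: "f \<in> borel_measurable M" and h: "h \<in> M \<rightarrow>\<^sub>M SO_borel"
  shows "(\<lambda>q. kac_rot p (f q) ** h q) \<in> M \<rightarrow>\<^sub>M SO_borel"
proof (cases "fst p < snd p")
  case True
  have "(\<lambda>q. (f q, h q)) \<in> M \<rightarrow>\<^sub>M lborel \<Otimes>\<^sub>M SO_borel"
    using f h by (intro measurable_Pair) auto
  from measurable_compose[OF this measurable_kac_rotation_mult[of "fst p" "snd p"]] True
  show ?thesis by (simp add: kac_rot_def)
next
  case False
  then show ?thesis using h by (simp add: kac_rot_def)
qed

text \<open>Both points turn in the same plane by the same random angle, up to an offset that
  depends on the plane and the two points but not on the angle.\<close>

definition kac_pair :: "('n \<times> 'n \<Rightarrow> 'n::{finite,linorder} sqmat \<times> 'n sqmat \<Rightarrow> real) \<Rightarrow>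
    ('n sqmat \<times> 'n sqmat) \<times> ('n \<times> 'n) \<times> real \<Rightarrow> 'n sqmat \<times> 'n sqmat" where
  "kac_pair \<Phi> = (\<lambda>(z, p, \<theta>). (kac_rot p \<theta> ** fst z, kac_rot p (\<theta> + \<Phi> p z) ** snd z))"

lemma measurable_kac_pair:
  fixes \<eta> :: "('n::{finite,linorder} sqmat \<times> 'n sqmat) measure"
  assumes \<eta>: "sets \<eta> = sets (SO_borel \<Otimes>\<^sub>M SO_borel)" and \<Phi>: "\<And>p. \<Phi> p \<in> borel_measurable \<eta>"
  shows "kac_pair \<Phi> \<in> with_kac_choice \<eta> \<rightarrow>\<^sub>M SO_borel \<Otimes>\<^sub>M SO_borel"
proof -
  let ?Q = "with_kac_choice \<eta> :: (('n sqmat \<times> 'n sqmat) \<times> ('n \<times> 'n) \<times> real) measure"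
  have z: "fst \<in> ?Q \<rightarrow>\<^sub>M \<eta>" unfolding with_kac_choice_def by (rule measurable_fst)
  have "(\<lambda>q. fst (snd q)) \<in> ?Q \<rightarrow>\<^sub>M measure_pmf (pmf_of_set {(i, j). i < j})"
    unfolding with_kac_choice_def by (intro measurable_compose[OF measurable_snd measurable_fst])
  then have p: "(\<lambda>q. fst (snd q)) \<in> ?Q \<rightarrow>\<^sub>M count_space UNIV"
    by (simp cong: measurable_cong_sets)
  have "(\<lambda>q. snd (snd q)) \<in> ?Q \<rightarrow>\<^sub>M uniform_measure lborel {0..2*pi}"
    unfolding with_kac_choice_def by (intro measurable_compose[OF measurable_snd measurable_snd])
  then have \<theta>: "(\<lambda>q. snd (snd q)) \<in> borel_measurable ?Q"
    by (simp cong: measurable_cong_sets)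
  have "fst \<in> \<eta> \<rightarrow>\<^sub>M SO_borel" "snd \<in> \<eta> \<rightarrow>\<^sub>M SO_borel"
    using \<eta> by (simp_all cong: measurable_cong_sets)
  then have xy: "(\<lambda>q. fst (fst q)) \<in> ?Q \<rightarrow>\<^sub>M SO_borel" "(\<lambda>q. snd (fst q)) \<in> ?Q \<rightarrow>\<^sub>M SO_borel"
    using measurable_compose[OF z] by auto
  have "(\<lambda>q. \<Phi> p (fst q)) \<in> borel_measurable ?Q" for p
    using measurable_compose[OF z \<Phi>] by simp
  note \<Phi>' = this
  have "(\<lambda>q. kac_rot p (snd (snd q)) ** fst (fst q)) \<in> ?Q \<rightarrow>\<^sub>M SO_borel"
    "(\<lambda>q. kac_rot p (snd (snd q) + \<Phi> p (fst q)) ** snd (fst q)) \<in> ?Q \<rightarrow>\<^sub>M SO_borel" for p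
    by (rule measurable_kac_rot borel_measurable_add \<theta> xy \<Phi>')+
  note rot = this
  \<comment> \<open>The pair of axes takes finitely many values, so measurability for each fixed
    pair is enough.\<close>
  have "(\<lambda>q. kac_rot (fst (snd q)) (snd (snd q)) ** fst (fst q)) \<in> ?Q \<rightarrow>\<^sub>M SO_borel"
    by (rule measurable_compose_countable'[OF rot(1) p]) (rule countable_finite, simp)
  moreover have "(\<lambda>q. kac_rot (fst (snd q)) (snd (snd q) + \<Phi> (fst (snd q)) (fst q)) ** snd (fst q))
      \<in> ?Q \<rightarrow>\<^sub>M SO_borel"
    by (rule measurable_compose_countable'[OF rot(2) p]) (rule countable_finite, simp)
  ultimately have "(\<lambda>q. (kac_rot (fst (snd q)) (snd (snd q)) ** fst (fst q),
      kac_rot (fst (snd q)) (snd (snd q) + \<Phi> (fst (snd q)) (fst q)) ** snd (fst q))) \<in> ?Q \<rightarrow>\<^sub>M SO_borel \<Otimes>\<^sub>M SO_borel"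
    by (rule measurable_Pair)
  then show ?thesis
    by (simp add: kac_pair_def split_beta)
qed

lemma sets_kac_step:
  fixes \<mu> :: "'n::{finite,linorder} sqmat measure"
  assumes "prob_space \<mu>" "sets \<mu> = sets SO_borel"
  shows "sets (kac_step \<mu>) = sets SO_borel"
  unfolding kac_step_def using assms(1) by (intro sets_bind) (auto simp: prob_space.not_empty)

lemma measurable_kac_kernel_fun:
  fixes A :: "'n::{finite,linorder} sqmat set"
  assumes "2 \<le> CARD('n)" "A \<in> sets SO_borel"
  shows "(\<lambda>x. kac_kernel_fun x A) \<in> borel_measurable SO_borel"
proof -
  have "(\<lambda>x. emeasure (kac_kernel x) A) \<in> borel_measurable SO_borel"
    by (rule measurable_compose[OF measurable_kac_kernel[OF assms(1)] measurable_emeasure_subprob_algebra[OF assms(2)]])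
  then show ?thesis
    by (rule measurable_cong[THEN iffD1, rotated]) (simp add: emeasure_kac_kernel assms(2))
qed

lemma nn_integral_distr_target:
  "T \<in> M \<rightarrow>\<^sub>M N \<Longrightarrow> f \<in> borel_measurable N \<Longrightarrow> (\<integral>\<^sup>+x. f x \<partial>distr M N T) = (\<integral>\<^sup>+x. f (T x) \<partial>M)"
  by (rule nn_integral_distr) simp_all

text \<open>The first point takes a plain step of the walk. For the second, the offset is constant
  while \<theta> runs over a full period, so integration over \<theta> forgets it; averaging over
  \<eta> then gives the step from \<nu>.\<close>

lemma kac_pair_coupling:
  fixes \<mu> \<nu> :: "'n::{finite,linorder} sqmat measure"
  assumes n: "2 \<le> CARD('n)"
    and \<mu>: "prob_space \<mu>" "sets \<mu> = sets SO_borel" and \<nu>: "prob_space \<nu>" "sets \<nu> = sets SO_borel"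
    and \<eta>: "\<eta> \<in> couplings \<mu> \<nu>" and \<Phi>: "\<And>p. \<Phi> p \<in> borel_measurable \<eta>"
    and range: "\<And>p z. 0 \<le> \<Phi> p z \<and> \<Phi> p z < 2*pi"
  shows "distr (with_kac_choice \<eta>) (SO_borel \<Otimes>\<^sub>M SO_borel) (kac_pair \<Phi>) \<in> couplings (kac_step \<mu>) (kac_step \<nu>)"
proof -
  let ?Q = "with_kac_choice \<eta> :: (('n sqmat \<times> 'n sqmat) \<times> ('n \<times> 'n) \<times> real) measure"
  let ?SS = "SO_borel \<Otimes>\<^sub>M SO_borel :: ('n sqmat \<times> 'n sqmat) measure"
  let ?E = "distr ?Q ?SS (kac_pair \<Phi>)"
  from \<eta> have \<eta>': "prob_space \<eta>" "sets \<eta> = sets (\<mu> \<Otimes>\<^sub>M \<nu>)" "distr \<eta> \<mu> fst = \<mu>" "distr \<eta> \<nu> snd = \<nu>"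
    by (auto simp: couplings_def)
  have sets_\<eta>: "sets \<eta> = sets ?SS"
    using \<eta>'(2) sets_pair_measure_cong[OF \<mu>(2) \<nu>(2)] by simp
  have space_\<eta>: "space \<eta> = SO \<times> SO"
    using sets_eq_imp_space_eq[OF sets_\<eta>] by (simp add: space_pair_measure)
  have T: "kac_pair \<Phi> \<in> ?Q \<rightarrow>\<^sub>M ?SS" by (rule measurable_kac_pair[OF sets_\<eta> \<Phi>])
  have fst_snd: "fst \<in> \<eta> \<rightarrow>\<^sub>M \<mu>" "snd \<in> \<eta> \<rightarrow>\<^sub>M \<nu>"
    unfolding measurable_cong_sets[OF \<eta>'(2) refl] by simp_all
  have sets_step: "sets (kac_step \<mu>) = sets SO_borel" "sets (kac_step \<nu>) = sets SO_borel"
    by (rule sets_kac_step[OF \<mu>] sets_kac_step[OF \<nu>])+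
  have coord: "fst \<in> ?SS \<rightarrow>\<^sub>M SO_borel" "snd \<in> ?SS \<rightarrow>\<^sub>M SO_borel" by simp_all
  have emeasure_marginal: "emeasure (distr ?E K h) A = (\<integral>\<^sup>+q. indicator A (h (kac_pair \<Phi> q)) \<partial>?Q)"
    if K: "sets K = sets SO_borel" and h: "h \<in> ?SS \<rightarrow>\<^sub>M SO_borel" and A: "A \<in> sets SO_borel"
    for K :: "'n sqmat measure" and h A
  proof -
    have hK: "h \<in> ?E \<rightarrow>\<^sub>M K" unfolding measurable_cong_sets[OF sets_distr K] by (rule h)
    have "emeasure (distr ?E K h) A = (\<integral>\<^sup>+x. indicator A x \<partial>distr ?E K h)"
      using A by (simp add: K)
    also have "\<dots> = (\<integral>\<^sup>+z. indicator A (h z) \<partial>?E)"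
      by (rule nn_integral_distr_target[OF hK]) (simp only: measurable_cong_sets[OF K refl] borel_measurable_indicator[OF A])
    also have "\<dots> = (\<integral>\<^sup>+q. indicator A (h (kac_pair \<Phi> q)) \<partial>?Q)"
      by (rule nn_integral_distr_target[OF T measurable_compose[OF h borel_measurable_indicator[OF A]]])
    finally show ?thesis .
  qed
  have meas_marginal: "(\<lambda>q. indicator A (h (kac_pair \<Phi> q)) :: ennreal) \<in> borel_measurable ?Q"
    if h: "h \<in> ?SS \<rightarrow>\<^sub>M SO_borel" and A: "A \<in> sets SO_borel" for h :: "_ \<Rightarrow> 'n sqmat" and A
    using measurable_compose[OF measurable_compose[OF T h] borel_measurable_indicator[OF A]] .
  have fst_marginal: "distr ?E (kac_step \<mu>) fst = kac_step \<mu>"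
  proof (rule measure_eqI)
    fix A assume "A \<in> sets (distr ?E (kac_step \<mu>) fst)"
    then have A: "A \<in> sets SO_borel" by (simp add: sets_step)
    have "emeasure (distr ?E (kac_step \<mu>) fst) A = (\<integral>\<^sup>+z. kac_kernel_fun (fst z) A \<partial>\<eta>)"
      unfolding emeasure_marginal[OF sets_step(1) coord(1) A]
        nn_integral_with_kac_choice[OF n meas_marginal[OF coord(1) A]]
        kac_kernel_fun_def
    proof (intro nn_integral_cong arg_cong2[of _ _ _ _ "(*)"] refl sum.cong)
      fix z and p :: "'n \<times> 'n" assume z: "z \<in> space \<eta>" and "p \<in> {(i, j). i < j}"
      then obtain i j where p: "p = (i, j)" "i < j" by auto
      show "(\<integral>\<^sup>+\<theta>\<in>{0..2*pi}. indicator A (fst (kac_pair \<Phi> (z, p, \<theta>))) \<partial>lborel) =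
        (case p of (i, j) \<Rightarrow>
          \<integral>\<^sup>+\<theta>\<in>{0..2*pi}. emeasure (return SO_borel (kac_rotation i j \<theta> ** fst z)) A \<partial>lborel)"
        using p A by (simp add: kac_pair_def kac_rot_def)
    qed
    also have "\<dots> = (\<integral>\<^sup>+x. kac_kernel_fun x A \<partial>distr \<eta> \<mu> fst)"
      by (rule nn_integral_distr_target[symmetric, OF fst_snd(1)])
         (simp add: measurable_cong_sets[OF \<mu>(2) refl] measurable_kac_kernel_fun[OF n A])
    also have "\<dots> = emeasure (kac_step \<mu>) A"
      using emeasure_kac_step[OF n \<mu> A] by (simp only: \<eta>'(3))
    finally show "emeasure (distr ?E (kac_step \<mu>) fst) A = emeasure (kac_step \<mu>) A" .
  qed simp
  have shift: "(\<integral>\<^sup>+\<theta>\<in>{0..2*pi}. indicator A (kac_rotation i j (\<theta> + \<Phi> p z) ** snd z) \<partial>lborel) =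
     (\<integral>\<^sup>+\<theta>\<in>{0..2*pi}. emeasure (return SO_borel (kac_rotation i j \<theta> ** snd z)) A \<partial>lborel)"
    if "i < j" "z \<in> space \<eta>" "A \<in> sets SO_borel" for i j :: 'n and p z A
  proof -
    let ?f = "\<lambda>\<theta>. indicator A (kac_rotation i j \<theta> ** snd z) :: ennreal"
    have "snd z \<in> SO" using that(2) unfolding space_\<eta> by (rule mem_Times_iff[THEN iffD1, THEN conjunct2])
    then have "(\<lambda>\<theta>. emeasure (return SO_borel (kac_rotation i j \<theta> ** snd z)) A) \<in> borel_measurable lborel"
      using less_imp_neq[OF that(1)] that(3) by (intro measurable_kac_return')
    then have "?f \<in> borel_measurable borel"
      by (simp only: emeasure_return[OF that(3)] measurable_cong_sets[OF sets_lborel refl])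
    moreover have "?f (t + 2*pi) = ?f t" for t
      unfolding kac_rotation_def sin_periodic cos_periodic ..
    ultimately have "(\<integral>\<^sup>+\<theta>\<in>{0..2*pi}. ?f (\<theta> + \<Phi> p z) \<partial>lborel) = (\<integral>\<^sup>+\<theta>\<in>{0..2*pi}. ?f \<theta> \<partial>lborel)"
      using range[of p z] by (intro nn_integral_period_2pi) blast+
    then show ?thesis by (simp only: emeasure_return[OF that(3)])
  qed
  have snd_marginal: "distr ?E (kac_step \<nu>) snd = kac_step \<nu>"
  proof (rule measure_eqI)
    fix A assume "A \<in> sets (distr ?E (kac_step \<nu>) snd)"
    then have A: "A \<in> sets SO_borel" by (simp add: sets_step)
    have "emeasure (distr ?E (kac_step \<nu>) snd) A = (\<integral>\<^sup>+z. kac_kernel_fun (snd z) A \<partial>\<eta>)"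
      unfolding emeasure_marginal[OF sets_step(2) coord(2) A]
        nn_integral_with_kac_choice[OF n meas_marginal[OF coord(2) A]] kac_kernel_fun_def
    proof (intro nn_integral_cong arg_cong2[of _ _ _ _ "(*)"] refl sum.cong)
      fix z and p :: "'n \<times> 'n" assume z: "z \<in> space \<eta>" and "p \<in> {(i, j). i < j}"
      then obtain i j where p: "p = (i, j)" "i < j" by auto
      show "(\<integral>\<^sup>+\<theta>\<in>{0..2*pi}. indicator A (snd (kac_pair \<Phi> (z, p, \<theta>))) \<partial>lborel) =
        (case p of (i, j) \<Rightarrow>
          \<integral>\<^sup>+\<theta>\<in>{0..2*pi}. emeasure (return SO_borel (kac_rotation i j \<theta> ** snd z)) A \<partial>lborel)"
        using shift[OF p(2) z A, of "(i, j)"] by (simp add: p kac_pair_def kac_rot_def)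
    qed
    also have "\<dots> = (\<integral>\<^sup>+x. kac_kernel_fun x A \<partial>distr \<eta> \<nu> snd)"
      by (rule nn_integral_distr_target[symmetric, OF fst_snd(2)])
         (simp add: measurable_cong_sets[OF \<nu>(2) refl] measurable_kac_kernel_fun[OF n A])
    also have "\<dots> = emeasure (kac_step \<nu>) A"
      using emeasure_kac_step[OF n \<nu> A] by (simp only: \<eta>'(4))
    finally show "emeasure (distr ?E (kac_step \<nu>) snd) A = emeasure (kac_step \<nu>) A" .
  qed simp
  have "prob_space ?E"
    by (rule prob_space.prob_space_distr[OF prob_space_with_kac_choice[OF \<eta>'(1)] T])
  then show ?thesis
    using fst_marginal snd_marginal sets_pair_measure_cong[OF sets_step]
    by (simp add: couplings_def)
qed

section \<open>Nonempty sets of couplings and integrable costs\<close>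

text \<open>Makes the infimum in \<open>wasserstein2\<close> range over a nonempty set.\<close>

lemma couplings_pair_measure:
  assumes "prob_space \<mu>" "prob_space \<nu>"
  shows "\<mu> \<Otimes>\<^sub>M \<nu> \<in> couplings \<mu> \<nu>"
proof -
  interpret \<nu>: prob_space \<nu> by (rule assms(2))
  interpret \<mu>: prob_space \<mu> by (rule assms(1))
  have "distr (\<mu> \<Otimes>\<^sub>M \<nu>) \<nu> snd = \<nu>"
  proof (rule measure_eqI)
    fix A assume "A \<in> sets (distr (\<mu> \<Otimes>\<^sub>M \<nu>) \<nu> snd)"
    then have A: "A \<in> sets \<nu>" by simp
    then have "snd -` A \<inter> space (\<mu> \<Otimes>\<^sub>M \<nu>) = space \<mu> \<times> A"
      using sets.sets_into_space[OF A] by (auto simp: space_pair_measure)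
    then show "emeasure (distr (\<mu> \<Otimes>\<^sub>M \<nu>) \<nu> snd) A = emeasure \<nu> A"
      using A by (simp add: emeasure_distr \<nu>.emeasure_pair_measure_Times \<mu>.emeasure_space_1)
  qed simp
  then show ?thesis
    using \<nu>.distr_pair_fst[of \<mu>] prob_space_pair[OF assms] by (simp add: couplings_def)
qed

text \<open>Continuity is available on \<open>SO \<times> SO\<close> only, hence the detour through
  the Borel sets restricted to this product.\<close>

lemma borel_measurable_SO_dist:
  fixes \<eta> :: "('n::finite sqmat \<times> 'n sqmat) measure"
  assumes "sets \<eta> = sets (SO_borel \<Otimes>\<^sub>M SO_borel)"
  shows "(\<lambda>z. SO_dist (fst z) (snd z)) \<in> borel_measurable \<eta>"
proof -
  let ?D = "\<lambda>z :: 'n sqmat \<times> 'n sqmat. SO_dist (fst z) (snd z)"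
  have "(\<lambda>z. (fst z, snd z)) \<in> SO_borel \<Otimes>\<^sub>M SO_borel \<rightarrow>\<^sub>M (borel :: ('n sqmat \<times> 'n sqmat) measure)"
    unfolding borel_prod[symmetric]
    by (intro measurable_Pair measurable_compose[OF measurable_fst] measurable_compose[OF measurable_snd]
        measurable_restrict_space1) simp_all
  then have "(\<lambda>z. z) \<in> SO_borel \<Otimes>\<^sub>M SO_borel \<rightarrow>\<^sub>M restrict_space (borel :: ('n sqmat \<times> 'n sqmat) measure) (SO \<times> SO)"
    by (intro measurable_restrict_space2) (auto simp: space_pair_measure)
  moreover have "?D \<in> borel_measurable (restrict_space borel (SO \<times> SO))"
    by (rule borel_measurable_continuous_on_restrict[OF continuous_on_SO_dist])
  ultimately have "?D \<in> borel_measurable (SO_borel \<Otimes>\<^sub>M SO_borel)"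
    by (rule measurable_compose)
  then show ?thesis
    using assms by (simp cong: measurable_cong_sets)
qed

lemma wasserstein2_le:
  assumes "\<eta> \<in> couplings \<mu> \<nu>" "integrable \<eta> (\<lambda>z. (d (fst z) (snd z))\<^sup>2)"
  shows "wasserstein2 d \<mu> \<nu> \<le> sqrt (\<integral>z. (d (fst z) (snd z))\<^sup>2 \<partial>\<eta>)"
  unfolding wasserstein2_def
  by (rule cInf_lower) (use assms in \<open>auto intro!: bdd_belowI[of _ 0]\<close>)

lemma sets_coupling:
  assumes "\<eta> \<in> couplings \<mu> \<nu>" "sets \<mu> = sets SO_borel" "sets \<nu> = sets SO_borel"
  shows "sets \<eta> = sets (SO_borel \<Otimes>\<^sub>M SO_borel)"
  using assms(1) sets_pair_measure_cong[OF assms(2,3)] by (simp add: couplings_def)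

lemma integrable_SO_dist_sq:
  fixes \<eta> :: "('n::finite sqmat \<times> 'n sqmat) measure"
  assumes "prob_space \<eta>" "sets \<eta> = sets (SO_borel \<Otimes>\<^sub>M SO_borel)"
  shows "integrable \<eta> (\<lambda>z. (SO_dist (fst z) (snd z))\<^sup>2)"
proof -
  interpret prob_space \<eta> by (rule assms(1))
  obtain B where B: "0 < B" "\<And>x y :: 'n sqmat. x \<in> SO \<Longrightarrow> y \<in> SO \<Longrightarrow> SO_dist x y \<le> B"
    using SO_dist_bounded by blast
  have "space \<eta> = SO \<times> SO"
    using sets_eq_imp_space_eq[OF assms(2)] by (simp add: space_pair_measure)
  then have "norm ((SO_dist (fst z) (snd z))\<^sup>2) \<le> B\<^sup>2" if "z \<in> space \<eta>" for z
    using that B SO_dist_nonneg by (auto intro!: power_mono)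
  then show ?thesis
    by (intro integrable_const_bound[of _ "B\<^sup>2"] AE_I2 borel_measurable_power
        borel_measurable_SO_dist[OF assms(2)])
qed

section \<open>Cost of the coupled step\<close>

lemma one_le_choose_2: "2 \<le> n \<Longrightarrow> 1 \<le> real (n choose 2)"
  using zero_less_binomial[of 2 n] by linarith

lemma inverse_choose_2: "2 \<le> n \<Longrightarrow> 0 \<le> 1 - 1 / real (n choose 2)"
  using one_le_choose_2[of n] divide_le_eq_1_pos[of "real (n choose 2)" 1] by linarith

text \<open>By left invariance the cost in the plane p has a bound free of \<theta>, so the angular
  integral only contributes its length. The error collects \<open>4 * B * e + 4 * e\<^sup>2\<close>
  from replacing x, y by x0, y0 in the cost, and \<open>6 * B * e + 9 * e\<^sup>2\<close> from
  returning from x0, y0 to x, y in the bound on the angles.\<close>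

lemma average_kac_pair_cost:
  fixes x y x0 y0 :: "'n::{finite,linorder} sqmat"
  assumes n: "2 \<le> CARD('n)" and SO: "x \<in> SO" "y \<in> SO" "x0 \<in> SO" "y0 \<in> SO"
    and near: "SO_dist x x0 < e" "SO_dist x0 x < e" "SO_dist y y0 < e" "SO_dist y0 y < e"
    and B: "\<And>x y :: 'n sqmat. x \<in> SO \<Longrightarrow> y \<in> SO \<Longrightarrow> SO_dist x y \<le> B"
    and \<phi>: "(\<Sum>(i, j)\<in>{(i, j). i < j}. (SO_dist x0 (kac_rotation i j (\<phi> (i, j)) ** y0))\<^sup>2)
      \<le> (real (CARD('n) choose 2) - 1) * (SO_dist x0 y0 + e)\<^sup>2"
  shows "ennreal (1 / (2 * pi * real (CARD('n) choose 2))) *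
      (\<Sum>p\<in>{(i, j). i < j}. \<integral>\<^sup>+\<theta>\<in>{0..2*pi}.
        ennreal ((SO_dist (kac_rot p \<theta> ** x) (kac_rot p (\<theta> + \<phi> p) ** y))\<^sup>2) \<partial>lborel)
    \<le> ennreal ((1 - 1 / real (CARD('n) choose 2)) * (SO_dist x y)\<^sup>2 + (10 * B * e + 13 * e\<^sup>2))"
proof -
  let ?C = "real (CARD('n) choose 2)"
  let ?P = "{(i, j). i < (j::'n)}"
  have C: "1 \<le> ?C" "0 \<le> 1 - 1 / ?C"
    using one_le_choose_2[OF n] inverse_choose_2[OF n] .
  have e: "0 < e" using near(1) SO_dist_nonneg[OF SO(1,3)] by linarith
  have B0: "0 \<le> B" using B[OF SO(1,1)] SO_dist_nonneg[OF SO(1,1)] by linarith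
  define d where "d p = SO_dist x0 (kac_rot p (\<phi> p) ** y0)" for p
  have d: "0 \<le> d p" "d p \<le> B" for p
    unfolding d_def using SO by (auto intro!: SO_dist_nonneg B SO_mult kac_rot_in_SO)
  have cost: "SO_dist (kac_rot p \<theta> ** x) (kac_rot p (\<theta> + \<phi> p) ** y) \<le> d p + 2 * e" if "p \<in> ?P" for p \<theta>
  proof -
    let ?R = "kac_rot p"
    have p: "fst p < snd p" "fst p \<noteq> snd p" using that by auto
    have R: "?R (\<theta> + \<phi> p) = ?R \<theta> ** ?R (\<phi> p)"
      using p by (simp add: kac_rot_def kac_rotation_add)
    note inSO = SO SO_mult kac_rot_in_SO
    \<comment> \<open>The route runs over the rotated x0 and the rotated y0: the outer legs cost
      less than e each, the middle one at most d p.\<close>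
    have "SO_dist (?R \<theta> ** x) (?R (\<theta> + \<phi> p) ** y)
        \<le> SO_dist (?R \<theta> ** x) (?R \<theta> ** x0) + SO_dist (?R \<theta> ** x0) (?R (\<theta> + \<phi> p) ** y)"
      by (intro SO_dist_triangle inSO)
    also have "SO_dist (?R \<theta> ** x0) (?R (\<theta> + \<phi> p) ** y)
        \<le> SO_dist (?R \<theta> ** x0) (?R (\<theta> + \<phi> p) ** y0) + SO_dist (?R (\<theta> + \<phi> p) ** y0) (?R (\<theta> + \<phi> p) ** y)"
      by (intro SO_dist_triangle inSO)
    also have "SO_dist (?R \<theta> ** x) (?R \<theta> ** x0) \<le> SO_dist x x0"
      by (intro SO_dist_mult_left_le inSO)
    also have "SO_dist (?R (\<theta> + \<phi> p) ** y0) (?R (\<theta> + \<phi> p) ** y) \<le> SO_dist y0 y"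
      by (intro SO_dist_mult_left_le inSO)
    also have "SO_dist (?R \<theta> ** x0) (?R (\<theta> + \<phi> p) ** y0) \<le> d p"
      unfolding d_def R matrix_mul_assoc[symmetric] by (intro SO_dist_mult_left_le inSO)
    finally show ?thesis using near by simp
  qed
  have "(\<integral>\<^sup>+\<theta>\<in>{0..2*pi}. ennreal ((SO_dist (kac_rot p \<theta> ** x) (kac_rot p (\<theta> + \<phi> p) ** y))\<^sup>2) \<partial>lborel)
      \<le> ennreal ((d p + 2 * e)\<^sup>2 * (2 * pi))" if p: "p \<in> ?P" for p
  proof -
    have "(\<integral>\<^sup>+\<theta>\<in>{0..2*pi}. ennreal ((SO_dist (kac_rot p \<theta> ** x) (kac_rot p (\<theta> + \<phi> p) ** y))\<^sup>2) \<partial>lborel)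
        \<le> (\<integral>\<^sup>+\<theta>\<in>{0..2*pi}. ennreal ((d p + 2 * e)\<^sup>2) \<partial>lborel)"
      using SO cost[OF p]
      by (intro nn_integral_mono mult_right_mono ennreal_leI power_mono SO_dist_nonneg SO_mult kac_rot_in_SO) auto
    also have "\<dots> = ennreal ((d p + 2 * e)\<^sup>2 * (2 * pi))"
      by (simp add: nn_integral_cmult_indicator ennreal_mult')
    finally show ?thesis .
  qed
  then have "(\<Sum>p\<in>?P. \<integral>\<^sup>+\<theta>\<in>{0..2*pi}.
        ennreal ((SO_dist (kac_rot p \<theta> ** x) (kac_rot p (\<theta> + \<phi> p) ** y))\<^sup>2) \<partial>lborel)
      \<le> (\<Sum>p\<in>?P. ennreal ((d p + 2 * e)\<^sup>2 * (2 * pi)))"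
    by (rule sum_mono)
  also have "\<dots> = ennreal (\<Sum>p\<in>?P. (d p + 2 * e)\<^sup>2 * (2 * pi))"
    by (rule sum_ennreal) simp
  finally have "ennreal (1 / (2 * pi * ?C)) * (\<Sum>p\<in>?P. \<integral>\<^sup>+\<theta>\<in>{0..2*pi}.
        ennreal ((SO_dist (kac_rot p \<theta> ** x) (kac_rot p (\<theta> + \<phi> p) ** y))\<^sup>2) \<partial>lborel)
      \<le> ennreal (1 / (2 * pi * ?C)) * ennreal (\<Sum>p\<in>?P. (d p + 2 * e)\<^sup>2 * (2 * pi))"
    by (rule mult_left_mono) simp
  also have "\<dots> = ennreal (1 / (2 * pi * ?C) * (\<Sum>p\<in>?P. (d p + 2 * e)\<^sup>2 * (2 * pi)))"
    by (rule ennreal_mult'[symmetric]) simp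
  also have "1 / (2 * pi * ?C) * (\<Sum>p\<in>?P. (d p + 2 * e)\<^sup>2 * (2 * pi)) = (\<Sum>p\<in>?P. (d p + 2 * e)\<^sup>2) / ?C"
    by (simp add: sum_distrib_right[symmetric])
  also have "\<dots> \<le> (1 - 1 / ?C) * (SO_dist x y)\<^sup>2 + (10 * B * e + 13 * e\<^sup>2)"
  proof -
    have "(\<Sum>p\<in>?P. (d p + 2 * e)\<^sup>2) \<le> (\<Sum>p\<in>?P. (d p)\<^sup>2 + (4 * B * e + 4 * e\<^sup>2))"
    proof (rule sum_mono)
      fix p
      have "d p * e \<le> B * e" using d e by (intro mult_right_mono) auto
      then show "(d p + 2 * e)\<^sup>2 \<le> (d p)\<^sup>2 + (4 * B * e + 4 * e\<^sup>2)"
        by (simp add: power2_eq_square algebra_simps)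
    qed
    also have "\<dots> = (\<Sum>p\<in>?P. (d p)\<^sup>2) + ?C * (4 * B * e + 4 * e\<^sup>2)"
      by (simp add: sum.distrib card_less_pairs)
    also have "(\<Sum>p\<in>?P. (d p)\<^sup>2) = (\<Sum>(i, j)\<in>?P. (SO_dist x0 (kac_rotation i j (\<phi> (i, j)) ** y0))\<^sup>2)"
      by (intro sum.cong) (auto simp: d_def kac_rot_def)
    also have "\<dots> \<le> (?C - 1) * (SO_dist x0 y0 + e)\<^sup>2" by (rule \<phi>)
    \<comment> \<open>2 * e for exchanging the two points, and e for the slack in the hypothesis on
      the angles.\<close>
    also have "\<dots> \<le> (?C - 1) * (SO_dist x y + 3 * e)\<^sup>2"
    proof (intro mult_left_mono power_mono)
      show "SO_dist x0 y0 + e \<le> SO_dist x y + 3 * e"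
        using SO_dist_triangle[OF SO(3,1,4)] SO_dist_triangle[OF SO(1,2,4)] near by linarith
    qed (use C e SO_dist_nonneg[OF SO(3,4)] in auto)
    also have "\<dots> \<le> (?C - 1) * ((SO_dist x y)\<^sup>2 + (6 * B * e + 9 * e\<^sup>2))"
    proof (intro mult_left_mono)
      have "SO_dist x y * e \<le> B * e" using B[OF SO(1,2)] e by (intro mult_right_mono) auto
      then show "(SO_dist x y + 3 * e)\<^sup>2 \<le> (SO_dist x y)\<^sup>2 + (6 * B * e + 9 * e\<^sup>2)"
        by (simp add: power2_eq_square algebra_simps)
    qed (use C in auto)
    \<comment> \<open>C - 1 is enlarged to C in the error term, so that division by C leaves an
      error free of C.\<close>
    also have "(?C - 1) * ((SO_dist x y)\<^sup>2 + (6 * B * e + 9 * e\<^sup>2))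
        \<le> (?C - 1) * (SO_dist x y)\<^sup>2 + ?C * (6 * B * e + 9 * e\<^sup>2)"
      using B0 e by (simp add: algebra_simps)
    finally have "(\<Sum>p\<in>?P. (d p + 2 * e)\<^sup>2)
        \<le> (?C - 1) * (SO_dist x y)\<^sup>2 + ?C * (10 * B * e + 13 * e\<^sup>2)"
      by (simp add: algebra_simps)
    then have "(\<Sum>p\<in>?P. (d p + 2 * e)\<^sup>2) / ?C
        \<le> ((?C - 1) * (SO_dist x y)\<^sup>2 + ?C * (10 * B * e + 13 * e\<^sup>2)) / ?C"
      by (rule divide_right_mono) simp
    also have "\<dots> = (1 - 1 / ?C) * (SO_dist x y)\<^sup>2 + (10 * B * e + 13 * e\<^sup>2)"
    proof -
      have "((c - 1) * a + c * b) / c = (1 - 1 / c) * a + b" if "1 \<le> c" for a b c :: real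
        using that by (simp add: field_simps)
      then show ?thesis using C(1) by blast
    qed
    finally show ?thesis .
  qed
  finally show ?thesis by (simp add: ennreal_leI)
qed

text \<open>The rotation angles are chosen only for a pair of nearby representatives out of countably many, so
  that they depend measurably on the pair of points.\<close>
lemma kac_step_cost:
  fixes \<mu> \<nu> :: "'n::{finite,linorder} sqmat measure"
  assumes n: "2 \<le> CARD('n)"
    and \<mu>: "prob_space \<mu>" "sets \<mu> = sets SO_borel" and \<nu>: "prob_space \<nu>" "sets \<nu> = sets SO_borel"
    and \<eta>: "\<eta> \<in> couplings \<mu> \<nu>" and e: "0 < e"
    and B: "0 < B" "\<And>x y :: 'n sqmat. x \<in> SO \<Longrightarrow> y \<in> SO \<Longrightarrow> SO_dist x y \<le> B"
  shows "\<exists>\<eta>'\<in>couplings (kac_step \<mu>) (kac_step \<nu>).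
    (\<integral>z. (SO_dist (fst z) (snd z))\<^sup>2 \<partial>\<eta>')
      \<le> (1 - 1 / real (CARD('n) choose 2)) * (\<integral>z. (SO_dist (fst z) (snd z))\<^sup>2 \<partial>\<eta>) + (10 * B * e + 13 * e\<^sup>2)"
proof -
  let ?C = "real (CARD('n) choose 2)"
  let ?D = "\<lambda>z :: 'n sqmat \<times> 'n sqmat. (SO_dist (fst z) (snd z))\<^sup>2"
  let ?\<delta> = "10 * B * e + 13 * e\<^sup>2"
  let ?SS = "SO_borel \<Otimes>\<^sub>M SO_borel :: ('n sqmat \<times> 'n sqmat) measure"
  have C: "1 \<le> ?C" "0 \<le> 1 - 1 / ?C"
    using one_le_choose_2[OF n] inverse_choose_2[OF n] .
  have \<delta>: "0 \<le> ?\<delta>" using e B(1) by simp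
  have prob: "prob_space \<eta>" using \<eta> by (simp add: couplings_def)
  note sets_\<eta> = sets_coupling[OF \<eta> \<mu>(2) \<nu>(2)]
  have space_\<eta>: "space \<eta> = SO \<times> SO"
    using sets_eq_imp_space_eq[OF sets_\<eta>] by (simp add: space_pair_measure)
  obtain c :: "'n sqmat \<Rightarrow> nat" and r :: "nat \<Rightarrow> 'n sqmat"
    where c: "c \<in> SO_borel \<rightarrow>\<^sub>M count_space UNIV" and r: "\<And>k. r k \<in> SO"
      and near: "\<And>x. x \<in> SO \<Longrightarrow> SO_dist x (r (c x)) < e \<and> SO_dist (r (c x)) x < e"
    using SO_cells[OF e] by metis
  \<comment> \<open>One predicate for the range and the cost of the angles, so that a single choice
    over all pairs of labels gives both.\<close>
  define P where "P k l \<phi> \<longleftrightarrow> (\<forall>i j. 0 \<le> \<phi> i j \<and> \<phi> i j < 2*pi) \<and>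
    (\<Sum>(i, j)\<in>{(i, j). i < j}. (SO_dist (r k) (kac_rotation i j (\<phi> i j) ** r l))\<^sup>2)
      \<le> (?C - 1) * (SO_dist (r k) (r l) + e)\<^sup>2" for k l and \<phi> :: "'n \<Rightarrow> 'n \<Rightarrow> real"
  have "\<exists>\<phi>. P k l \<phi>" for k l
    unfolding P_def by (rule rotated_pair[OF n r r e])
  then obtain \<phi> where "\<And>k l. P k l (\<phi> k l)" by metis
  then have \<phi>: "\<And>k l i j. 0 \<le> \<phi> k l i j \<and> \<phi> k l i j < 2*pi"
    "\<And>k l. (\<Sum>(i, j)\<in>{(i, j). i < j}. (SO_dist (r k) (kac_rotation i j (\<phi> k l i j) ** r l))\<^sup>2)
      \<le> (?C - 1) * (SO_dist (r k) (r l) + e)\<^sup>2"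
    unfolding P_def by blast+
  define \<Phi> where "\<Phi> p z = \<phi> (c (fst z)) (c (snd z)) (fst p) (snd p)" for p z
  have proj: "fst \<in> \<eta> \<rightarrow>\<^sub>M SO_borel" "snd \<in> \<eta> \<rightarrow>\<^sub>M SO_borel"
    unfolding measurable_cong_sets[OF sets_\<eta> refl] by simp_all
  have cz: "(\<lambda>z. c (fst z)) \<in> \<eta> \<rightarrow>\<^sub>M count_space UNIV" "(\<lambda>z. c (snd z)) \<in> \<eta> \<rightarrow>\<^sub>M count_space UNIV"
    by (rule measurable_compose[OF proj(1) c] measurable_compose[OF proj(2) c])+
  \<comment> \<open>Any function of a label in a countable discrete space is measurable, so one
    label is fixed at a time.\<close>
  have "(\<lambda>z. \<phi> k (c (snd z)) (fst p) (snd p)) \<in> borel_measurable \<eta>" for k p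
    by (rule measurable_compose[OF cz(2)]) simp
  then have meas_\<Phi>: "\<Phi> p \<in> borel_measurable \<eta>" for p
    unfolding \<Phi>_def by (rule measurable_compose_countable[OF _ cz(1)])
  have range: "0 \<le> \<Phi> p z \<and> \<Phi> p z < 2*pi" for p z
    using \<phi>(1) by (simp add: \<Phi>_def)
  let ?Q = "with_kac_choice \<eta> :: (('n sqmat \<times> 'n sqmat) \<times> ('n \<times> 'n) \<times> real) measure"
  let ?E = "distr ?Q ?SS (kac_pair \<Phi>)"
  have E: "?E \<in> couplings (kac_step \<mu>) (kac_step \<nu>)"
    by (rule kac_pair_coupling[OF n \<mu> \<nu> \<eta> meas_\<Phi> range])
  have prob_E: "prob_space ?E" using E by (simp add: couplings_def)
  have T: "kac_pair \<Phi> \<in> ?Q \<rightarrow>\<^sub>M ?SS" by (rule measurable_kac_pair[OF sets_\<eta> meas_\<Phi>])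
  have meas_D: "(\<lambda>z. ennreal (?D z)) \<in> borel_measurable ?SS"
    by (rule measurable_compose[OF borel_measurable_power[OF borel_measurable_SO_dist[OF refl]] measurable_ennreal])
  have int: "integrable \<eta> ?D" by (rule integrable_SO_dist_sq[OF prob sets_\<eta>])
  have int_E: "integrable ?E ?D" by (rule integrable_SO_dist_sq[OF prob_E sets_distr])
  have "ennreal (\<integral>z. ?D z \<partial>?E) = (\<integral>\<^sup>+z. ennreal (?D z) \<partial>?E)"
    by (rule nn_integral_eq_integral[OF int_E, symmetric]) simp
  also have "\<dots> = (\<integral>\<^sup>+q. ennreal (?D (kac_pair \<Phi> q)) \<partial>?Q)"
    by (rule nn_integral_distr_target[OF T meas_D])
  also have "\<dots> = (\<integral>\<^sup>+z. ennreal (1 / (2 * pi * ?C)) *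
      (\<Sum>p\<in>{(i, j). i < j}. \<integral>\<^sup>+\<theta>\<in>{0..2*pi}. ennreal (?D (kac_pair \<Phi> (z, p, \<theta>))) \<partial>lborel) \<partial>\<eta>)"
    by (rule nn_integral_with_kac_choice[OF n measurable_compose[OF T meas_D]])
  also have "\<dots> \<le> (\<integral>\<^sup>+z. ennreal ((1 - 1 / ?C) * ?D z + ?\<delta>) \<partial>\<eta>)"
  proof (rule nn_integral_mono)
    fix z assume "z \<in> space \<eta>"
    then have z: "fst z \<in> SO" "snd z \<in> SO" unfolding space_\<eta> mem_Times_iff by blast+
    have "(\<Sum>(i, j)\<in>{(i, j). i < j}.
        (SO_dist (r (c (fst z))) (kac_rotation i j (\<Phi> (i, j) z) ** r (c (snd z))))\<^sup>2)
      \<le> (?C - 1) * (SO_dist (r (c (fst z))) (r (c (snd z))) + e)\<^sup>2"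
      unfolding \<Phi>_def fst_conv snd_conv by (rule \<phi>(2))
    from average_kac_pair_cost[OF n z r r near[OF z(1), THEN conjunct1] near[OF z(1), THEN conjunct2]
        near[OF z(2), THEN conjunct1] near[OF z(2), THEN conjunct2] B(2) this]
    show "ennreal (1 / (2 * pi * ?C)) *
      (\<Sum>p\<in>{(i, j). i < j}. \<integral>\<^sup>+\<theta>\<in>{0..2*pi}. ennreal (?D (kac_pair \<Phi> (z, p, \<theta>))) \<partial>lborel)
      \<le> ennreal ((1 - 1 / ?C) * ?D z + ?\<delta>)"
      unfolding kac_pair_def prod.case fst_conv snd_conv .
  qed
  also have "\<dots> = ennreal (\<integral>z. (1 - 1 / ?C) * ?D z + ?\<delta> \<partial>\<eta>)"
  proof (rule nn_integral_eq_integral)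
    interpret prob_space \<eta> by (rule prob)
    show "integrable \<eta> (\<lambda>z. (1 - 1 / ?C) * ?D z + ?\<delta>)" 
      by (intro Bochner_Integration.integrable_add integrable_mult_right int integrable_const)
    show "AE z in \<eta>. 0 \<le> (1 - 1 / ?C) * ?D z + ?\<delta>"
      by (intro AE_I2 add_nonneg_nonneg[OF mult_nonneg_nonneg[OF C(2)] \<delta>]) simp
  qed
  also have "(\<integral>z. (1 - 1 / ?C) * ?D z + ?\<delta> \<partial>\<eta>) = (1 - 1 / ?C) * (\<integral>z. ?D z \<partial>\<eta>) + ?\<delta>"
  proof -
    interpret prob_space \<eta> by (rule prob)
    show ?thesis
      by (subst Bochner_Integration.integral_add) (simp_all add: int prob_space)
  qed
  finally have "ennreal (\<integral>z. ?D z \<partial>?E) \<le> ennreal ((1 - 1 / ?C) * (\<integral>z. ?D z \<partial>\<eta>) + ?\<delta>)" .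
  moreover have "0 \<le> (1 - 1 / ?C) * (\<integral>z. ?D z \<partial>\<eta>) + ?\<delta>"
    by (intro add_nonneg_nonneg[OF mult_nonneg_nonneg[OF C(2)] \<delta>]) simp
  ultimately have "(\<integral>z. ?D z \<partial>?E) \<le> (1 - 1 / ?C) * (\<integral>z. ?D z \<partial>\<eta>) + ?\<delta>"
    by (simp only: ennreal_le_iff)
  with E show ?thesis by blast
qed

section \<open>Contraction of the Wasserstein distance\<close>

theorem lemma1:
  fixes \<mu> \<nu> :: "'n::{finite,linorder} sqmat measure"
  assumes "2 \<le> CARD('n)"
    and "prob_space \<mu>" and "sets \<mu> = sets SO_borel"
    and "prob_space \<nu>" and "sets \<nu> = sets SO_borel"
  shows "wasserstein2 SO_dist (kac_step \<mu>) (kac_step \<nu>)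
           \<le> sqrt (1 - 1 / real (CARD('n) choose 2)) * wasserstein2 SO_dist \<mu> \<nu>"
proof -
  let ?C = "real (CARD('n) choose 2)"
  let ?D = "\<lambda>z :: 'n sqmat \<times> 'n sqmat. (SO_dist (fst z) (snd z))\<^sup>2"
  let ?W = "wasserstein2 SO_dist \<mu> \<nu>" and ?W' = "wasserstein2 SO_dist (kac_step \<mu>) (kac_step \<nu>)"
  let ?\<kappa> = "sqrt (1 - 1 / ?C)"
  have C: "1 \<le> ?C" "0 \<le> 1 - 1 / ?C"
    using one_le_choose_2[OF assms(1)] inverse_choose_2[OF assms(1)] .
  have \<kappa>: "0 \<le> ?\<kappa>" "?\<kappa> \<le> 1" using C(2) by simp_all
  obtain B where B: "0 < B" "\<And>x y :: 'n sqmat. x \<in> SO \<Longrightarrow> y \<in> SO \<Longrightarrow> SO_dist x y \<le> B"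
    using SO_dist_bounded by blast
  note sets_step = sets_kac_step[OF assms(2,3)] sets_kac_step[OF assms(4,5)]
  have contract: "?W' \<le> ?\<kappa> * sqrt (\<integral>z. ?D z \<partial>\<eta>)" if \<eta>: "\<eta> \<in> couplings \<mu> \<nu>" for \<eta>
  proof -
    let ?I = "\<integral>z. ?D z \<partial>\<eta>"
    have bound: "?W' \<le> sqrt ((1 - 1 / ?C) * ?I + (10 * B * e + 13 * e\<^sup>2))" if e: "0 < e" for e
    proof -
      obtain \<eta>' where \<eta>': "\<eta>' \<in> couplings (kac_step \<mu>) (kac_step \<nu>)"
        "(\<integral>z. ?D z \<partial>\<eta>') \<le> (1 - 1 / ?C) * ?I + (10 * B * e + 13 * e\<^sup>2)"
        using kac_step_cost[OF assms \<eta> e B] by blast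
      have "integrable \<eta>' ?D"
        using \<eta>'(1) by (intro integrable_SO_dist_sq sets_coupling[OF \<eta>'(1) sets_step]) (simp add: couplings_def)
      from wasserstein2_le[OF \<eta>'(1) this] \<eta>'(2) show ?thesis
        using real_sqrt_le_mono order_trans by blast
    qed
    \<comment> \<open>The left side does not depend on e, although the coupling \<eta>' does, so the
      error disappears as e tends to 0.\<close>
    have "((\<lambda>e. sqrt ((1 - 1 / ?C) * ?I + (10 * B * e + 13 * e\<^sup>2))) \<longlongrightarrow>
        sqrt ((1 - 1 / ?C) * ?I + (10 * B * 0 + 13 * 0\<^sup>2))) (at_right 0)"
      by (intro tendsto_intros)
    then have "?W' \<le> sqrt ((1 - 1 / ?C) * ?I + (10 * B * 0 + 13 * 0\<^sup>2))"
      by (rule tendsto_lowerbound)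
         (auto intro!: eventually_at_rightI[of 0 1] bound)
    then show ?thesis by (simp add: real_sqrt_mult)
  qed
  \<comment> \<open>A nearly optimal coupling stands in for an optimal one; \<kappa> \<le> 1 keeps
    the resulting error at most e.\<close>
  have "?W' \<le> ?\<kappa> * ?W + e" if e: "0 < e" for e
  proof -
    let ?A = "{sqrt (\<integral>z. ?D z \<partial>\<eta>) | \<eta>. \<eta> \<in> couplings \<mu> \<nu> \<and> integrable \<eta> ?D}"
    have "\<mu> \<Otimes>\<^sub>M \<nu> \<in> couplings \<mu> \<nu>" by (rule couplings_pair_measure[OF assms(2,4)])
    moreover from this have "integrable (\<mu> \<Otimes>\<^sub>M \<nu>) ?D"
      by (intro integrable_SO_dist_sq sets_coupling[OF _ assms(3,5)]) (simp_all add: couplings_def)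
    ultimately have "?A \<noteq> {}" by blast
    moreover have "bdd_below ?A" by (auto intro!: bdd_belowI[of _ 0])
    moreover have "Inf ?A < ?W + e" using e by (simp add: wasserstein2_def)
    ultimately obtain \<eta> where \<eta>: "\<eta> \<in> couplings \<mu> \<nu>" "sqrt (\<integral>z. ?D z \<partial>\<eta>) < ?W + e"
      using cInf_less_iff[of ?A "?W + e"] by blast
    have "?W' \<le> ?\<kappa> * (?W + e)"
      using contract[OF \<eta>(1)] mult_left_mono[OF less_imp_le[OF \<eta>(2)] \<kappa>(1)] by linarith
    also have "\<dots> \<le> ?\<kappa> * ?W + e"
      using \<kappa>(2) e mult_right_mono[of ?\<kappa> 1 e] by (simp add: distrib_left)
    finally show ?thesis .
  qed
  then show ?thesis by (rule field_le_epsilon)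
qed

end
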